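(* Let $\mathcal{N}_{3,3}$ be the set of all inertias $\operatorname{In}(\rho^\Gamma)$, where $\rho$ ranges over all $9\times 9$ complex positive semidefinite matrices on $\mathbb{C}^3\otimes\mathbb{C}^3$ such that $\rho^\Gamma$ has at least one negative eigenvalue. Then $$\mathcal{N}_{3,3}=\{(1,0,8),(1,1,7),(1,2,6),(1,3,5),(1,4,4),(1,5,3),(2,0,7),(2,1,6),(2,2,5),(2,3,4),(3,0,6),(3,1,5),(4,0,5)\}.$$
   Context: For a Hermitian matrix $H$, the inertia is $\operatorname{In}(H)=(a,b,c)$, where $a,b,c$ are the numbers (with multiplicity) of negative, zero and positive eigenvalues of $H$, in this order. A matrix $M\in\mathbb{C}^{mn\times mn}$ on $\mathbb{C}^m\otimes\mathbb{C}^n$ is written as an $m\times m$ block matrix $M=[M_{ij}]$ with blocks $M_{ij}\in\mathbb{C}^{n\times n}$; its partial transpose (on the first system) is $M^\Gamma=[M_{ji}]$, i.e. the block matrix whose $(i,j)$ block is $M_{ji}$. States are positive semidefinite matrices (not necessarily normalized). *)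

theory Defs
  imports "Jordan_Normal_Form.Schur_Decomposition" "Jordan_Normal_Form.Char_Poly"
begin

text \<open>The order on \<^typ>\<open>complex\<close> is that of \<^theory>\<open>HOL-Library.Complex_Order\<close>:
  \<open>0 \<le> z\<close>, \<open>0 < z\<close> and \<open>z < 0\<close> each include the assertion that \<open>z\<close> is real.\<close>

definition hermitian_mat :: "complex mat \<Rightarrow> bool" where
  "hermitian_mat A \<longleftrightarrow> mat_adjoint A = A"

definition psd_mat :: "complex mat \<Rightarrow> bool" where
  "psd_mat A \<longleftrightarrow> hermitian_mat A \<and> (\<forall>v \<in> carrier_vec (dim_row A). 0 \<le> (A *\<^sub>v v) \<bullet>c v)"

text \<open>Negative, zero and positive eigenvalues, in this order; \<^const>\<open>proots\<close> is the multiset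
  of roots. Multiplicities are algebraic, which for Hermitian matrices are also the geometric ones.\<close>

definition inertia :: "complex mat \<Rightarrow> nat \<times> nat \<times> nat" where
  "inertia H =
    (size {# x \<in># proots (char_poly H). x < 0 #},
     size {# x \<in># proots (char_poly H). x = 0 #},
     size {# x \<in># proots (char_poly H). x > 0 #})"

text \<open>The basis vector \<open>e\<^sub>i \<otimes> e\<^sub>k\<close> of the tensor product has index \<open>i * n + k\<close>
  (all indices start at 0), so the block \<open>(i, j)\<close> consists of the entries
  \<open>(i * n + k, j * n + l)\<close> for \<open>k, l < n\<close>.\<close>

definition mat_block :: "nat \<Rightarrow> 'a mat \<Rightarrow> nat \<Rightarrow> nat \<Rightarrow> 'a mat" where
  "mat_block n M i j = mat n n (\<lambda>(k, l). M $$ (i * n + k, j * n + l))"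

definition partial_transpose :: "nat \<Rightarrow> nat \<Rightarrow> 'a mat \<Rightarrow> 'a mat" where
  "partial_transpose m n M = mat (m * n) (m * n)
     (\<lambda>(r, c). mat_block n M (c div n) (r div n) $$ (r mod n, c mod n))"

lemma partial_transpose_carrier [simp]:
  "partial_transpose m n M \<in> carrier_mat (m * n) (m * n)"
  by (simp add: partial_transpose_def)

lemma block_index_less:
  fixes i k m n :: nat
  assumes "i < m" "k < n"
  shows "i * n + k < m * n"
proof -
  have "i * n + k < Suc i * n" using assms by simp
  also have "\<dots> \<le> m * n" using assms by (intro mult_le_mono1) simp
  finally show ?thesis .
qed

lemma mat_block_partial_transpose:
  assumes "i < m" "j < m"
  shows "mat_block n (partial_transpose m n M) i j = mat_block n M j i"
  using assms
  by (intro eq_matI) (auto simp: mat_block_def partial_transpose_def block_index_less)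

definition npt_inertias :: "nat \<Rightarrow> nat \<Rightarrow> (nat \<times> nat \<times> nat) set" where
  "npt_inertias m n =
    {inertia (partial_transpose m n \<rho>) | \<rho>.
       \<rho> \<in> carrier_mat (m * n) (m * n) \<and> psd_mat \<rho> \<and>
       (\<exists>x. eigenvalue (partial_transpose m n \<rho>) x \<and> x < 0)}"

end

theory Submission
  imports Defs "Jordan_Normal_Form.Spectral_Radius"
begin

text \<open>Let \<open>H\<close> be the partial transpose of the state \<open>\<rho>\<close>, with \<open>a\<close> negative and \<open>c\<close> positive eigenvalues.
  The inclusion from left to right says that \<open>c \<ge> min (a + 2) 5\<close> whenever \<open>a \<ge> 1\<close>. If \<open>c \<le> 4\<close>,
  the orthogonal complement of the positive eigenvectors contains a product vector \<open>x \<otimes> y\<close>. As \<open>H\<close> is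
  nonnegative on product vectors, \<open>x \<otimes> y\<close> lies in the kernel of \<open>H\<close>, and its conjugate in the first
  factor lies in the kernel of \<open>\<rho>\<close>. In bases adapted to \<open>x\<close> and \<open>y\<close>, the compressions of \<open>H\<close>
  to \<open>x \<otimes> y\<^sup>\<bottom>\<close> and to \<open>x\<^sup>\<bottom> \<otimes> y\<close> become diagonal with entries 0 and 1. If no entry vanishes, they
  provide four positive directions, and the Schur complement of \<open>H\<close> on \<open>x\<^sup>\<bottom> \<otimes> y\<^sup>\<bottom>\<close> has the same trace
  as that of \<open>\<rho>\<close>; so it is 0 or provides a fifth. If some entries vanish, either isotropic vectors of
  \<open>H\<close> yield hyperbolic planes, or the state is reduced to one on \<open>2 \<times> 3\<close>, and there to \<open>2 \<times> 2\<close> and \<open>1 \<times> n\<close>,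
  where the same argument applies. For the converse inclusion, sparse states are chosen such that \<open>H\<close>
  is a direct sum of blocks of size at most 2.\<close>

section \<open>Sesquilinear forms and their signs\<close>


text \<open>The product vectors form a variety of dimension \<open>m + n - 2\<close>, which is 4 for
  two qutrits. With at most \<open>m + n - 2\<close> positive directions a kernel product vector is
  unavoidable, and a nondegenerate one yields \<open>m + n - 1\<close> of them unless
  \<open>H\<close> is nonnegative. The two thresholds match, so one scheme serves for 3 x 3, 2 x 3
  and 2 x 2. The obstacle is degeneracy: a zero entry in a local block removes one of the axes that
  are counted, and the loss has to be made up by a hyperbolic plane or by shrinking the system. In
  one configuration, where both local blocks have rank one and neither coupling passes through
  \<open>(a1, b1)\<close>, only four positive directions are produced, and a third negative
  direction is excluded instead. Hence the bound is proved as three implications, according to the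
  number of negative directions. Forms on arbitrary index sets replace matrices because factors are
  exchanged and lose indices along the way.\<close>

definition sform :: "'i set \<Rightarrow> ('i \<Rightarrow> 'i \<Rightarrow> complex) \<Rightarrow> ('i \<Rightarrow> complex) \<Rightarrow> ('i \<Rightarrow> complex) \<Rightarrow> complex" where
  "sform J M u v = (\<Sum>a\<in>J. \<Sum>b\<in>J. cnj (u a) * M a b * v b)"

abbreviation qform :: "'i set \<Rightarrow> ('i \<Rightarrow> 'i \<Rightarrow> complex) \<Rightarrow> ('i \<Rightarrow> complex) \<Rightarrow> real" where
  "qform J M v \<equiv> Re (sform J M v v)"

abbreviation lincomb :: "'p set \<Rightarrow> ('p \<Rightarrow> complex) \<Rightarrow> ('p \<Rightarrow> 'i \<Rightarrow> complex) \<Rightarrow> 'i \<Rightarrow> complex" where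
  "lincomb P c w \<equiv> (\<lambda>a. \<Sum>p\<in>P. c p * w p a)"

definition herm_on :: "'i set \<Rightarrow> ('i \<Rightarrow> 'i \<Rightarrow> complex) \<Rightarrow> bool" where
  "herm_on J M \<longleftrightarrow> (\<forall>a\<in>J. \<forall>b\<in>J. M b a = cnj (M a b))"

definition psd_on :: "'i set \<Rightarrow> ('i \<Rightarrow> 'i \<Rightarrow> complex) \<Rightarrow> bool" where
  "psd_on J M \<longleftrightarrow> herm_on J M \<and> (\<forall>v. 0 \<le> qform J M v)"

text \<open>Lower bounds on the number of positive eigenvalues are built up as orthogonal systems, vector
  by vector, whereas negativity is only ever used through a whole negative definite subspace. Hence
  the different shapes of \<open>pos_ge\<close> and \<open>neg_ge\<close>.\<close>

definition orth_pos :: "'i set \<Rightarrow> ('i \<Rightarrow> 'i \<Rightarrow> complex) \<Rightarrow> ('i \<Rightarrow> complex) set \<Rightarrow> bool" where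
  "orth_pos J M U \<longleftrightarrow> finite U \<and> (\<forall>u\<in>U. 0 < qform J M u) \<and>
     (\<forall>u\<in>U. \<forall>v\<in>U. u \<noteq> v \<longrightarrow> sform J M u v = 0)"

definition pos_ge :: "'i set \<Rightarrow> ('i \<Rightarrow> 'i \<Rightarrow> complex) \<Rightarrow> nat \<Rightarrow> bool" where
  "pos_ge J M k \<longleftrightarrow> (\<exists>U. orth_pos J M U \<and> k \<le> card U)"

definition neg_ge :: "'i set \<Rightarrow> ('i \<Rightarrow> 'i \<Rightarrow> complex) \<Rightarrow> nat \<Rightarrow> bool" where
  "neg_ge J M k \<longleftrightarrow> (\<exists>w :: nat \<Rightarrow> 'i \<Rightarrow> complex. \<forall>c. (\<exists>p<k. c p \<noteq> 0) \<longrightarrow>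
     qform J M (lincomb {..<k} c w) < 0)"

abbreviation axis :: "'i \<Rightarrow> 'i \<Rightarrow> complex" where
  "axis a \<equiv> (\<lambda>b. if b = a then 1 else 0)"

lemma sform_cong:
  "(\<And>a. a \<in> J \<Longrightarrow> u a = u' a) \<Longrightarrow> (\<And>a. a \<in> J \<Longrightarrow> v a = v' a) \<Longrightarrow>
   (\<And>a b. a \<in> J \<Longrightarrow> b \<in> J \<Longrightarrow> M a b = M' a b) \<Longrightarrow> sform J M u v = sform J M' u' v'"
  unfolding sform_def by (intro sum.cong refl) auto

lemma sform_add_right: "sform J M u (\<lambda>a. v a + w a) = sform J M u v + sform J M u w"
  by (simp add: sform_def distrib_left sum.distrib)

lemma sform_add_left: "sform J M (\<lambda>a. v a + w a) u = sform J M v u + sform J M w u"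
  by (simp add: sform_def distrib_right distrib_left sum.distrib)

lemma sform_diff_right: "sform J M u (\<lambda>a. v a - w a) = sform J M u v - sform J M u w"
  by (simp add: sform_def right_diff_distrib sum_subtractf)

lemma sform_diff_left: "sform J M (\<lambda>a. v a - w a) u = sform J M v u - sform J M w u"
  by (simp add: sform_def left_diff_distrib sum_subtractf)

lemma sform_scale_right: "sform J M u (\<lambda>a. c * v a) = c * sform J M u v"
  by (simp add: sform_def sum_distrib_left mult_ac)

lemma sform_scale_left: "sform J M (\<lambda>a. c * v a) u = cnj c * sform J M v u"
  by (simp add: sform_def sum_distrib_left mult_ac)

lemma sform_zero_right: "sform J M u (\<lambda>a. 0) = 0" by (simp add: sform_def)

lemma sform_zero_left: "sform J M (\<lambda>a. 0) u = 0" by (simp add: sform_def)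

lemma sform_sum_right:
  "sform J M u (lincomb P c w) = (\<Sum>p\<in>P. c p * sform J M u (w p))"
  by (induction P rule: infinite_finite_induct)
     (simp_all add: sform_zero_right sform_add_right sform_scale_right)

lemma sform_sum_left:
  "sform J M (lincomb P c w) u = (\<Sum>p\<in>P. cnj (c p) * sform J M (w p) u)"
  by (induction P rule: infinite_finite_induct)
     (simp_all add: sform_zero_left sform_add_left sform_scale_left)

lemmas sform_linear = sform_add_right sform_add_left sform_diff_right sform_diff_left
  sform_scale_right sform_scale_left sform_sum_right sform_sum_left

lemma sform_sum_sum:
  "sform J M (lincomb P c w) (lincomb Q d x) =
   (\<Sum>p\<in>P. \<Sum>q\<in>Q. cnj (c p) * sform J M (w p) (x q) * d q)"
  unfolding sform_sum_left sform_sum_right sum_distrib_left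
  by (intro sum.cong refl) (simp add: mult_ac)

lemma herm_onD: "herm_on J M \<Longrightarrow> a \<in> J \<Longrightarrow> b \<in> J \<Longrightarrow> cnj (M a b) = M b a"
  by (metis herm_on_def)

lemma sform_swap: "herm_on J M \<Longrightarrow> sform J M v u = cnj (sform J M u v)"
proof -
  assume h: "herm_on J M"
  have "cnj (sform J M u v) = (\<Sum>a\<in>J. \<Sum>b\<in>J. cnj (v b) * M b a * u a)"
    unfolding sform_def cnj_sum by (intro sum.cong refl) (simp add: herm_onD[OF h] mult_ac)
  also have "\<dots> = sform J M v u" unfolding sform_def by (rule sum.swap)
  finally show ?thesis by simp
qed

lemma sform_real: "herm_on J M \<Longrightarrow> Im (sform J M v v) = 0"
  by (metis sform_swap Reals_cnj_iff complex_is_Real_iff)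

lemma sform_axis_left:
  assumes "finite J" "a \<in> J" shows "sform J M (axis a) v = (\<Sum>b\<in>J. M a b * v b)"
proof -
  have "sform J M (axis a) v = (\<Sum>b\<in>J. \<Sum>x\<in>J. if x = a then M a b * v b else 0)"
    unfolding sform_def by (subst sum.swap) (intro sum.cong refl, auto)
  then show ?thesis using assms by simp
qed

lemma sform_axis:
  assumes "finite J" "a \<in> J" "b \<in> J" shows "sform J M (axis a) (axis b) = M a b"
proof -
  have "(\<Sum>x\<in>J. M a x * (if x = b then 1 else 0)) = (\<Sum>x\<in>J. if x = b then M a b else 0)"
    by (intro sum.cong) auto
  then show ?thesis using assms by (simp add: sform_axis_left)
qed

lemma sum_axis:
  assumes "finite J" "a \<in> J" shows "(\<Sum>b\<in>J. v b * axis b a) = v a"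
proof -
  have "(\<Sum>b\<in>J. v b * axis b a) = (\<Sum>b\<in>J. if b = a then v a else 0)"
    by (intro sum.cong) auto
  then show ?thesis using assms by simp
qed

lemma psd_on_herm: "psd_on J M \<Longrightarrow> herm_on J M" by (simp add: psd_on_def)

lemma psd_on_nonneg: "psd_on J M \<Longrightarrow> 0 \<le> qform J M v" by (simp add: psd_on_def)

lemma psd_not_neg_ge: "(\<And>v. 0 \<le> qform J M v) \<Longrightarrow> 0 < k \<Longrightarrow> \<not> neg_ge J M k"
proof
  assume p: "\<And>v. 0 \<le> qform J M v" and k: "0 < k" and "neg_ge J M k"
  then obtain w where w: "\<And>c. (\<exists>p<k. c p \<noteq> 0) \<Longrightarrow>
      qform J M (lincomb {..<k} c w) < 0" unfolding neg_ge_def by blast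
  show False using w[of "\<lambda>_. 1"] p k by (auto simp: not_less[symmetric])
qed

lemma orth_pos_inner_nz: "orth_pos J M U \<Longrightarrow> u \<in> U \<Longrightarrow> sform J M u u \<noteq> 0"
  by (auto simp: orth_pos_def)

lemma orth_pos_insert:
  assumes h: "herm_on J M" and U: "orth_pos J M U" and v: "0 < qform J M v"
    and o: "\<And>u. u \<in> U \<Longrightarrow> sform J M u v = 0"
  shows "orth_pos J M (insert v U)" "v \<notin> U"
proof -
  show "v \<notin> U" using o v by auto
  have "sform J M v u = 0" if "u \<in> U" for u using o[OF that] sform_swap[OF h, of v u] by simp
  then show "orth_pos J M (insert v U)" using U v o by (auto simp: orth_pos_def)
qed

lemma pos_ge_mono: "pos_ge J M k \<Longrightarrow> j \<le> k \<Longrightarrow> pos_ge J M j"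
  by (auto simp: pos_ge_def)

lemma neg_ge_mono:
  assumes "neg_ge J M k" "j \<le> k" shows "neg_ge J M j"
proof -
  obtain w where w: "\<And>c. (\<exists>p<k. c p \<noteq> 0) \<Longrightarrow>
      qform J M (lincomb {..<k} c w) < 0" using assms(1) unfolding neg_ge_def by blast
  have "qform J M (lincomb {..<j} c w) < 0"
    if "\<exists>p<j. c p \<noteq> 0" for c
  proof -
    have e: "(\<Sum>p<k. (if p < j then c p else 0) * w p a) = (\<Sum>p<j. c p * w p a)" for a
      using assms(2) by (intro sum.mono_neutral_cong_right) auto
    obtain p where "p < j" "c p \<noteq> 0" using \<open>\<exists>p<j. c p \<noteq> 0\<close> by auto
    then have "\<exists>p<k. (if p < j then c p else 0) \<noteq> 0" using assms(2) by (intro exI[of _ p]) auto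
    then show ?thesis using w[of "\<lambda>p. if p < j then c p else 0"] unfolding e by simp
  qed
  then show ?thesis unfolding neg_ge_def by blast
qed

lemma sform_orthogonal_combination:
  assumes "finite P" and o: "\<And>p q. p \<in> P \<Longrightarrow> q \<in> P \<Longrightarrow> p \<noteq> q \<Longrightarrow> sform J M (w p) (w q) = 0"
  shows "sform J M (lincomb P c w) (lincomb P c w)
    = (\<Sum>p\<in>P. of_real ((cmod (c p))\<^sup>2) * sform J M (w p) (w p))"
  unfolding sform_sum_sum
proof (rule sum.cong[OF refl])
  fix p assume p: "p \<in> P"
  have "(\<Sum>q\<in>P. cnj (c p) * sform J M (w p) (w q) * c q) =
      (\<Sum>q\<in>P. if q = p then of_real ((cmod (c p))\<^sup>2) * sform J M (w p) (w p) else 0)"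
    using o[OF p] by (intro sum.cong refl) (auto simp: complex_norm_square mult_ac simp del: of_real_power)
  then show "(\<Sum>q\<in>P. cnj (c p) * sform J M (w p) (w q) * c q) = of_real ((cmod (c p))\<^sup>2) * sform J M (w p) (w p)"
    using assms(1) p by simp
qed

definition oproj :: "'i set \<Rightarrow> ('i \<Rightarrow> 'i \<Rightarrow> complex) \<Rightarrow> ('i \<Rightarrow> complex) set \<Rightarrow> ('i \<Rightarrow> complex) \<Rightarrow> 'i \<Rightarrow> complex" where
  "oproj J M U w = (\<lambda>a. w a - (\<Sum>u\<in>U. sform J M u w / sform J M u u * u a))"

lemma sform_oproj_right:
  "sform J M x (oproj J M U w) = sform J M x w - (\<Sum>u\<in>U. sform J M u w / sform J M u u * sform J M x u)"
  unfolding oproj_def sform_diff_right sform_sum_right ..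

lemma sform_oproj_member:
  assumes "orth_pos J M U" "x \<in> U"
  shows "sform J M x (oproj J M U w) = 0"
proof -
  have "(\<Sum>u\<in>U. sform J M u w / sform J M u u * sform J M x u) = (\<Sum>u\<in>U. if u = x then sform J M x w else 0)"
    using assms orth_pos_inner_nz[OF assms] by (intro sum.cong refl) (auto simp: orth_pos_def)
  then show ?thesis using assms by (simp add: sform_oproj_right orth_pos_def)
qed

text \<open>If \<open>z\<close> is isotropic and pairs nontrivially with \<open>w\<close>, the two
  span a hyperbolic plane: adding a large multiple of \<open>z\<close> to \<open>w\<close> lets the
  cross term outweigh the square of \<open>w\<close>. As \<open>z\<close> is orthogonal to
  \<open>U\<close>, only \<open>w\<close> has to be corrected. The last conclusion records that
  \<open>v\<close> lies in the span of \<open>z\<close>, \<open>w\<close> and \<open>U\<close>, so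
  that a second isotropic vector orthogonal to these can be used afterwards.\<close>

lemma orth_pos_insert_isotropic:
  assumes h: "herm_on J M" and U: "orth_pos J M U" and zU: "\<And>u. u \<in> U \<Longrightarrow> sform J M u z = 0"
    and z: "sform J M z z = 0" and zw: "sform J M z w \<noteq> 0"
  obtains v where "orth_pos J M (insert v U)" "v \<notin> U"
    "\<And>y. (\<And>u. u \<in> U \<Longrightarrow> sform J M y u = 0) \<Longrightarrow> sform J M y z = 0 \<Longrightarrow> sform J M y w = 0 \<Longrightarrow> sform J M y v = 0"
proof -
  define w' where "w' = oproj J M U w"
  define s where "s = sform J M z w"
  have zU': "sform J M z u = 0" if "u \<in> U" for u
    using zU[OF that] sform_swap[OF h, of z u] by simp
  have zw': "sform J M z w' = s" by (simp add: w'_def sform_oproj_right zU' s_def)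
  have wz': "sform J M w' z = cnj s" using sform_swap[OF h, of w' z] zw' by simp
  define x where "x = qform J M w'"
  \<comment> \<open>Chosen so that the cross terms contribute
    \<open>2 * (1 + \<bar>x\<bar>)\<close>, which exceeds \<open>- x\<close>.\<close>
  define t where "t = (1 + \<bar>x\<bar>) / (cmod s)\<^sup>2"
  define v where "v = (\<lambda>a. (of_real t * s) * z a + w' a)"
  have s0: "cmod s \<noteq> 0" using zw s_def by simp
  have "sform J M v v = of_real t * (cnj s * s) + of_real t * (s * cnj s) + sform J M w' w'"
    by (simp add: v_def sform_linear z zw' wz' algebra_simps)
  also have "\<dots> = of_real (2 * t * (cmod s)\<^sup>2) + sform J M w' w'"
    by (simp add: complex_norm_square[symmetric] mult.commute)
  finally have "qform J M v = 2 * t * (cmod s)\<^sup>2 + x" by (simp add: x_def)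
  also have "\<dots> = 2 * (1 + \<bar>x\<bar>) + x" using s0 by (simp add: t_def)
  finally have pos: "0 < qform J M v" by (simp add: abs_if split: if_splits)
  have o: "sform J M u v = 0" if "u \<in> U" for u
    using that zU[OF that] sform_oproj_member[OF U that, of w] by (simp add: v_def sform_linear w'_def)
  show ?thesis
  proof (rule that)
    show "orth_pos J M (insert v U)" "v \<notin> U" using orth_pos_insert[OF h U pos o] by auto
    show "sform J M y v = 0" if "\<And>u. u \<in> U \<Longrightarrow> sform J M y u = 0" "sform J M y z = 0" "sform J M y w = 0" for y
      using that by (simp add: v_def sform_linear w'_def sform_oproj_right)
  qed
qed

text \<open>Gaussian elimination by induction on the equations: \<open>N\<close> is the system left
  after eliminating the unknown \<open>q\<close> with the equation \<open>e\<close>, and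
  \<open>d\<close> restores the value at \<open>q\<close>. The index types are arbitrary, so that
  equations may be indexed by vectors as well as by coordinates.\<close>

lemma homogeneous_system:
  fixes M :: "'e \<Rightarrow> 'p \<Rightarrow> complex"
  assumes "finite E" "finite P" "card E < card P"
  shows "\<exists>c. (\<exists>p\<in>P. c p \<noteq> 0) \<and> (\<forall>e\<in>E. (\<Sum>p\<in>P. c p * M e p) = 0)"
  using assms
proof (induction E arbitrary: P M rule: finite_induct)
  case empty
  then obtain p where "p \<in> P" by fastforce
  then show ?case by (intro exI[of _ "\<lambda>_. 1"]) auto
next
  case (insert e E)
  show ?case
  proof (cases "\<forall>p\<in>P. M e p = 0")
    case True
    then show ?thesis using insert.IH[of P M] insert.prems insert.hyps by auto
  next
    case False
    then obtain q where q: "q \<in> P" "M e q \<noteq> 0" by auto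
    define N where "N = (\<lambda>f p. M f p - M f q / M e q * M e p)"
    have "card E < card (P - {q})" using insert.prems insert.hyps q by simp
    then obtain c where c: "\<exists>p\<in>P - {q}. c p \<noteq> 0" "\<forall>f\<in>E. (\<Sum>p\<in>P - {q}. c p * N f p) = 0"
      using insert.IH[of "P - {q}" N] insert.prems by auto
    define S where "S = (\<lambda>f. \<Sum>p\<in>P - {q}. c p * M f p)"
    define d where "d = c(q := - S e / M e q)"
    have d: "(\<Sum>p\<in>P. d p * M f p) = S f - S e / M e q * M f q" for f
    proof -
      have "(\<Sum>p\<in>P - {q}. d p * M f p) = S f" unfolding S_def d_def by (intro sum.cong) auto
      then show ?thesis using q insert.prems by (subst sum.remove[of _ q]) (auto simp: d_def)
    qed
    have "(\<Sum>p\<in>P. d p * M f p) = 0" if "f \<in> E" for f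
    proof -
      have "0 = (\<Sum>p\<in>P - {q}. c p * M f p - M f q / M e q * (c p * M e p))"
        using c(2)[rule_format, OF that] unfolding N_def by (simp add: right_diff_distrib mult_ac)
      also have "\<dots> = S f - M f q / M e q * S e"
        by (simp add: S_def sum_subtractf sum_distrib_left)
      finally show ?thesis by (simp add: d mult.commute)
    qed
    moreover have "(\<Sum>p\<in>P. d p * M e p) = 0" using q by (simp add: d)
    moreover have "\<exists>p\<in>P. d p \<noteq> 0" using c(1) unfolding d_def by auto
    ultimately show ?thesis by auto
  qed
qed

text \<open>A positive definite subspace and a nonpositive one meet only in 0. If the dimensions
  were too large, there would be a nontrivial relation \<open>x = y\<close> with \<open>x\<close> in
  the first and \<open>y\<close> in the second. The common value of the form must vanish, which
  kills the coefficients on \<open>U\<close>, and independence kills the others.\<close>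

lemma pos_nonpos_dim:
  assumes J: "finite J" and U: "orth_pos J M U" and R: "finite R"
    and le: "\<And>c. qform J M (lincomb R c w) \<le> 0"
    and indep: "\<And>c. (\<And>a. a \<in> J \<Longrightarrow> (\<Sum>q\<in>R. c q * w q a) = 0) \<Longrightarrow> \<forall>q\<in>R. c q = 0"
  shows "card U + card R \<le> card J"
proof (rule ccontr)
  let ?v = "\<lambda>a p. case p of Inl u \<Rightarrow> u a | Inr q \<Rightarrow> - w q a"
  assume less: "\<not> ?thesis"
  have fU: "finite U" using U by (simp add: orth_pos_def)
  have "card J < card (U <+> R)" using less fU R by (simp add: card_Plus)
  then obtain c where c: "\<exists>p\<in>U <+> R. c p \<noteq> 0" "\<forall>a\<in>J. (\<Sum>p\<in>U <+> R. c p * ?v a p) = 0"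
    using homogeneous_system[of J "U <+> R" ?v] J fU R by auto
  define x where "x = (\<lambda>a. \<Sum>u\<in>U. c (Inl u) * u a)"
  define y where "y = (\<lambda>a. \<Sum>q\<in>R. c (Inr q) * w q a)"
  have xy: "x a = y a" if "a \<in> J" for a
    using c(2) that fU R by (simp add: sum.Plus x_def y_def sum_negf)
  have nn: "0 \<le> (cmod (c (Inl u)))\<^sup>2 * qform J M u" if "u \<in> U" for u
    using U that by (auto simp: orth_pos_def intro: less_imp_le)
  have "sform J M x x = (\<Sum>u\<in>U. of_real ((cmod (c (Inl u)))\<^sup>2) * sform J M u u)"
    unfolding x_def using U by (intro sform_orthogonal_combination) (auto simp: orth_pos_def)
  then have Rx: "qform J M x = (\<Sum>u\<in>U. (cmod (c (Inl u)))\<^sup>2 * qform J M u)" by simp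
  have "sform J M x x = sform J M y y" using xy by (intro sform_cong) auto
  then have "qform J M x \<le> 0" unfolding y_def by (simp only: le)
  then have "(\<Sum>u\<in>U. (cmod (c (Inl u)))\<^sup>2 * qform J M u) = 0"
    unfolding Rx using nn by (intro antisym sum_nonneg)
  then have "\<forall>u\<in>U. (cmod (c (Inl u)))\<^sup>2 * qform J M u = 0"
    using sum_nonneg_eq_0_iff[OF fU nn] by simp
  then have cU: "\<forall>u\<in>U. c (Inl u) = 0" using U by (force simp: orth_pos_def)
  have "(\<Sum>q\<in>R. c (Inr q) * w q a) = 0" if "a \<in> J" for a
    using xy[OF that] cU by (simp add: x_def y_def)
  then have "\<forall>q\<in>R. c (Inr q) = 0" by (rule indep)
  then show False using c(1) cU by auto
qed

lemma pos_neg_dim: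
  assumes J: "finite J" and p: "pos_ge J M k" and n: "neg_ge J M l"
  shows "k + l \<le> card J"
proof -
  obtain U where U: "orth_pos J M U" "k \<le> card U" using p unfolding pos_ge_def by auto
  obtain w where w: "\<And>c. (\<exists>p<l. c p \<noteq> 0) \<Longrightarrow>
      qform J M (lincomb {..<l} c w) < 0" using n unfolding neg_ge_def by blast
  have "card U + card {..<l} \<le> card J"
  proof (rule pos_nonpos_dim[OF J U(1)])
    fix c :: "nat \<Rightarrow> complex"
    show "qform J M (lincomb {..<l} c w) \<le> 0"
      using w[of c] by (cases "\<exists>p<l. c p \<noteq> 0") (auto simp: sform_zero_left)
    assume "\<And>a. a \<in> J \<Longrightarrow> (\<Sum>p<l. c p * w p a) = 0"
    then have "sform J M (lincomb {..<l} c w) (lincomb {..<l} c w) = 0" by (simp add: sform_def)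
    then show "\<forall>p\<in>{..<l}. c p = 0" using w[of c] by auto
  qed simp
  then show ?thesis using U(2) by simp
qed

section \<open>Partial transposes and product vectors in the kernel\<close>


definition pt :: "('a \<times> 'b \<Rightarrow> 'a \<times> 'b \<Rightarrow> complex) \<Rightarrow> 'a \<times> 'b \<Rightarrow> 'a \<times> 'b \<Rightarrow> complex" where
  "pt r a b = r (fst b, snd a) (fst a, snd b)"

definition tensor :: "('a \<Rightarrow> complex) \<Rightarrow> ('b \<Rightarrow> complex) \<Rightarrow> 'a \<times> 'b \<Rightarrow> complex" where
  "tensor x y a = x (fst a) * y (snd a)"

text \<open>Exchanging the tensor factors is combined with a transposition, so that the partial transpose
  is merely reindexed.\<close>

definition swp :: "('a \<times> 'b \<Rightarrow> 'a \<times> 'b \<Rightarrow> complex) \<Rightarrow> 'b \<times> 'a \<Rightarrow> 'b \<times> 'a \<Rightarrow> complex" where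
  "swp r a b = r (prod.swap b) (prod.swap a)"

lemma pt_pair [simp]: "pt r (i, k) (j, l) = r (j, k) (i, l)" by (simp add: pt_def)

lemma swp_pair [simp]: "swp r (k, i) (l, j) = r (j, l) (i, k)" by (simp add: swp_def)

lemma tensor_pair [simp]: "tensor x y (i, k) = x i * y k" by (simp add: tensor_def)

abbreviation pos_pt :: "'a set \<Rightarrow> 'b set \<Rightarrow> ('a \<times> 'b \<Rightarrow> 'a \<times> 'b \<Rightarrow> complex) \<Rightarrow> nat \<Rightarrow> bool" where
  "pos_pt A B r \<equiv> pos_ge (A \<times> B) (pt r)"

abbreviation neg_pt :: "'a set \<Rightarrow> 'b set \<Rightarrow> ('a \<times> 'b \<Rightarrow> 'a \<times> 'b \<Rightarrow> complex) \<Rightarrow> nat \<Rightarrow> bool" where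
  "neg_pt A B r \<equiv> neg_ge (A \<times> B) (pt r)"

lemma herm_on_pt:
  assumes "herm_on (A \<times> B) r" shows "herm_on (A \<times> B) (pt r)"
proof (unfold herm_on_def, intro ballI)
  fix a b assume "a \<in> A \<times> B" "b \<in> A \<times> B"
  then show "pt r b a = cnj (pt r a b)"
    unfolding pt_def by (subst herm_onD[OF assms]) (auto simp: mem_Times_iff)
qed

lemma herm_on_swp:
  assumes "herm_on (A \<times> B) r" shows "herm_on (B \<times> A) (swp r)"
proof (unfold herm_on_def, intro ballI)
  fix a b assume "a \<in> B \<times> A" "b \<in> B \<times> A"
  then show "swp r b a = cnj (swp r a b)" unfolding swp_def by (subst herm_onD[OF assms]) auto
qed

text \<open>The bridge between \<open>H\<close> and the state: on product vectors, partial
  transposition exchanges the two first factors and conjugates them. Equal arguments give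
  nonnegativity on product vectors; basis vectors show how a change of product basis acts on the
  state.\<close>

lemma sform_pt_tensor:
  "sform (A \<times> B) (pt r) (tensor x y) (tensor x' y') =
   sform (A \<times> B) r (tensor (\<lambda>i. cnj (x' i)) y) (tensor (\<lambda>i. cnj (x i)) y')"
proof -
  let ?t = "\<lambda>i k j l. cnj (x i) * cnj (y k) * r (j, k) (i, l) * x' j * y' l"
  have "sform (A \<times> B) (pt r) (tensor x y) (tensor x' y') = (\<Sum>i\<in>A. \<Sum>k\<in>B. \<Sum>j\<in>A. \<Sum>l\<in>B. ?t i k j l)"
    by (simp add: sform_def sum.cartesian_product' mult_ac)
  also have "\<dots> = (\<Sum>i\<in>A. \<Sum>j\<in>A. \<Sum>k\<in>B. \<Sum>l\<in>B. ?t i k j l)"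
    by (rule sum.cong[OF refl])+ (rule sum.swap)
  also have "\<dots> = (\<Sum>j\<in>A. \<Sum>i\<in>A. \<Sum>k\<in>B. \<Sum>l\<in>B. ?t i k j l)"
    by (rule sum.swap)
  also have "\<dots> = (\<Sum>j\<in>A. \<Sum>k\<in>B. \<Sum>i\<in>A. \<Sum>l\<in>B. ?t i k j l)"
    by (rule sum.cong[OF refl])+ (rule sum.swap)
  also have "\<dots> = sform (A \<times> B) r (tensor (\<lambda>i. cnj (x' i)) y) (tensor (\<lambda>i. cnj (x i)) y')"
    by (simp add: sform_def sum.cartesian_product' mult_ac)
  finally show ?thesis .
qed

section \<open>Transfer of positive and negative directions\<close>

lemma sform_reindex:
  assumes "bij_betw f J' J"
  shows "sform J' (\<lambda>a b. M (f a) (f b)) (\<lambda>a. u (f a)) (\<lambda>a. v (f a)) = sform J M u v"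
proof -
  have "sform J M u v = (\<Sum>a\<in>J'. \<Sum>b\<in>J. cnj (u (f a)) * M (f a) b * v b)"
    unfolding sform_def by (rule sum.reindex_bij_betw[OF assms, symmetric])
  also have "\<dots> = sform J' (\<lambda>a b. M (f a) (f b)) (\<lambda>a. u (f a)) (\<lambda>a. v (f a))"
    unfolding sform_def by (intro sum.cong refl sum.reindex_bij_betw[OF assms, symmetric])
  finally show ?thesis by simp
qed

text \<open>\<open>T\<close> only has to preserve the form. It is then injective on a positive
  orthogonal system, since \<open>T u = T v\<close> would make the square of \<open>u\<close> equal
  to its product with \<open>v\<close>, which is 0.\<close>

lemma pos_ge_transfer:
  assumes "pos_ge J' M' k"
    and T: "\<And>u v. sform J M (T u) (T v) = sform J' M' u v"
  shows "pos_ge J M k"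
proof -
  obtain U where U: "orth_pos J' M' U" "k \<le> card U" using assms(1) by (auto simp: pos_ge_def)
  have "inj_on T U"
  proof (rule inj_onI, rule ccontr)
    fix u v assume *: "u \<in> U" "v \<in> U" "T u = T v" "u \<noteq> v"
    have "sform J' M' u u = sform J' M' u v" using T[of u u] T[of u v] * by simp
    then show False using U(1) * by (force simp: orth_pos_def)
  qed
  then have "card (T ` U) = card U" by (rule card_image)
  moreover have "orth_pos J M (T ` U)" using U(1) by (auto simp: orth_pos_def T)
  ultimately show ?thesis using U(2) by (auto simp: pos_ge_def)
qed

lemma pos_ge_reindex:
  assumes b: "bij_betw f J' J" and p: "pos_ge J' (\<lambda>a b. M (f a) (f b)) k"
  shows "pos_ge J M k"
proof (rule pos_ge_transfer[OF p])
  fix u v :: "'a \<Rightarrow> complex"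
  let ?T = "\<lambda>u a. u (the_inv_into J' f a)"
  have "sform J M (?T u) (?T v) = sform J' (\<lambda>a b. M (f a) (f b)) (\<lambda>a. ?T u (f a)) (\<lambda>a. ?T v (f a))"
    by (rule sform_reindex[OF b, symmetric])
  also have "\<dots> = sform J' (\<lambda>a b. M (f a) (f b)) u v"
    using b by (intro sform_cong) (auto simp: bij_betw_def the_inv_into_f_f)
  finally show "sform J M (?T u) (?T v) = sform J' (\<lambda>a b. M (f a) (f b)) u v" .
qed

text \<open>A negative subspace is pulled back by taking coordinates in the family \<open>X\<close>,
  chosen once for each spanning vector, which keeps the pullback linear. Coordinates need not be
  unique, so it is enough that \<open>X\<close> spans.\<close>

lemma neg_ge_transfer:
  assumes n: "neg_ge J M k"
    and T: "\<And>w. \<exists>w'. \<forall>a\<in>J. (\<Sum>b\<in>J'. w' b * X b a) = w a"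
    and M': "\<And>a b. a \<in> J' \<Longrightarrow> b \<in> J' \<Longrightarrow> M' a b = sform J M (X a) (X b)"
  shows "neg_ge J' M' k"
proof -
  obtain w where w: "\<And>c. (\<exists>p<k. c p \<noteq> 0) \<Longrightarrow>
      qform J M (lincomb {..<k} c w) < 0" using n unfolding neg_ge_def by blast
  have "\<forall>p. \<exists>w'. \<forall>a\<in>J. (\<Sum>b\<in>J'. w' b * X b a) = w p a" using T by blast
  then obtain W where W: "\<And>p a. a \<in> J \<Longrightarrow> (\<Sum>b\<in>J'. W p b * X b a) = w p a" by metis
  have "qform J' M' (lincomb {..<k} c W) < 0"
    if c: "\<exists>p<k. c p \<noteq> 0" for c
  proof -
    let ?W = "\<lambda>a. \<Sum>p<k. c p * W p a"
    have e: "(\<Sum>b\<in>J'. ?W b * X b a) = (\<Sum>p<k. c p * w p a)" if "a \<in> J" for a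
    proof -
      have "(\<Sum>b\<in>J'. ?W b * X b a) = (\<Sum>p<k. \<Sum>b\<in>J'. c p * W p b * X b a)"
        by (simp add: sum_distrib_right sum.swap[of _ "{..<k}"])
      also have "\<dots> = (\<Sum>p<k. c p * w p a)"
        using W[OF that] by (simp add: sum_distrib_left[symmetric] mult.assoc)
      finally show ?thesis .
    qed
    have "sform J' M' ?W ?W = (\<Sum>a\<in>J'. \<Sum>b\<in>J'. cnj (?W a) * sform J M (X a) (X b) * ?W b)"
      unfolding sform_def[of J' M'] by (intro sum.cong refl) (simp add: M')
    also have "\<dots> = sform J M (\<lambda>x. \<Sum>b\<in>J'. ?W b * X b x) (\<lambda>x. \<Sum>b\<in>J'. ?W b * X b x)"
      by (rule sform_sum_sum[symmetric])
    also have "\<dots> = sform J M (lincomb {..<k} c w) (lincomb {..<k} c w)"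
      by (intro sform_cong e refl)
    finally show ?thesis using w[OF c] by simp
  qed
  then show ?thesis unfolding neg_ge_def by blast
qed

lemma neg_ge_reindex:
  assumes b: "bij_betw f J' J" and p: "neg_ge J M k"
  shows "neg_ge J' (\<lambda>a b. M (f a) (f b)) k"
proof -
  obtain w where w: "\<And>c. (\<exists>p<k. c p \<noteq> 0) \<Longrightarrow>
      qform J M (lincomb {..<k} c w) < 0" using p unfolding neg_ge_def by blast
  then show ?thesis unfolding neg_ge_def sform_reindex[OF b, of M, symmetric]
    by (intro exI[of _ "\<lambda>p a. w p (f a)"]) blast
qed

lemma bij_betw_prod_swap: "bij_betw prod.swap (B \<times> A) (A \<times> B)"
  by (auto simp: bij_betw_def inj_on_def)

lemma pt_swp: "pt (swp r) = (\<lambda>a b. pt r (prod.swap a) (prod.swap b))"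
  by (auto simp: fun_eq_iff)

lemma pos_ge_swp: "pos_pt B A (swp r) k \<Longrightarrow> pos_pt A B r k"
  unfolding pt_swp by (rule pos_ge_reindex[OF bij_betw_prod_swap])

lemma neg_ge_swp: "neg_pt A B r k \<Longrightarrow> neg_pt B A (swp r) k"
  unfolding pt_swp by (rule neg_ge_reindex[OF bij_betw_prod_swap])

lemma psd_on_swp:
  assumes "psd_on (A \<times> B) r" shows "psd_on (B \<times> A) (swp r)"
proof -
  have h: "herm_on (A \<times> B) r" and p: "\<And>v. 0 \<le> qform (A \<times> B) r v"
    using assms by (auto simp: psd_on_def)
  have "herm_on (B \<times> A) (swp r)" using h by (rule herm_on_swp)
  moreover have "0 \<le> qform (B \<times> A) (swp r) v" for v
  proof -
    let ?w = "\<lambda>a. cnj (v (prod.swap a))"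
    have "sform (A \<times> B) r ?w ?w = sform (B \<times> A) (\<lambda>a b. r (prod.swap a) (prod.swap b)) (\<lambda>a. cnj (v a)) (\<lambda>a. cnj (v a))"
      using sform_reindex[OF bij_betw_prod_swap, of B A r ?w ?w] by simp
    also have "\<dots> = sform (B \<times> A) (swp r) v v"
      unfolding sform_def by (subst sum.swap) (intro sum.cong refl, simp add: swp_def mult_ac)
    finally show ?thesis using p[of ?w] by simp
  qed
  ultimately show ?thesis by (simp add: psd_on_def)
qed

lemma pt_product_nonneg:
  assumes "psd_on (A \<times> B) r" shows "0 \<le> qform (A \<times> B) (pt r) (tensor x y)"
  using assms by (simp add: sform_pt_tensor psd_on_def)

text \<open>Otherwise a maximal orthogonal system of positive vectors could be extended by the
  product vector, or by a large multiple of it plus a correction.\<close>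

lemma kernel_product_vector:
  assumes fin: "finite A" "finite B" and r: "psd_on (A \<times> B) r" and n: "\<not> pos_pt A B r (Suc k)"
    and Z: "\<And>F :: ('a \<times> 'b \<Rightarrow> complex) set. finite F \<Longrightarrow> card F \<le> k \<Longrightarrow>
      \<exists>x y. (\<exists>i\<in>A. x i \<noteq> 0) \<and> (\<exists>l\<in>B. y l \<noteq> 0) \<and> (\<forall>f\<in>F. (\<Sum>a\<in>A\<times>B. f a * tensor x y a) = 0)"
  obtains x y where "\<exists>i\<in>A. x i \<noteq> 0" "\<exists>l\<in>B. y l \<noteq> 0" "\<And>z. sform (A \<times> B) (pt r) (tensor x y) z = 0"
proof -
  let ?J = "A \<times> B" and ?M = "pt r"
  have h: "herm_on ?J ?M" using r by (simp add: psd_on_herm herm_on_pt)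
  define P where "P = (\<lambda>m. \<exists>U. orth_pos ?J ?M U \<and> card U = m)"
  have bound: "m \<le> k" if "P m" for m
    using n that unfolding P_def pos_ge_def by (auto simp: not_less_eq_eq)
  have "P 0" unfolding P_def by (intro exI[of _ "{}"]) (simp add: orth_pos_def)
  then have Pm: "P (Greatest P)" using GreatestI_nat[of P 0 k] bound by blast
  then obtain U where U: "orth_pos ?J ?M U" "card U = Greatest P" by (auto simp: P_def)
  have maxi: False if "orth_pos ?J ?M (insert v U)" "v \<notin> U" for v
  proof -
    have "P (Suc (Greatest P))" using that U unfolding P_def
      by (intro exI[of _ "insert v U"]) (simp add: orth_pos_def)
    then show False using Greatest_le_nat[of P "Suc (Greatest P)" k] bound by auto
  qed
  have fU: "finite U" using U(1) by (simp add: orth_pos_def)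
  \<comment> \<open>Orthogonality to each member of \<open>U\<close> is one linear condition on the
    product vector, so \<open>F\<close> has at most \<open>k\<close> elements and \<open>Z\<close>
    applies.\<close>
  define F where "F = (\<lambda>u b. \<Sum>a\<in>?J. cnj (u a) * ?M a b) ` U"
  have "finite F" "card F \<le> k"
    using fU card_image_le[OF fU] bound[OF Pm] U(2) unfolding F_def by (auto intro: le_trans)
  from Z[OF this] obtain x y where xy: "\<exists>i\<in>A. x i \<noteq> 0" "\<exists>l\<in>B. y l \<noteq> 0"
    "\<forall>f\<in>F. (\<Sum>a\<in>A\<times>B. f a * tensor x y a) = 0" by blast
  define t where "t = tensor x y"
  have o: "sform ?J ?M u t = 0" if "u \<in> U" for u
  proof -
    have "sform ?J ?M u t = (\<Sum>b\<in>?J. \<Sum>a\<in>?J. cnj (u a) * ?M a b * t b)"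
      unfolding sform_def by (rule sum.swap)
    also have "\<dots> = (\<Sum>b\<in>?J. (\<Sum>a\<in>?J. cnj (u a) * ?M a b) * t b)" by (simp add: sum_distrib_right)
    also have "\<dots> = 0" using xy(3) that unfolding F_def t_def by simp
    finally show ?thesis .
  qed
  have "\<not> 0 < qform ?J ?M t" using orth_pos_insert[OF h U(1) _ o] maxi by blast
  then have "qform ?J ?M t = 0" using pt_product_nonneg[OF r, of x y] by (simp add: t_def)
  then have t0: "sform ?J ?M t t = 0" using sform_real[OF h, of t] by (simp add: complex_eq_iff)
  have "sform ?J ?M t z = 0" for z
  proof (rule ccontr)
    assume "sform ?J ?M t z \<noteq> 0"
    from orth_pos_insert_isotropic[OF h U(1) o t0 this] show False using maxi by metis
  qed
  then show thesis using that xy(1,2) unfolding t_def by blast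
qed

section \<open>Adapted bases\<close>


text \<open>Spanning alone is recorded, because that is what pulls back negative subspaces. For as
  many vectors as there are coordinates it amounts to being a basis.\<close>

definition basis_on :: "'a set \<Rightarrow> ('a \<Rightarrow> 'a \<Rightarrow> complex) \<Rightarrow> bool" where
  "basis_on A X \<longleftrightarrow> (\<forall>v. \<exists>c. \<forall>i\<in>A. (\<Sum>j\<in>A. c j * X j i) = v i)"

text \<open>Otherwise \<open>z\<close> and \<open>w\<close> would span a hyperbolic plane for
  \<open>- M\<close>, and that plane contains a vector on which \<open>M\<close> is
  negative.\<close>

lemma psd_isotropic:
  assumes p: "psd_on J M" and z: "sform J M z z = 0"
  shows "sform J M z w = 0"
proof (rule ccontr)
  let ?N = "\<lambda>a b. - M a b"
  have n: "sform J ?N u v = - sform J M u v" for u v by (simp add: sform_def sum_negf)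
  have h: "herm_on J ?N"
    using psd_on_herm[OF p] unfolding herm_on_def by (metis complex_cnj_minus)
  assume "sform J M z w \<noteq> 0"
  then have "sform J ?N z w \<noteq> 0" by (simp add: n)
  moreover have "orth_pos J ?N {}" "sform J ?N z z = 0" using z by (auto simp: orth_pos_def n)
  ultimately obtain v where "orth_pos J ?N (insert v {})"
    using orth_pos_insert_isotropic[OF h, of "{}" z w] by blast
  then show False using psd_on_nonneg[OF p, of v] by (simp add: orth_pos_def n)
qed

lemma basis_on_start:
  assumes "finite A" "a0 \<in> A" "x a0 \<noteq> 0"
  shows "basis_on A (\<lambda>j. if j = a0 then x else axis j)" unfolding basis_on_def
proof
  fix v
  let ?c = "\<lambda>j. if j = a0 then v a0 / x a0 else v j - v a0 / x a0 * x j"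
  have "(\<Sum>j\<in>A. ?c j * (if j = a0 then x else axis j) i) = v i" if "i \<in> A" for i
  proof -
    have "(\<Sum>j\<in>A - {a0}. ?c j * (if j = a0 then x else axis j) i) =
        (\<Sum>j\<in>A - {a0}. if j = i then v i - v a0 / x a0 * x i else 0)"
      by (intro sum.cong) auto
    then show ?thesis using assms that by (subst sum.remove[of _ a0]) auto
  qed
  then show "\<exists>c. \<forall>i\<in>A. (\<Sum>j\<in>A. c j * (if j = a0 then x else axis j) i) = v i"
    by (intro exI[of _ ?c] ballI)
qed

lemma basis_on_replace:
  assumes b: "basis_on A X" and A: "finite A" "d \<in> A" and D: "D \<subseteq> A - {d}" and t: "t \<noteq> 0"
  shows "basis_on A (X(d := \<lambda>a. t * (X d a - (\<Sum>i\<in>D. q i * X i a))))" (is "basis_on A ?Y")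
  unfolding basis_on_def
proof
  fix v
  obtain c where c: "\<forall>i\<in>A. (\<Sum>j\<in>A. c j * X j i) = v i" using b unfolding basis_on_def by blast
  let ?c = "\<lambda>j. if j = d then c d / t else c j + (if j \<in> D then c d * q j else 0)"
  have "(\<Sum>j\<in>A. ?c j * ?Y j i) = v i" if "i \<in> A" for i
  proof -
    have "(\<Sum>j\<in>A - {d}. ?c j * ?Y j i) = (\<Sum>j\<in>A - {d}. c j * X j i + (if j \<in> D then c d * q j * X j i else 0))"
      by (intro sum.cong) (auto simp: algebra_simps)
    also have "\<dots> = (\<Sum>j\<in>A - {d}. c j * X j i) + (\<Sum>j\<in>D. c d * q j * X j i)"
      using A D by (simp add: sum.distrib sum.If_cases Int_absorb1)
    also have "(\<Sum>j\<in>D. c d * q j * X j i) = c d * (\<Sum>j\<in>D. q j * X j i)"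
      by (simp add: sum_distrib_left mult.assoc)
    finally have "(\<Sum>j\<in>A. ?c j * ?Y j i) =
        c d / t * ?Y d i + ((\<Sum>j\<in>A - {d}. c j * X j i) + c d * (\<Sum>j\<in>D. q j * X j i))"
      unfolding sum.remove[OF A, of "\<lambda>j. ?c j * ?Y j i"] by simp
    also have "\<dots> = c d * X d i + (\<Sum>j\<in>A - {d}. c j * X j i)" using t by (simp add: field_simps)
    also have "\<dots> = (\<Sum>j\<in>A. c j * X j i)"
      unfolding sum.remove[OF A, of "\<lambda>j. c j * X j i"] ..
    finally show ?thesis using c that by simp
  qed
  then show "\<exists>c. \<forall>i\<in>A. (\<Sum>j\<in>A. c j * ?Y j i) = v i"
    by (intro exI[of _ ?c] ballI)
qed

text \<open>Gram-Schmidt for a form that may be degenerate, started at the isotropic vector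
  \<open>x\<close>. Vectors of square 0 do no harm, because by \<open>psd_isotropic\<close> they are
  orthogonal to everything.\<close>

lemma diagonalizing_basis:
  assumes A: "finite A" and Q: "psd_on A Q" and x: "\<exists>i\<in>A. x i \<noteq> 0" and x0: "sform A Q x x = 0"
  obtains a0 X where "a0 \<in> A" "X a0 = x" "basis_on A X"
    "\<And>i j. i \<in> A \<Longrightarrow> j \<in> A \<Longrightarrow> i \<noteq> j \<Longrightarrow> sform A Q (X i) (X j) = 0"
    "\<And>i. i \<in> A \<Longrightarrow> sform A Q (X i) (X i) \<in> {0, 1}"
proof -
  obtain a0 where a0: "a0 \<in> A" "x a0 \<noteq> 0" using x by blast
  have "D \<subseteq> A - {a0} \<Longrightarrow> \<exists>X. X a0 = x \<and> basis_on A X \<and>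
      (\<forall>i\<in>insert a0 D. \<forall>j\<in>insert a0 D. i \<noteq> j \<longrightarrow> sform A Q (X i) (X j) = 0) \<and>
      (\<forall>i\<in>insert a0 D. sform A Q (X i) (X i) \<in> {0, 1})" if "finite D" for D
    using that
  proof (induction D rule: finite_induct)
    case empty
    show ?case by (intro exI[of _ "\<lambda>j. if j = a0 then x else axis j"])
      (use basis_on_start[where x = x, OF A a0] x0 in auto)
  next
    case (insert d D)
    then have "D \<subseteq> A - {a0}" by blast
    from insert.IH[OF this] obtain X where X: "X a0 = x" "basis_on A X"
      "\<And>i j. i \<in> insert a0 D \<Longrightarrow> j \<in> insert a0 D \<Longrightarrow> i \<noteq> j \<Longrightarrow> sform A Q (X i) (X j) = 0"
      "\<And>i. i \<in> insert a0 D \<Longrightarrow> sform A Q (X i) (X i) \<in> {0, 1}" by (elim exE conjE) (metis insert_iff)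
    define E where "E = insert a0 D"
    have fE: "finite E" and dE: "d \<notin> E" and EA: "E \<subseteq> A - {d}" and dA: "d \<in> A"
      using insert.hyps insert.prems a0 by (auto simp: E_def)
    \<comment> \<open>No division by the squares: they are 1, or they are 0 and the coefficient
      vanishes as well.\<close>
    define y where "y = (\<lambda>a. X d a - (\<Sum>i\<in>E. sform A Q (X i) (X d) * X i a))"
    define t where "t = (if sform A Q y y = 0 then 1 else of_real (1 / sqrt (qform A Q y)) :: complex)"
    define Y where "Y = X(d := \<lambda>a. t * (X d a - (\<Sum>i\<in>E. sform A Q (X i) (X d) * X i a)))"
    have Yd: "Y d = (\<lambda>a. t * y a)" by (simp add: Y_def y_def)
    have YE: "Y i = X i" if "i \<in> E" for i using that dE by (auto simp: Y_def)
    have ry: "sform A Q y y = of_real (qform A Q y)"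
      using sform_real[OF psd_on_herm[OF Q], of y] by (simp add: complex_eq_iff)
    have ny: "0 \<le> qform A Q y" using psd_on_nonneg[OF Q] .
    have t0: "t \<noteq> 0" using ry ny by (auto simp: t_def)
    have o: "sform A Q (X i) y = 0" if i: "i \<in> E" for i
    proof -
      have "sform A Q (X i) y = sform A Q (X i) (X d) - (\<Sum>j\<in>E. sform A Q (X j) (X d) * sform A Q (X i) (X j))"
        unfolding y_def sform_diff_right sform_sum_right ..
      also have "(\<Sum>j\<in>E. sform A Q (X j) (X d) * sform A Q (X i) (X j)) =
          (\<Sum>j\<in>E. if j = i then sform A Q (X i) (X d) * sform A Q (X i) (X i) else 0)"
        using X(3) i unfolding E_def by (intro sum.cong refl) auto
      also have "\<dots> = sform A Q (X i) (X d)"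
        using i fE X(4)[of i] psd_isotropic[OF Q, of "X i" "X d"] by (auto simp: E_def)
      finally show ?thesis by simp
    qed
    have o1: "sform A Q (Y i) (Y d) = 0" if "i \<in> E" for i
      using o[OF that] YE[OF that] by (simp add: Yd sform_scale_right)
    have o2: "sform A Q (Y d) (Y i) = 0" if "i \<in> E" for i
      using o1[OF that] sform_swap[OF psd_on_herm[OF Q], of "Y d" "Y i"] by simp
    have dd: "sform A Q (Y d) (Y d) \<in> {0, 1}"
    proof (cases "sform A Q y y = 0")
      case True
      then show ?thesis by (simp add: Yd sform_linear)
    next
      case False
      define s where "s = qform A Q y"
      have s: "0 < s" using False ry ny unfolding s_def by (metis less_eq_real_def of_real_0)
      have "sform A Q (Y d) (Y d) = of_real (1 / sqrt s * (1 / sqrt s) * s)"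
        using False ry s unfolding Yd sform_scale_left sform_scale_right
        by (simp add: t_def s_def[symmetric] flip: of_real_mult)
      also have "1 / sqrt s * (1 / sqrt s) * s = 1" using s by simp
      finally show ?thesis by simp
    qed
    have "Y a0 = x" using X(1) YE[of a0] by (simp add: E_def)
    moreover have "basis_on A Y" unfolding Y_def by (rule basis_on_replace[OF X(2) A dA EA t0])
    moreover have "sform A Q (Y i) (Y j) = 0" if "i \<in> insert d E" "j \<in> insert d E" "i \<noteq> j" for i j
      using that o1 o2 X(3) YE unfolding E_def by auto
    moreover have "sform A Q (Y i) (Y i) \<in> {0, 1}" if "i \<in> insert d E" for i
      using that dd X(4)[of i] YE[of i] unfolding E_def by (cases "i = d") simp_all
    ultimately show ?case unfolding E_def by (metis insert_commute)
  qed
  from this[of "A - {a0}"] obtain X where X: "X a0 = x" "basis_on A X"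
      "\<forall>i\<in>insert a0 (A - {a0}). \<forall>j\<in>insert a0 (A - {a0}). i \<noteq> j \<longrightarrow> sform A Q (X i) (X j) = 0"
      "\<forall>i\<in>insert a0 (A - {a0}). sform A Q (X i) (X i) \<in> {0, 1}" using A by auto
  show thesis by (rule that[OF a0(1) X(1,2)]) (use X(3,4) a0(1) in \<open>auto simp: insert_absorb\<close>)
qed

text \<open>By the first clause on \<open>r\<close>, the partial transpose annihilates the basis vector \<open>(a0, b0)\<close>.\<close>

definition normal_form :: "'a set \<Rightarrow> 'b set \<Rightarrow> 'a \<Rightarrow> 'b \<Rightarrow> ('a \<times> 'b \<Rightarrow> 'a \<times> 'b \<Rightarrow> complex) \<Rightarrow> bool" where
  "normal_form A B a0 b0 r \<longleftrightarrow> finite A \<and> finite B \<and> a0 \<in> A \<and> b0 \<in> B \<and> psd_on (A \<times> B) r \<and>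
     (\<forall>j\<in>A. \<forall>l\<in>B. r (j, b0) (a0, l) = 0) \<and>
     (\<forall>i\<in>A. \<forall>j\<in>A. i \<noteq> j \<longrightarrow> r (i, b0) (j, b0) = 0) \<and>
     (\<forall>k\<in>B. \<forall>l\<in>B. k \<noteq> l \<longrightarrow> r (a0, k) (a0, l) = 0) \<and>
     (\<forall>i\<in>A. r (i, b0) (i, b0) \<in> {0, 1}) \<and> (\<forall>k\<in>B. r (a0, k) (a0, k) \<in> {0, 1})"

lemma sform_family:
  "sform J (\<lambda>a b. sform K M (w a) (w b)) u v =
   sform K M (lincomb J u w) (lincomb J v w)" unfolding sform_sum_sum by (simp add: sform_def)

lemma herm_on_family:
  assumes "herm_on K M" shows "herm_on J (\<lambda>a b. sform K M (w a) (w b))"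
  unfolding herm_on_def using sform_swap[OF assms] by blast

lemma psd_on_family:
  assumes "psd_on K M" shows "psd_on J (\<lambda>a b. sform K M (w a) (w b))" unfolding psd_on_def
proof (intro conjI allI)
  show "herm_on J (\<lambda>a b. sform K M (w a) (w b))"
    by (rule herm_on_family[OF psd_on_herm[OF assms]])
  show "0 \<le> qform J (\<lambda>a b. sform K M (w a) (w b)) v" for v
    unfolding sform_family by (rule psd_on_nonneg[OF assms])
qed

lemma tensor_axis_sum:
  assumes "finite A" "fst a \<in> A" shows "tensor x y a = (\<Sum>i\<in>A. x i * tensor (axis i) y a)"
proof -
  have "(\<Sum>i\<in>A. x i * tensor (axis i) y a) = (\<Sum>i\<in>A. if i = fst a then x i * y (snd a) else 0)"
    unfolding tensor_def by (intro sum.cong) auto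
  then show ?thesis using assms by (simp add: tensor_def)
qed

lemma tensor_axis_sum':
  assumes "finite B" "snd a \<in> B" shows "tensor x y a = (\<Sum>k\<in>B. y k * tensor x (axis k) a)"
proof -
  have "(\<Sum>k\<in>B. y k * tensor x (axis k) a) = (\<Sum>k\<in>B. if k = snd a then x (fst a) * y k else 0)"
    unfolding tensor_def by (intro sum.cong) auto
  then show ?thesis using assms by (simp add: tensor_def)
qed

text \<open>\<open>Q\<close> and \<open>P\<close> are the compressions of \<open>H\<close> to
  product vectors with second factor \<open>y\<close> and with first factor \<open>x\<close>. They
  are positive semidefinite although \<open>H\<close> is not, because only product vectors are
  involved; so bases starting at \<open>x\<close> and \<open>y\<close> diagonalise them.\<close>

lemma normal_form_exists:
  assumes fin: "finite A" "finite B" and r: "psd_on (A \<times> B) r"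
    and x: "\<exists>i\<in>A. x i \<noteq> 0" and y: "\<exists>l\<in>B. y l \<noteq> 0"
    and ker: "\<And>z. sform (A \<times> B) (pt r) (tensor x y) z = 0"
  obtains a0 b0 r' where "normal_form A B a0 b0 r'"
    "\<And>k. pos_pt A B r' k \<Longrightarrow> pos_pt A B r k"
    "\<And>k. neg_pt A B r k \<Longrightarrow> neg_pt A B r' k"
proof -
  let ?J = "A \<times> B" and ?M = "pt r"
  have h: "herm_on ?J ?M" using r by (simp add: psd_on_herm herm_on_pt)
  define Q where "Q = (\<lambda>i j. sform ?J ?M (tensor (axis i) y) (tensor (axis j) y))"
  define P where "P = (\<lambda>k l. sform ?J ?M (tensor x (axis k)) (tensor x (axis l)))"
  have Qs: "sform A Q u v = sform ?J ?M (tensor u y) (tensor v y)" for u v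
    unfolding Q_def sform_family
    by (rule sform_cong) (simp_all add: tensor_axis_sum[OF fin(1), symmetric] mem_Times_iff)
  have Ps: "sform B P u v = sform ?J ?M (tensor x u) (tensor x v)" for u v
    unfolding P_def sform_family
    by (rule sform_cong) (simp_all add: tensor_axis_sum'[OF fin(2), symmetric] mem_Times_iff)
  have Qp: "psd_on A Q" unfolding psd_on_def Qs using pt_product_nonneg[OF r] herm_on_family[OF h]
    by (simp add: Q_def)
  have Pp: "psd_on B P" unfolding psd_on_def Ps using pt_product_nonneg[OF r] herm_on_family[OF h]
    by (simp add: P_def)
  have Q0: "sform A Q x x = 0" and P0: "sform B P y y = 0" unfolding Qs Ps by (simp_all add: ker)
  obtain a0 X where X: "a0 \<in> A" "X a0 = x" "basis_on A X"
    "\<And>i j. i \<in> A \<Longrightarrow> j \<in> A \<Longrightarrow> i \<noteq> j \<Longrightarrow> sform A Q (X i) (X j) = 0"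
    "\<And>i. i \<in> A \<Longrightarrow> sform A Q (X i) (X i) \<in> {0, 1}"
    using diagonalizing_basis[OF fin(1) Qp x Q0] by blast
  obtain b0 Y where Y: "b0 \<in> B" "Y b0 = y" "basis_on B Y"
    "\<And>i j. i \<in> B \<Longrightarrow> j \<in> B \<Longrightarrow> i \<noteq> j \<Longrightarrow> sform B P (Y i) (Y j) = 0"
    "\<And>i. i \<in> B \<Longrightarrow> sform B P (Y i) (Y i) \<in> {0, 1}"
    using diagonalizing_basis[OF fin(2) Pp y P0] by blast
  \<comment> \<open>The first factors are conjugated so that, by \<open>sform_pt_tensor\<close>, the
    partial transpose of \<open>r'\<close> is the Gram matrix of \<open>H\<close> in the
    unconjugated basis \<open>z\<close>.\<close>
  define w where "w = (\<lambda>a. tensor (\<lambda>i. cnj (X (fst a) i)) (Y (snd a)))"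
  define z where "z = (\<lambda>a. tensor (X (fst a)) (Y (snd a)))"
  define r' where "r' = (\<lambda>a b. sform ?J r (w a) (w b))"
  have ptr': "pt r' a b = sform ?J ?M (z a) (z b)" for a b
    unfolding r'_def z_def w_def sform_pt_tensor by (simp add: pt_def)
  have r'pt: "r' (j, k) (i, l) = sform ?J ?M (z (i, k)) (z (j, l))" for i j k l
    using ptr'[of "(i, k)" "(j, l)"] by simp
  have psd': "psd_on ?J r'" unfolding r'_def by (rule psd_on_family[OF r])
  have z0: "r' (j, b0) (a0, l) = 0" for j l unfolding r'pt by (simp add: z_def X(2) Y(2) ker)
  have zQ: "r' (i, b0) (j, b0) = sform A Q (X j) (X i)" for i j
    unfolding r'pt Qs by (simp add: z_def Y(2))
  have zP: "r' (a0, k) (a0, l) = sform B P (Y k) (Y l)" for k l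
    unfolding r'pt Ps by (simp add: z_def X(2))
  have nf: "normal_form A B a0 b0 r'"
    unfolding normal_form_def zQ zP using fin psd' z0 X Y by auto
  have Tpos: "sform ?J ?M (lincomb ?J u z) (lincomb ?J v z) = sform ?J (pt r') u v" for u v
    unfolding sform_family[symmetric] by (intro sform_cong ptr'[symmetric] refl)
  have surj: "\<exists>v'. \<forall>a\<in>?J. (\<Sum>b\<in>?J. v' b * z b a) = v a" for v
  proof -
    have "\<exists>c. \<forall>i'\<in>A. (\<Sum>i\<in>A. c i * X i i') = v (i', k')" for k'
      using X(3)[unfolded basis_on_def, rule_format, of "\<lambda>i'. v (i', k')"] .
    then obtain c where c: "\<And>k' i'. i' \<in> A \<Longrightarrow> (\<Sum>i\<in>A. c k' i * X i i') = v (i', k')" by metis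
    have "\<exists>d. \<forall>k'\<in>B. (\<Sum>k\<in>B. d k * Y k k') = c k' i" for i
      using Y(3)[unfolded basis_on_def, rule_format, of "\<lambda>k'. c k' i"] .
    then obtain d where d: "\<And>i k'. k' \<in> B \<Longrightarrow> (\<Sum>k\<in>B. d i k * Y k k') = c k' i" by metis
    have "(\<Sum>b\<in>?J. d (fst b) (snd b) * z b (i', k')) = v (i', k')" if "i' \<in> A" "k' \<in> B" for i' k'
    proof -
      have "(\<Sum>b\<in>?J. d (fst b) (snd b) * z b (i', k')) = (\<Sum>i\<in>A. \<Sum>k\<in>B. (d i k * Y k k') * X i i')"
        by (simp add: sum.cartesian_product' z_def mult_ac)
      also have "\<dots> = (\<Sum>i\<in>A. c k' i * X i i')"
        using d[OF that(2)] by (simp add: sum_distrib_right[symmetric])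
      finally show ?thesis using c[OF that(1)] by simp
    qed
    then show ?thesis by (intro exI[of _ "\<lambda>b. d (fst b) (snd b)"]) auto
  qed
  show thesis
  proof (rule that[OF nf])
    show "pos_ge ?J (pt r) k" if "pos_ge ?J (pt r') k" for k
      using pos_ge_transfer[OF that, of ?J ?M "\<lambda>u x. \<Sum>a\<in>?J. u a * z a x"] Tpos by blast
    show "neg_ge ?J (pt r') k" if "neg_ge ?J (pt r) k" for k
      by (rule neg_ge_transfer[OF that surj ptr'])
  qed
qed

section \<open>Schur complements\<close>


text \<open>No inverse appears, since it is formed only where the block of \<open>M\<close> on
  \<open>F\<close> is the identity; for the same reason \<open>residual\<close> subtracts plain
  entries.\<close>

definition schur_compl :: "('i \<Rightarrow> 'i \<Rightarrow> complex) \<Rightarrow> 'i set \<Rightarrow> 'i \<Rightarrow> 'i \<Rightarrow> complex" where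
  "schur_compl M F c d = M c d - (\<Sum>f\<in>F. M c f * M f d)"

definition residual :: "('i \<Rightarrow> 'i \<Rightarrow> complex) \<Rightarrow> 'i set \<Rightarrow> 'i \<Rightarrow> 'i \<Rightarrow> complex" where
  "residual M F c = (\<lambda>x. axis c x - (\<Sum>f\<in>F. M f c * axis f x))"

locale orthonormal_axes =
  fixes J :: "'i set" and M :: "'i \<Rightarrow> 'i \<Rightarrow> complex" and F :: "'i set"
  assumes fin: "finite J" and herm: "herm_on J M" and F: "F \<subseteq> J"
    and on: "\<And>f g. f \<in> F \<Longrightarrow> g \<in> F \<Longrightarrow> M f g = (if f = g then 1 else 0)"
begin

lemma finF: "finite F" using F fin by (rule finite_subset)

lemma orth_pos_axes: "orth_pos J M (axis ` F)"
  using F finF by (auto simp: orth_pos_def sform_axis[OF fin] on subset_iff)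

lemma card_axes: "card (axis ` F) = card F" by (intro card_image inj_onI) (metis zero_neq_one)

lemma sform_residual_right:
  "sform J M z (residual M F d) = sform J M z (axis d) - (\<Sum>f\<in>F. M f d * sform J M z (axis f))"
  unfolding residual_def sform_diff_right sform_sum_right ..

lemma sform_axis_residual:
  assumes "c \<in> J" "d \<in> J" shows "sform J M (axis c) (residual M F d) = schur_compl M F c d"
proof -
  have "(\<Sum>f\<in>F. M f d * sform J M (axis c) (axis f)) = (\<Sum>f\<in>F. M c f * M f d)"
    using F assms by (intro sum.cong refl) (auto simp: sform_axis[OF fin] subset_iff)
  then show ?thesis using assms by (simp add: sform_residual_right schur_compl_def sform_axis[OF fin])
qed

lemma schur_compl_axis: "f \<in> F \<Longrightarrow> schur_compl M F f d = 0"
  using finF by (simp add: schur_compl_def on sum.delta if_distrib[of "\<lambda>x. x * _"] cong: sum.cong if_cong)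

lemma schur_compl_swap: "c \<in> J \<Longrightarrow> d \<in> J \<Longrightarrow> schur_compl M F d c = cnj (schur_compl M F c d)"
  using F unfolding schur_compl_def
  by (auto simp: herm_onD[OF herm] subset_iff mult_ac intro!: sum.cong)

lemma sform_residual_residual:
  assumes "c \<in> J" "d \<in> J" shows "sform J M (residual M F c) (residual M F d) = schur_compl M F c d"
proof -
  have r: "sform J M (residual M F c) (axis f) = 0" if "f \<in> F" for f
    using sform_swap[OF herm, of "residual M F c" "axis f"] that F assms
    by (simp add: sform_axis_residual schur_compl_axis subset_iff)
  have "sform J M (residual M F c) (axis d) = schur_compl M F c d"
    using sform_swap[OF herm, of "residual M F c" "axis d"] schur_compl_swap[of d c] assms
    by (simp add: sform_axis_residual)
  then show ?thesis using r by (simp add: sform_residual_right)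
qed

lemma schur_compl_diag:
  assumes "c \<in> J" shows "Re (schur_compl M F c c) = Re (M c c) - (\<Sum>f\<in>F. (cmod (M f c))\<^sup>2)"
proof -
  have "M c f * M f c = of_real ((cmod (M f c))\<^sup>2)" if "f \<in> F" for f
    using herm_onD[OF herm, of f c] that assms F
    by (auto simp: complex_norm_square mult.commute simp del: of_real_power)
  then show ?thesis by (simp add: schur_compl_def)
qed

text \<open>Completing squares. If the complement vanishes, the form is a sum of squares, hence
  nonnegative.\<close>

lemma sform_schur_compl:
  "sform J M v v = of_real (\<Sum>f\<in>F. (cmod (\<Sum>d\<in>J. M f d * v d))\<^sup>2) + sform J (schur_compl M F) v v"
proof -
  have "(\<Sum>c\<in>J. \<Sum>d\<in>J. cnj (v c) * (\<Sum>f\<in>F. M c f * M f d) * v d)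
      = (\<Sum>c\<in>J. \<Sum>d\<in>J. \<Sum>f\<in>F. cnj (M f c * v c) * (M f d * v d))"
  proof (rule sum.cong[OF refl], rule sum.cong[OF refl])
    fix c d assume "c \<in> J" "d \<in> J"
    then have "M c f = cnj (M f c)" if "f \<in> F" for f
      using that F by (subst herm_onD[OF herm]) auto
    then show "cnj (v c) * (\<Sum>f\<in>F. M c f * M f d) * v d = (\<Sum>f\<in>F. cnj (M f c * v c) * (M f d * v d))"
      unfolding sum_distrib_left sum_distrib_right by (intro sum.cong refl) (simp add: mult_ac)
  qed
  also have "\<dots> = (\<Sum>c\<in>J. \<Sum>f\<in>F. \<Sum>d\<in>J. cnj (M f c * v c) * (M f d * v d))"
    by (rule sum.cong[OF refl], rule sum.swap)
  also have "\<dots> = (\<Sum>f\<in>F. \<Sum>c\<in>J. \<Sum>d\<in>J. cnj (M f c * v c) * (M f d * v d))"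
    by (rule sum.swap)
  also have "\<dots> = (\<Sum>f\<in>F. cnj (\<Sum>d\<in>J. M f d * v d) * (\<Sum>d\<in>J. M f d * v d))"
    unfolding cnj_sum sum_product ..
  also have "\<dots> = of_real (\<Sum>f\<in>F. (cmod (\<Sum>d\<in>J. M f d * v d))\<^sup>2)"
    by (simp add: complex_norm_square mult.commute del: of_real_power)
  finally show ?thesis by (simp add: sform_def schur_compl_def algebra_simps sum_subtractf)
qed

lemma orth_pos_residual:
  assumes "c \<in> J" "0 < Re (schur_compl M F c c)"
  shows "orth_pos J M (insert (residual M F c) (axis ` F))"
    "card (insert (residual M F c) (axis ` F)) = Suc (card F)"
proof -
  have "0 < qform J M (residual M F c)" using assms by (simp add: sform_residual_residual)
  moreover have "sform J M u (residual M F c) = 0" if "u \<in> axis ` F" for u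
    using that F assms(1) by (auto simp: sform_axis_residual schur_compl_axis subset_iff)
  ultimately have *: "orth_pos J M (insert (residual M F c) (axis ` F))" "residual M F c \<notin> axis ` F"
    using orth_pos_insert[OF herm orth_pos_axes] by blast+
  show "orth_pos J M (insert (residual M F c) (axis ` F))" by (rule *(1))
  show "card (insert (residual M F c) (axis ` F)) = Suc (card F)"
    using *(2) finF card_axes by simp
qed

lemma pos_ge_residual:
  assumes "c \<in> J" "0 < Re (schur_compl M F c c)" shows "pos_ge J M (Suc (card F))"
  using orth_pos_residual[OF assms] by (auto simp: pos_ge_def)

lemma pos_ge_residual_isotropic:
  assumes c: "c \<in> J" "d \<in> J" and z: "schur_compl M F c c = 0" and nz: "schur_compl M F c d \<noteq> 0"
  shows "pos_ge J M (Suc (card F))"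
proof -
  have o: "sform J M u (residual M F c) = 0" if "u \<in> axis ` F" for u
    using that F c by (auto simp: sform_axis_residual schur_compl_axis subset_iff)
  have "sform J M (residual M F c) (residual M F c) = 0" "sform J M (residual M F c) (residual M F d) \<noteq> 0"
    using c z nz by (simp_all add: sform_residual_residual)
  from orth_pos_insert_isotropic[OF herm orth_pos_axes o this]
  obtain v where "orth_pos J M (insert v (axis ` F))" "v \<notin> axis ` F" by metis
  then show ?thesis using card_axes finF unfolding pos_ge_def
    by (intro exI[of _ "insert v (axis ` F)"]) auto
qed

end

lemma bessel:
  assumes "orthonormal_axes J M F" "psd_on J M" "c \<in> J"
  shows "(\<Sum>f\<in>F. (cmod (M f c))\<^sup>2) \<le> Re (M c c)"
proof -
  interpret orthonormal_axes J M F by fact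
  have "0 \<le> Re (schur_compl M F c c)"
    using psd_on_nonneg[OF assms(2), of "residual M F c"] assms(3) by (simp add: sform_residual_residual)
  then show ?thesis using assms(3) by (simp add: schur_compl_diag)
qed

lemma psd_zero_row:
  assumes "psd_on J M" "finite J" "a \<in> J" "b \<in> J" "M a a = 0"
  shows "M a b = 0" "M b a = 0"
proof -
  show "M a b = 0"
    using psd_isotropic[OF assms(1), of "axis a" "axis b"] assms by (simp add: sform_axis)
  then show "M b a = 0" using herm_onD[OF psd_on_herm[OF assms(1)], of a b] assms by simp
qed

section \<open>States whose partial transpose kills a product basis vector\<close>

locale normal_pair =
  fixes A :: "'a set" and B :: "'b set" and a0 b0 r
  assumes nf: "normal_form A B a0 b0 r"
begin

lemma finAB: "finite A" "finite B" and a0: "a0 \<in> A" and b0: "b0 \<in> B" and psd: "psd_on (A \<times> B) r"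
  using nf by (auto simp: normal_form_def)

lemma fin: "finite (A \<times> B)" using finAB by simp

lemma herm_r: "herm_on (A \<times> B) r" using psd by (rule psd_on_herm)

lemma herm_pt: "herm_on (A \<times> B) (pt r)" using herm_r by (rule herm_on_pt)

lemma cross: "j \<in> A \<Longrightarrow> l \<in> B \<Longrightarrow> r (j, b0) (a0, l) = 0" "j \<in> A \<Longrightarrow> l \<in> B \<Longrightarrow> r (a0, l) (j, b0) = 0"
proof -
  show *: "r (j, b0) (a0, l) = 0" if "j \<in> A" "l \<in> B" for j l using nf that by (auto simp: normal_form_def)
  show "r (a0, l) (j, b0) = 0" if "j \<in> A" "l \<in> B"
    using *[OF that] herm_onD[OF herm_r, of "(j, b0)" "(a0, l)"] that a0 b0 by simp
qed

lemma diagA: "i \<in> A \<Longrightarrow> j \<in> A \<Longrightarrow> i \<noteq> j \<Longrightarrow> r (i, b0) (j, b0) = 0"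
  and diagB: "k \<in> B \<Longrightarrow> l \<in> B \<Longrightarrow> k \<noteq> l \<Longrightarrow> r (a0, k) (a0, l) = 0"
  and unitA: "i \<in> A \<Longrightarrow> r (i, b0) (i, b0) = 0 \<or> r (i, b0) (i, b0) = 1"
  and unitB: "k \<in> B \<Longrightarrow> r (a0, k) (a0, k) = 0 \<or> r (a0, k) (a0, k) = 1"
  using nf by (auto simp: normal_form_def)

lemma zero_row:
  assumes "i \<in> A" "k \<in> B" "j \<in> A" "l \<in> B" "r (i, k) (i, k) = 0"
  shows "r (i, k) (j, l) = 0" "r (j, l) (i, k) = 0"
  using psd_zero_row[OF psd fin, of "(i, k)" "(j, l)"] assms by auto

lemma corner: "j \<in> A \<Longrightarrow> l \<in> B \<Longrightarrow> r (a0, b0) (j, l) = 0" "j \<in> A \<Longrightarrow> l \<in> B \<Longrightarrow> r (j, l) (a0, b0) = 0"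
  using zero_row[OF a0 b0, of j l] cross[OF a0 b0] by auto

text \<open>The same axes are orthonormal for the state and for its partial transpose, so that the
  two Schur complements can be compared. Entries between the two local families vanish by
  \<open>cross\<close> for the state; for the partial transpose they lie in the row or column of the
  corner \<open>(a0, b0)\<close>.\<close>

lemma axes:
  assumes "L \<subseteq> B - {b0}" "I \<subseteq> A - {a0}"
    and "\<And>k. k \<in> L \<Longrightarrow> r (a0, k) (a0, k) = 1" "\<And>i. i \<in> I \<Longrightarrow> r (i, b0) (i, b0) = 1"
  shows "orthonormal_axes (A \<times> B) (pt r) ({a0} \<times> L \<union> I \<times> {b0})"
    "orthonormal_axes (A \<times> B) r ({a0} \<times> L \<union> I \<times> {b0})"
    "card ({a0} \<times> L \<union> I \<times> {b0}) = card L + card I"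
proof -
  have s: "{a0} \<times> L \<union> I \<times> {b0} \<subseteq> A \<times> B" using assms a0 b0 by auto
  show "orthonormal_axes (A \<times> B) (pt r) ({a0} \<times> L \<union> I \<times> {b0})"
  proof
    fix f g assume fg: "f \<in> {a0} \<times> L \<union> I \<times> {b0}" "g \<in> {a0} \<times> L \<union> I \<times> {b0}"
    show "pt r f g = (if f = g then 1 else 0)"
      using fg assms a0 b0 by (auto simp: subset_iff corner) (metis diagA diagB)+
  qed (use fin herm_pt s in auto)
  show "orthonormal_axes (A \<times> B) r ({a0} \<times> L \<union> I \<times> {b0})"
  proof
    fix f g assume fg: "f \<in> {a0} \<times> L \<union> I \<times> {b0}" "g \<in> {a0} \<times> L \<union> I \<times> {b0}"
    show "r f g = (if f = g then 1 else 0)"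
      using fg assms a0 b0 by (auto simp: subset_iff cross) (metis diagA diagB)+
  qed (use fin herm_r s in auto)
  have "finite L" "finite I" using assms(1,2) finAB by (auto intro: finite_subset)
  then show "card ({a0} \<times> L \<union> I \<times> {b0}) = card L + card I"
    using assms(1,2) by (subst card_Un_disjoint) (auto simp: card_cartesian_product)
qed

lemma sum_axes:
  assumes "L \<subseteq> B - {b0}" "I \<subseteq> A - {a0}"
  shows "(\<Sum>f\<in>{a0} \<times> L \<union> I \<times> {b0}. g f) = (\<Sum>k\<in>L. g (a0, k)) + (\<Sum>i\<in>I. g (i, b0) :: real)"
proof -
  have "finite L" "finite I" using assms finAB by (auto intro: finite_subset)
  then have "(\<Sum>f\<in>{a0} \<times> L \<union> I \<times> {b0}. g f) = (\<Sum>f\<in>{a0} \<times> L. g f) + (\<Sum>f\<in>I \<times> {b0}. g f)"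
    using assms by (intro sum.union_disjoint) auto
  then show ?thesis by (simp add: sum.cartesian_product')
qed

lemma cmod_swap: "c \<in> A \<times> B \<Longrightarrow> d \<in> A \<times> B \<Longrightarrow> cmod (r c d) = cmod (r d c)"
  by (metis herm_onD[OF herm_r] complex_mod_cnj)

text \<open>If both local blocks at the kernel vector are nondegenerate, the Schur complements of
  the partial transpose and of the state itself have the same trace, since the corrections only
  exchange \<open>X\<^sup>* X\<close> for \<open>X X\<^sup>*\<close>. So the former cannot be negative semidefinite unless it is 0.\<close>

lemma nondegenerate_case:
  assumes one: "\<And>k. k \<in> B - {b0} \<Longrightarrow> r (a0, k) (a0, k) = 1" "\<And>i. i \<in> A - {a0} \<Longrightarrow> r (i, b0) (i, b0) = 1"
  shows "pos_pt A B r (card A + card B - 1) \<or> (\<forall>v. 0 \<le> qform (A \<times> B) (pt r) v)"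
proof (rule disjCI)
  let ?J = "A \<times> B" and ?M = "pt r"
  define I where "I = A - {a0}"
  define L where "L = B - {b0}"
  define F where "F = {a0} \<times> L \<union> I \<times> {b0}"
  have IL: "L \<subseteq> B - {b0}" "I \<subseteq> A - {a0}" by (auto simp: I_def L_def)
  have one': "\<And>k. k \<in> L \<Longrightarrow> r (a0, k) (a0, k) = 1" "\<And>i. i \<in> I \<Longrightarrow> r (i, b0) (i, b0) = 1"
    using one by (auto simp: I_def L_def)
  note ax = axes[OF IL one', folded F_def]
  interpret pm: orthonormal_axes ?J ?M F by (rule ax(1))
  interpret pr: orthonormal_axes ?J r F by (rule ax(2))
  let ?S = "schur_compl ?M F"
  have "1 \<le> card A" "1 \<le> card B" using a0 b0 finAB by (auto simp: Suc_le_eq card_gt_0_iff)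
  then have cF: "Suc (card F) = card A + card B - 1"
    using ax(3) a0 b0 finAB by (simp add: I_def L_def)
  assume n: "\<not> (\<forall>v. 0 \<le> qform ?J ?M v)"
  show "pos_ge ?J ?M (card A + card B - 1)"
  proof (rule ccontr)
    assume np: "\<not> pos_ge ?J ?M (card A + card B - 1)"
    have le: "Re (?S c c) \<le> 0" if "c \<in> ?J" for c
      using pm.pos_ge_residual[OF that] np cF by (simp add: not_less[symmetric]) blast
    \<comment> \<open>Up to conjugation, the partial transpose exchanges \<open>k\<close> and
      \<open>l\<close> in the entry at \<open>(a0, k)\<close> and \<open>(i, l)\<close>, and
      \<open>i\<close> and \<open>j\<close> in the entry at \<open>(j, b0)\<close> and
      \<open>(i, l)\<close>. Only the sum over all of \<open>I \<times> L\<close> is invariant, not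
      the individual columns.\<close>
    have sw: "(\<Sum>c\<in>I \<times> L. \<Sum>f\<in>F. (cmod (?M f c))\<^sup>2) = (\<Sum>c\<in>I \<times> L. \<Sum>f\<in>F. (cmod (r f c))\<^sup>2)"
    proof -
      have "(\<Sum>c\<in>I \<times> L. \<Sum>f\<in>F. (cmod (?M f c))\<^sup>2) =
          (\<Sum>i\<in>I. \<Sum>l\<in>L. \<Sum>k\<in>L. (cmod (r (i, k) (a0, l)))\<^sup>2) + (\<Sum>i\<in>I. \<Sum>l\<in>L. \<Sum>j\<in>I. (cmod (r (i, b0) (j, l)))\<^sup>2)"
        unfolding F_def by (simp add: sum_axes[OF IL] sum.cartesian_product' sum.distrib)
      also have "(\<Sum>i\<in>I. \<Sum>l\<in>L. \<Sum>k\<in>L. (cmod (r (i, k) (a0, l)))\<^sup>2) =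
          (\<Sum>i\<in>I. \<Sum>k\<in>L. \<Sum>l\<in>L. (cmod (r (a0, l) (i, k)))\<^sup>2)"
      proof (rule sum.cong[OF refl])
        fix i assume "i \<in> I"
        then have "(\<Sum>l\<in>L. \<Sum>k\<in>L. (cmod (r (i, k) (a0, l)))\<^sup>2) = (\<Sum>l\<in>L. \<Sum>k\<in>L. (cmod (r (a0, l) (i, k)))\<^sup>2)"
          using IL a0 by (intro sum.cong refl arg_cong[where f = "\<lambda>x. x\<^sup>2"] cmod_swap) auto
        also have "\<dots> = (\<Sum>k\<in>L. \<Sum>l\<in>L. (cmod (r (a0, l) (i, k)))\<^sup>2)" by (rule sum.swap)
        finally show "(\<Sum>l\<in>L. \<Sum>k\<in>L. (cmod (r (i, k) (a0, l)))\<^sup>2) = \<dots>" .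
      qed
      also have "(\<Sum>i\<in>I. \<Sum>l\<in>L. \<Sum>j\<in>I. (cmod (r (i, b0) (j, l)))\<^sup>2) =
          (\<Sum>l\<in>L. \<Sum>i\<in>I. \<Sum>j\<in>I. (cmod (r (i, b0) (j, l)))\<^sup>2)" by (rule sum.swap)
      also have "\<dots> = (\<Sum>l\<in>L. \<Sum>j\<in>I. \<Sum>i\<in>I. (cmod (r (i, b0) (j, l)))\<^sup>2)"
        by (rule sum.cong[OF refl], rule sum.swap)
      also have "\<dots> = (\<Sum>j\<in>I. \<Sum>l\<in>L. \<Sum>i\<in>I. (cmod (r (i, b0) (j, l)))\<^sup>2)"
        by (rule sum.swap)
      also have "(\<Sum>i\<in>I. \<Sum>k\<in>L. \<Sum>l\<in>L. (cmod (r (a0, l) (i, k)))\<^sup>2) + \<dots> =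
          (\<Sum>c\<in>I \<times> L. \<Sum>f\<in>F. (cmod (r f c))\<^sup>2)"
        unfolding F_def by (simp add: sum_axes[OF IL] sum.cartesian_product' sum.distrib)
      finally show ?thesis .
    qed
    have ILJ: "I \<times> L \<subseteq> ?J" by (auto simp: I_def L_def)
    have fIL: "finite (I \<times> L)" using finAB by (auto simp: I_def L_def)
    have diag: "?M c c = r c c" for c by (simp add: pt_def)
    have "(\<Sum>c\<in>I \<times> L. Re (?S c c)) = (\<Sum>c\<in>I \<times> L. Re (r c c) - (\<Sum>f\<in>F. (cmod (r f c))\<^sup>2))"
    proof -
      have "(\<Sum>c\<in>I \<times> L. Re (?S c c)) = (\<Sum>c\<in>I \<times> L. Re (r c c) - (\<Sum>f\<in>F. (cmod (?M f c))\<^sup>2))"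
        using ILJ by (intro sum.cong refl) (subst pm.schur_compl_diag, auto simp: diag)
      then show ?thesis by (simp only: sum_subtractf sw)
    qed
    also have "\<dots> \<ge> 0"
    proof (rule sum_nonneg)
      fix c assume "c \<in> I \<times> L"
      then have "c \<in> ?J" using ILJ by blast
      from bessel[OF ax(2) psd this] show "0 \<le> Re (r c c) - (\<Sum>f\<in>F. (cmod (r f c))\<^sup>2)" by simp
    qed
    finally have "0 \<le> (\<Sum>c\<in>I \<times> L. Re (?S c c))" .
    moreover have "(\<Sum>c\<in>I \<times> L. Re (?S c c)) \<le> 0" using le ILJ by (intro sum_nonpos) auto
    ultimately have "(\<Sum>c\<in>I \<times> L. - Re (?S c c)) = 0" by (simp add: sum_negf)
    then have z: "\<forall>c\<in>I \<times> L. - Re (?S c c) = 0"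
      by (subst (asm) sum_nonneg_eq_0_iff[OF fIL]) (use le ILJ in auto)
    have d0: "?S c c = 0" if "c \<in> I \<times> L" for c
    proof -
      have "c \<in> ?J" using that ILJ by blast
      then have "Im (?S c c) = 0" using pm.schur_compl_swap[of c c] by (metis Reals_cnj_iff complex_is_Real_iff)
      then show ?thesis using z that by (auto simp: complex_eq_iff)
    qed
    \<comment> \<open>Rows at \<open>F\<close> vanish by construction, and the row at the corner is
      0. In a row over \<open>I \<times> L\<close> a nonzero entry would give a hyperbolic plane
      with the zero on the diagonal.\<close>
    have S0: "?S c d = 0" if cd: "c \<in> ?J" "d \<in> ?J" for c d
    proof -
      have row: "c \<in> F \<or> c \<in> I \<times> L \<or> c = (a0, b0)" using cd by (auto simp: F_def I_def L_def)
      have "?M (a0, b0) e = 0" if "e \<in> ?J" for e using that by (auto simp: pt_def cross)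
      moreover have "F \<subseteq> ?J" by (rule pm.F)
      ultimately have "?S (a0, b0) d = 0" using cd by (auto simp: schur_compl_def subset_iff intro!: sum.neutral)
      then show ?thesis
        using row pm.schur_compl_axis[of c d] pm.pos_ge_residual_isotropic[of c d, OF cd d0] np cF by metis
    qed
    have "sform ?J ?S v v = 0" for v unfolding sform_def using S0 by (simp add: sum.neutral)
    then have "0 \<le> qform ?J ?M v" for v unfolding pm.sform_schur_compl[of v] by (simp add: sum_nonneg)
    then show False using n by blast
  qed
qed

text \<open>The obstruction to discarding \<open>a0\<close> when its local block has one extra zero:
  the axis \<open>(a0, b1)\<close> is isotropic for \<open>H\<close> but not in the kernel, since
  \<open>r (j, b1) (a0, b2)\<close> is the entry of \<open>H\<close> at \<open>(a0, b1)\<close> and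
  \<open>(j, b2)\<close>.\<close>

definition coupled :: "'b \<Rightarrow> 'b \<Rightarrow> 'a \<Rightarrow> bool" where
  "coupled b1 b2 j \<longleftrightarrow> B = {b0, b1, b2} \<and> b0 \<noteq> b1 \<and> b0 \<noteq> b2 \<and> b1 \<noteq> b2 \<and>
     r (a0, b1) (a0, b1) = 0 \<and> r (a0, b2) (a0, b2) = 1 \<and> j \<in> A \<and> r (j, b1) (a0, b2) \<noteq> 0"

text \<open>The count is \<open>card A\<close> axes, one residual and one hyperbolic plane. The
  plane comes from the isotropic axis \<open>(a0, b1)\<close>, which is orthogonal to everything
  chosen before. The residual comes from the trace argument restricted to the indices
  \<open>(j, b1)\<close>: there Bessel's inequality for the state has a term from
  \<open>(a0, b2)\<close> which the partial transpose replaces by 0, so the trace for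
  \<open>H\<close> is strictly positive.\<close>

lemma half_degenerate_case:
  assumes c: "coupled b1 b2 j0" and oneA: "\<And>i. i \<in> A - {a0} \<Longrightarrow> r (i, b0) (i, b0) = 1"
  shows "pos_pt A B r (card A + 2)"
proof -
  let ?J = "A \<times> B" and ?M = "pt r"
  have b: "b1 \<in> B - {b0}" "b2 \<in> B - {b0}" "b1 \<noteq> b2"
    and z: "r (a0, b1) (a0, b1) = 0" and one: "r (a0, b2) (a0, b2) = 1"
    and j0: "j0 \<in> A" "r (j0, b1) (a0, b2) \<noteq> 0" using c by (auto simp: coupled_def)
  define I where "I = A - {a0}"
  define F where "F = {a0} \<times> {b2} \<union> I \<times> {b0}"
  have IL: "{b2} \<subseteq> B - {b0}" "I \<subseteq> A - {a0}" using b by (auto simp: I_def)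
  have one': "\<And>k. k \<in> {b2} \<Longrightarrow> r (a0, k) (a0, k) = 1" "\<And>i. i \<in> I \<Longrightarrow> r (i, b0) (i, b0) = 1"
    using one oneA by (auto simp: I_def)
  note ax = axes[OF IL one', folded F_def]
  interpret pm: orthonormal_axes ?J ?M F by (rule ax(1))
  have cF: "card F = card A" using ax(3) card.remove[OF finAB(1) a0] by (simp add: I_def)
  have sF: "(\<Sum>f\<in>F. g f) = g (a0, b2) + (\<Sum>i\<in>I. g (i, b0))" for g :: "_ \<Rightarrow> real"
    unfolding F_def using sum_axes[OF IL] by simp
  have fI: "finite I" using finAB by (simp add: I_def)
  have bB: "b1 \<in> B" "b2 \<in> B" "b1 \<noteq> b0" using b by auto
  have j0I: "j0 \<in> I" using j0 zero_row(1)[OF a0 bB(1) a0 bB(2) z] by (auto simp: I_def)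
  have diag: "?M c c = r c c" for c by (simp add: pt_def)
  have S: "Re (schur_compl ?M F (j, b1) (j, b1)) =
      Re (r (j, b1) (j, b1)) - (\<Sum>i\<in>I. (cmod (r (j, b0) (i, b1)))\<^sup>2)" if "j \<in> I" for j
  proof -
    have "j \<in> A" using that by (simp add: I_def)
    then show ?thesis using bB zero_row(2)[OF a0 bB(1) \<open>j \<in> A\<close> bB(2) z]
      by (subst pm.schur_compl_diag) (auto simp: sF diag)
  qed
  have R: "(cmod (r (a0, b2) (j, b1)))\<^sup>2 + (\<Sum>i\<in>I. (cmod (r (i, b0) (j, b1)))\<^sup>2) \<le> Re (r (j, b1) (j, b1))"
    if "j \<in> I" for j
    using bessel[OF ax(2) psd, of "(j, b1)"] that bB by (simp add: sF I_def)
  \<comment> \<open>The extra term of Bessel's inequality for the state; the coupling at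
    \<open>j0\<close> makes it positive.\<close>
  have "0 < (\<Sum>j\<in>I. (cmod (r (a0, b2) (j, b1)))\<^sup>2)"
  proof (rule sum_pos2[OF fI j0I])
    have "cmod (r (a0, b2) (j0, b1)) = cmod (r (j0, b1) (a0, b2))" using j0 a0 bB by (intro cmod_swap) auto
    then show "0 < (cmod (r (a0, b2) (j0, b1)))\<^sup>2" using j0 by simp
  qed simp
  also have "\<dots> \<le> (\<Sum>j\<in>I. Re (r (j, b1) (j, b1)) - (\<Sum>i\<in>I. (cmod (r (i, b0) (j, b1)))\<^sup>2))"
    using R by (intro sum_mono) force
  also have "\<dots> = (\<Sum>j\<in>I. Re (r (j, b1) (j, b1))) - (\<Sum>j\<in>I. \<Sum>i\<in>I. (cmod (r (i, b0) (j, b1)))\<^sup>2)"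
    by (rule sum_subtractf)
  also have "(\<Sum>j\<in>I. \<Sum>i\<in>I. (cmod (r (i, b0) (j, b1)))\<^sup>2) = (\<Sum>j\<in>I. \<Sum>i\<in>I. (cmod (r (j, b0) (i, b1)))\<^sup>2)"
    by (rule sum.swap)
  also have "(\<Sum>j\<in>I. Re (r (j, b1) (j, b1))) - \<dots> = (\<Sum>j\<in>I. Re (schur_compl ?M F (j, b1) (j, b1)))"
    using S by (simp add: sum_subtractf)
  finally have pos: "0 < (\<Sum>j\<in>I. Re (schur_compl ?M F (j, b1) (j, b1)))" .
  obtain j where j: "j \<in> I" "0 < Re (schur_compl ?M F (j, b1) (j, b1))"
  proof (rule ccontr)
    assume "\<not> thesis"
    then have "(\<Sum>j\<in>I. Re (schur_compl ?M F (j, b1) (j, b1))) \<le> 0"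
      using that by (intro sum_nonpos) (meson not_less)
    then show False using pos by simp
  qed
  have jA: "j \<in> A" using j by (simp add: I_def)
  let ?c = "(j, b1)" and ?z = "(a0, b1)"
  have cJ: "?c \<in> ?J" and zJ: "?z \<in> ?J" and wJ: "(j0, b2) \<in> ?J" using jA bB a0 j0 by auto
  define U where "U = insert (residual ?M F ?c) (axis ` F)"
  have U: "orth_pos ?J ?M U" "card U = Suc (card F)"
    unfolding U_def using pm.orth_pos_residual[OF cJ j(2)] .
  have zF: "?M ?z f = 0" "?M f ?z = 0" if "f \<in> F" for f
    using that a0 bB b zero_row[OF a0 bB(1) _ _ z] unfolding F_def I_def by (auto simp: corner diagB)
  have zU: "sform ?J ?M u (axis ?z) = 0" if u: "u \<in> U" for u
  proof -
    have "sform ?J ?M (axis ?z) (residual ?M F ?c) = 0"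
      using pm.sform_axis_residual[OF zJ cJ] zF zero_row(2)[OF a0 bB(1) jA bB(1) z]
      by (simp add: schur_compl_def)
    then have "sform ?J ?M (residual ?M F ?c) (axis ?z) = 0"
      using sform_swap[OF herm_pt, of "residual ?M F ?c" "axis ?z"] by simp
    moreover have "sform ?J ?M (axis f) (axis ?z) = 0" if "f \<in> F" for f
      using that pm.F zF(2) zJ by (subst sform_axis[OF fin]) auto
    ultimately show ?thesis using u unfolding U_def by blast
  qed
  have "sform ?J ?M (axis ?z) (axis ?z) = 0" "sform ?J ?M (axis ?z) (axis (j0, b2)) \<noteq> 0"
    using zJ wJ z j0 by (simp_all add: sform_axis[OF fin])
  from orth_pos_insert_isotropic[OF herm_pt U(1) zU this]
  obtain v where "orth_pos ?J ?M (insert v U)" "v \<notin> U" by metis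
  then show ?thesis using U cF unfolding pos_ge_def orth_pos_def
    by (intro exI[of _ "insert v U"]) (auto simp: U_def)
qed

end

section \<open>Common zeros of bilinear forms\<close>


definition bil :: "'a set \<Rightarrow> 'b set \<Rightarrow> ('a \<times> 'b \<Rightarrow> complex) \<Rightarrow> ('a \<Rightarrow> complex) \<Rightarrow> ('b \<Rightarrow> complex) \<Rightarrow> complex" where
  "bil A B f x y = (\<Sum>a\<in>A \<times> B. f a * tensor x y a)"

lemma bil_double: "bil A B f x y = (\<Sum>i\<in>A. \<Sum>l\<in>B. f (i, l) * (x i * y l))"
  by (simp add: bil_def sum.cartesian_product')

lemma bil_right: "bil A B f x y = (\<Sum>i\<in>A. x i * (\<Sum>l\<in>B. f (i, l) * y l))"
  by (simp add: bil_double sum_distrib_left mult_ac)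

lemma bil_left: "bil A B f x y = (\<Sum>l\<in>B. y l * (\<Sum>i\<in>A. f (i, l) * x i))"
  unfolding bil_double by (subst sum.swap) (simp add: sum_distrib_left mult_ac)

lemma bil_lin_right: "bil A B f x (\<lambda>l. c * y l + d * y' l) = c * bil A B f x y + d * bil A B f x y'"
  by (simp add: bil_def tensor_def sum_distrib_left sum.distrib algebra_simps)

lemma bil_lin_left: "bil A B f (\<lambda>i. c * x i + d * x' i) y = c * bil A B f x y + d * bil A B f x' y"
  by (simp add: bil_def tensor_def sum_distrib_left sum.distrib algebra_simps)

lemma bil_lin_form: "bil A B (\<lambda>a. c * f a + d * g a) x y = c * bil A B f x y + d * bil A B g x y"
  by (simp add: bil_def sum_distrib_left sum.distrib algebra_simps)

lemma bil_axis:
  assumes "finite A" "finite B" "i \<in> A" "l \<in> B" shows "bil A B f (axis i) (axis l) = f (i, l)"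
proof -
  have "bil A B f (axis i) (axis l) = (\<Sum>j\<in>A. if j = i then f (i, l) else 0)"
    unfolding bil_double
  proof (rule sum.cong[OF refl])
    fix j
    have "(\<Sum>m\<in>B. f (j, m) * (axis i j * axis l m)) = (\<Sum>m\<in>B. if m = l then f (j, l) * axis i j else 0)"
      by (intro sum.cong) auto
    then show "(\<Sum>m\<in>B. f (j, m) * (axis i j * axis l m)) = (if j = i then f (i, l) else 0)"
      using assms by simp
  qed
  then show ?thesis using assms by simp
qed

text \<open>With coordinates \<open>c\<close> and \<open>d\<close> in the first factor, the forms
  become the rows of a square matrix pencil \<open>c P + d R\<close>, and a common zero is a kernel
  vector of a singular member. Either \<open>P\<close> is singular, or an eigenvector of the inverse
  of \<open>P\<close> times \<open>R\<close> provides one.\<close>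

lemma common_zero_2:
  fixes F :: "('a \<times> 'b \<Rightarrow> complex) set"
  assumes A: "card A = 2" and B: "finite B" "B \<noteq> {}" and F: "finite F" "card F \<le> card B"
  shows "\<exists>x y. (\<exists>i\<in>A. x i \<noteq> 0) \<and> (\<exists>l\<in>B. y l \<noteq> 0) \<and> (\<forall>f\<in>F. bil A B f x y = 0)"
proof -
  obtain a0 a1 where a: "A = {a0, a1}" "a0 \<noteq> a1" using A by (auto simp: card_2_iff)
  define n where "n = card B"
  obtain h where h: "bij_betw h {..<n} B" using ex_bij_betw_nat_finite[OF B(1)] by (auto simp: n_def atLeast0LessThan)
  obtain e where e: "bij_betw e {..<card F} F" using ex_bij_betw_nat_finite[OF F(1)] by (auto simp: atLeast0LessThan)
  \<comment> \<open>Zero rows stand in for missing forms and make the matrices square.\<close>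
  define P where "P = mat n n (\<lambda>(q, l). if q < card F then e q (a0, h l) else 0)"
  define R where "R = mat n n (\<lambda>(q, l). if q < card F then e q (a1, h l) else 0)"
  have PR: "P \<in> carrier_mat n n" "R \<in> carrier_mat n n" by (auto simp: P_def R_def)
  have n0: "n \<noteq> 0" using B by (simp add: n_def)
  obtain c d v where v: "v \<in> carrier_vec n" "v \<noteq> 0\<^sub>v n" and cd: "c \<noteq> 0 \<or> d \<noteq> 0"
    and z: "c \<cdot>\<^sub>v (P *\<^sub>v v) + d \<cdot>\<^sub>v (R *\<^sub>v v) = 0\<^sub>v n"
  proof (cases "det P = 0")
    case True
    then obtain v where v: "v \<in> carrier_vec n" "v \<noteq> 0\<^sub>v n" "P *\<^sub>v v = 0\<^sub>v n"
      using det_0_iff_vec_prod_zero_field[OF PR(1)] by auto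
    have "1 \<cdot>\<^sub>v (P *\<^sub>v v) + 0 \<cdot>\<^sub>v (R *\<^sub>v v) = 0\<^sub>v n" using v PR by auto
    then show ?thesis using that[of v 1 0] v by auto
  next
    case False
    then obtain P' where P': "P' \<in> carrier_mat n n" "P * P' = 1\<^sub>m n"
      using det_non_zero_imp_unit[OF PR(1)] by (auto simp: Units_def ring_mat_def)
    then obtain k where "k \<in> spectrum (P' * R)" using spectrum_non_empty[of "P' * R" n] n0 PR by auto
    then obtain v where v: "v \<in> carrier_vec n" "v \<noteq> 0\<^sub>v n" "(P' * R) *\<^sub>v v = k \<cdot>\<^sub>v v"
      using P' by (auto simp: spectrum_def eigenvalue_def eigenvector_def)
    have v3: "P' *\<^sub>v (R *\<^sub>v v) = k \<cdot>\<^sub>v v" using v P' PR by simp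
    have "R *\<^sub>v v = (P * P') *\<^sub>v (R *\<^sub>v v)" using P'(2) PR v by simp
    also have "\<dots> = P *\<^sub>v (P' *\<^sub>v (R *\<^sub>v v))" using P'(1) PR v by (intro assoc_mult_mat_vec) auto
    also have "\<dots> = k \<cdot>\<^sub>v (P *\<^sub>v v)" unfolding v3 using PR v by (simp add: mult_mat_vec)
    finally have "(- k) \<cdot>\<^sub>v (P *\<^sub>v v) + 1 \<cdot>\<^sub>v (R *\<^sub>v v) = 0\<^sub>v n" using PR v by auto
    then show ?thesis using that[of v "- k" 1] v by auto
  qed
  define x where "x = (\<lambda>i. if i = a0 then c else d)"
  define y where "y = (\<lambda>l. v $ (the_inv_into {..<n} h l))"
  have yh: "y (h q) = v $ q" if "q < n" for q
    using that h by (simp add: y_def the_inv_into_f_f bij_betw_def)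
  have row: "(\<Sum>l\<in>B. f l * y l) = (\<Sum>q<n. f (h q) * v $ q)" for f
    using sum.reindex_bij_betw[OF h, of "\<lambda>l. f l * y l"] yh by simp
  have "bil A B f x y = 0" if f: "f \<in> F" for f
  proof -
    obtain q where q: "q < card F" "f = e q" using e f by (auto simp: bij_betw_def)
    have qn: "q < n" using q F by (simp add: n_def)
    have "bil A B f x y = c * (P *\<^sub>v v) $ q + d * (R *\<^sub>v v) $ q"
      using a v qn q unfolding bil_right row x_def
      by (simp add: P_def R_def scalar_prod_def row_def atLeast0LessThan)
    also have "\<dots> = (c \<cdot>\<^sub>v (P *\<^sub>v v) + d \<cdot>\<^sub>v (R *\<^sub>v v)) $ q" using PR v qn by simp
    finally show ?thesis using z qn by simp
  qed
  moreover obtain q where "q < n" "v $ q \<noteq> 0" using v by (metis eq_vecI carrier_vecD index_zero_vec)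
  then have "\<exists>l\<in>B. y l \<noteq> 0" using yh h by (metis bij_betwE lessThan_iff)
  moreover have "\<exists>i\<in>A. x i \<noteq> 0" using cd a by (auto simp: x_def)
  ultimately show ?thesis by blast
qed

text \<open>If \<open>P 1 t\<close> has no root, it is constant in \<open>t\<close>; homogeneity
  then makes \<open>P s 1\<close> a multiple of \<open>s ^ n\<close>, which vanishes at
  \<open>s = 0\<close>. Supplying the two dehomogenisations as univariate polynomials avoids
  bivariate ones.\<close>

lemma homogeneous_root:
  fixes P :: "complex \<Rightarrow> complex \<Rightarrow> complex"
  assumes hom: "\<And>c s t. P (c * s) (c * t) = c ^ n * P s t" and n: "0 < n"
    and p: "\<And>t. P 1 t = poly p t" and q: "\<And>s. P s 1 = poly q s"
  shows "\<exists>s t. (s \<noteq> 0 \<or> t \<noteq> 0) \<and> P s t = 0"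
proof (cases "\<exists>t. poly p t = 0")
  case True
  then obtain t where "P 1 t = 0" using p by auto
  then show ?thesis by (metis one_neq_zero)
next
  case False
  then have "constant (poly p)" using fundamental_theorem_of_algebra by blast
  then have c: "poly p t = poly p 0" for t by (auto simp: constant_def)
  let ?d = "q - monom (poly p 0) n"
  have "poly ?d s = 0" if "s \<noteq> 0" for s
    using hom[of s 1 "1 / s"] that p[of "1 / s"] q[of s] c[of "1 / s"] by (simp add: poly_monom mult.commute)
  then have "UNIV - {0} \<subseteq> {s. poly ?d s = 0}" by auto
  moreover have "infinite (UNIV - {0 :: complex})" using infinite_UNIV_char_0 by simp
  ultimately have "?d = 0" using poly_roots_finite finite_subset by blast
  then have "P 0 1 = 0" using q[of 0] n by (simp add: poly_monom)
  then show ?thesis by (metis one_neq_zero)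
qed

lemma quadratic_root: "(a :: complex) \<noteq> 0 \<Longrightarrow> \<exists>w. a * w\<^sup>2 + b * w + c = 0"
proof -
  assume "a \<noteq> 0"
  then have "\<not> constant (poly [:c, b, a:])" by (simp add: constant_degree)
  then obtain w where "poly [:c, b, a:] w = 0" using fundamental_theorem_of_algebra by blast
  then show ?thesis by (intro exI[of _ w]) (simp add: algebra_simps power2_eq_square)
qed

section \<open>Three further forms on the zeros of a singular form\<close>

definition lin :: "complex \<times> complex \<Rightarrow> complex \<Rightarrow> complex \<Rightarrow> complex" where
  "lin c s t = fst c * s + snd c * t"

definition quad :: "complex \<times> complex \<times> complex \<Rightarrow> complex \<Rightarrow> complex \<Rightarrow> complex" where
  "quad c s t = fst c * s\<^sup>2 + fst (snd c) * (s * t) + snd (snd c) * t\<^sup>2"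

text \<open>The vanishing of a bilinear form at a pair \<open>\<kappa> xs + z x0\<close>,
  \<open>\<mu> ys + w y0\<close>, where \<open>xs\<close> and \<open>ys\<close> depend linearly on
  \<open>(s, t)\<close>: \<open>q\<close>, \<open>m\<close>, \<open>l\<close>, \<open>a\<close> are
  its values at \<open>(xs, ys)\<close>, \<open>(xs, y0)\<close>, \<open>(x0, ys)\<close> and
  \<open>(x0, y0)\<close>.\<close>

definition solvable :: "(complex \<Rightarrow> complex \<Rightarrow> complex) \<Rightarrow> (complex \<Rightarrow> complex \<Rightarrow> complex) \<Rightarrow>
    (complex \<Rightarrow> complex \<Rightarrow> complex) \<Rightarrow> complex \<Rightarrow> complex \<Rightarrow> complex \<Rightarrow> complex \<Rightarrow> complex \<Rightarrow> complex \<Rightarrow> complex \<Rightarrow> bool" where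
  "solvable q m l a s t \<kappa> \<mu> z w \<longleftrightarrow> \<kappa> * \<mu> * q s t + \<kappa> * w * m s t + \<mu> * z * l s t + z * w * a = 0"

text \<open>Solving the two equations without \<open>zw\<close> term for \<open>(z, w)\<close> by Cramer's rule and substituting
  into the first one gives a binary sextic; where Cramer's rule fails, the solution degenerates
  to one with \<open>\<kappa> = 0\<close> or \<open>\<mu> = 0\<close>, or the three equations reduce to two.\<close>

lemma common_zero_scroll:
  fixes l1 l2 l3 m1 m2 m3 :: "complex \<times> complex" and q1 q2 q3 :: "complex \<times> complex \<times> complex"
  assumes a: "a \<noteq> 0"
  shows "\<exists>s t \<kappa> \<mu> z w. (s \<noteq> 0 \<or> t \<noteq> 0) \<and> (\<kappa> \<noteq> 0 \<or> z \<noteq> 0) \<and> (\<mu> \<noteq> 0 \<or> w \<noteq> 0) \<and>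
    solvable (quad q1) (lin m1) (lin l1) a s t \<kappa> \<mu> z w \<and>
    solvable (quad q2) (lin m2) (lin l2) 0 s t \<kappa> \<mu> z w \<and>
    solvable (quad q3) (lin m3) (lin l3) 0 s t \<kappa> \<mu> z w"
proof -
  \<comment> \<open>\<open>D\<close>, \<open>Dz\<close>, \<open>Dw\<close> are the Cramer
    determinants, of degrees 2, 3, 3 in \<open>s\<close> and \<open>t\<close>. \<open>P\<close> is
    the first equation at \<open>z = Dz / D\<close>, \<open>w = Dw / D\<close>, multiplied by the
    square of \<open>D\<close>, hence of degree 6.\<close>
  define D where "D = (\<lambda>s t. lin l2 s t * lin m3 s t - lin l3 s t * lin m2 s t)"
  define Dz where "Dz = (\<lambda>s t. quad q3 s t * lin m2 s t - quad q2 s t * lin m3 s t)"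
  define Dw where "Dw = (\<lambda>s t. quad q2 s t * lin l3 s t - quad q3 s t * lin l2 s t)"
  define P where "P = (\<lambda>s t. quad q1 s t * (D s t)\<^sup>2 + Dw s t * D s t * lin m1 s t
      + Dz s t * D s t * lin l1 s t + a * Dz s t * Dw s t)"
  define lp where "lp = (\<lambda>c :: complex \<times> complex. [:fst c, snd c:])"
  define qp where "qp = (\<lambda>c :: complex \<times> complex \<times> complex. [:fst c, fst (snd c), snd (snd c):])"
  define lr where "lr = (\<lambda>c :: complex \<times> complex. [:snd c, fst c:])"
  define qr where "qr = (\<lambda>c :: complex \<times> complex \<times> complex. [:snd (snd c), fst (snd c), fst c:])"
  have lp: "lin c 1 t = poly (lp c) t" "lin c t 1 = poly (lr c) t" for c t
    by (simp_all add: lin_def lp_def lr_def mult.commute)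
  have qp: "quad c 1 t = poly (qp c) t" "quad c t 1 = poly (qr c) t" for c t
    by (simp_all add: quad_def qp_def qr_def algebra_simps power2_eq_square)
  have hl: "lin c (k * s) (k * t) = k * lin c s t" for c k s t by (simp add: lin_def algebra_simps)
  have hq: "quad c (k * s) (k * t) = k\<^sup>2 * quad c s t" for c k s t
    by (simp add: quad_def algebra_simps power2_eq_square)
  have hD: "D (k * s) (k * t) = k\<^sup>2 * D s t" for k s t by (simp add: D_def hl algebra_simps power2_eq_square)
  have hz: "Dz (k * s) (k * t) = k ^ 3 * Dz s t" for k s t
    by (simp add: Dz_def hl hq algebra_simps power2_eq_square power3_eq_cube)
  have hw: "Dw (k * s) (k * t) = k ^ 3 * Dw s t" for k s t
    by (simp add: Dw_def hl hq algebra_simps power2_eq_square power3_eq_cube)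
  have "P (k * s) (k * t) = k ^ 6 * P s t" for k s t
    unfolding P_def hl hq hD hz hw by (simp add: algebra_simps eval_nat_numeral)
  moreover define pp where "pp = (\<lambda>lp qp. qp q1 * (lp l2 * lp m3 - lp l3 * lp m2)\<^sup>2
      + (qp q2 * lp l3 - qp q3 * lp l2) * (lp l2 * lp m3 - lp l3 * lp m2) * lp m1
      + (qp q3 * lp m2 - qp q2 * lp m3) * (lp l2 * lp m3 - lp l3 * lp m2) * lp l1
      + [:a:] * (qp q3 * lp m2 - qp q2 * lp m3) * (qp q2 * lp l3 - qp q3 * lp l2))"
  have "P 1 t = poly (pp lp qp) t" for t unfolding P_def D_def Dz_def Dw_def lp qp pp_def by simp
  moreover have "P s 1 = poly (pp lr qr) s" for s
    unfolding P_def D_def Dz_def Dw_def lp qp pp_def by simp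
  ultimately obtain s t where st: "s \<noteq> 0 \<or> t \<noteq> 0" "P s t = 0"
    using homogeneous_root[of P 6 "pp lp qp" "pp lr qr"] by auto
  define L1 L2 L3 M1 M2 M3 Q1 Q2 Q3 where
    v: "L1 = lin l1 s t" "L2 = lin l2 s t" "L3 = lin l3 s t" "M1 = lin m1 s t" "M2 = lin m2 s t"
       "M3 = lin m3 s t" "Q1 = quad q1 s t" "Q2 = quad q2 s t" "Q3 = quad q3 s t"
  have "\<exists>\<kappa> \<mu> z w. (\<kappa> \<noteq> 0 \<or> z \<noteq> 0) \<and> (\<mu> \<noteq> 0 \<or> w \<noteq> 0) \<and>
      \<kappa> * \<mu> * Q1 + \<kappa> * w * M1 + \<mu> * z * L1 + z * w * a = 0 \<and>
      \<kappa> * \<mu> * Q2 + \<kappa> * w * M2 + \<mu> * z * L2 = 0 \<and>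
      \<kappa> * \<mu> * Q3 + \<kappa> * w * M3 + \<mu> * z * L3 = 0"
  proof -
    define d where "d = L2 * M3 - L3 * M2"
    have st2: "Q1 * d\<^sup>2 + (Q2 * L3 - Q3 * L2) * d * M1 + (Q3 * M2 - Q2 * M3) * d * L1
        + a * (Q3 * M2 - Q2 * M3) * (Q2 * L3 - Q3 * L2) = 0"
      using st(2) unfolding P_def D_def Dz_def Dw_def v[symmetric] d_def .
    have wit: ?thesis if "\<kappa> \<noteq> 0 \<or> z \<noteq> 0" "\<mu> \<noteq> 0 \<or> w \<noteq> 0"
      "\<kappa> * \<mu> * Q1 + \<kappa> * w * M1 + \<mu> * z * L1 + z * w * a = 0"
      "\<kappa> * \<mu> * Q2 + \<kappa> * w * M2 + \<mu> * z * L2 = 0"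
      "\<kappa> * \<mu> * Q3 + \<kappa> * w * M3 + \<mu> * z * L3 = 0" for \<kappa> \<mu> z w
      using that by blast
    consider (reg) "d \<noteq> 0" | (l0) "L2 = 0" "L3 = 0" | (m0) "M2 = 0" "M3 = 0"
      | (par) "d = 0" "L2 \<noteq> 0 \<or> L3 \<noteq> 0" "M2 \<noteq> 0 \<or> M3 \<noteq> 0" by blast
    then show ?thesis
    proof cases
      case reg
      define z where "z = (Q3 * M2 - Q2 * M3) / d"
      define w where "w = (Q2 * L3 - Q3 * L2) / d"
      have zd: "z * d = Q3 * M2 - Q2 * M3" and wd: "w * d = Q2 * L3 - Q3 * L2"
        using reg by (simp_all add: z_def w_def)
      have "d\<^sup>2 * (Q1 + w * M1 + z * L1 + z * w * a) = 0"
        using st2 unfolding zd[symmetric] wd[symmetric] by (simp add: algebra_simps power2_eq_square)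
      moreover have "d * (Q2 + w * M2 + z * L2) = 0"
      proof -
        have "d * (Q2 + w * M2 + z * L2) = d * Q2 + (w * d) * M2 + (z * d) * L2" by (simp add: algebra_simps)
        then show ?thesis unfolding zd wd by (simp add: d_def algebra_simps)
      qed
      moreover have "d * (Q3 + w * M3 + z * L3) = 0"
      proof -
        have "d * (Q3 + w * M3 + z * L3) = d * Q3 + (w * d) * M3 + (z * d) * L3" by (simp add: algebra_simps)
        then show ?thesis unfolding zd wd by (simp add: d_def algebra_simps)
      qed
      ultimately show ?thesis using reg by (intro wit[of 1 z 1 w]) auto
    next
      case l0
      then show ?thesis using a by (intro wit[of 0 1 1 "- L1 / a"]) auto
    next
      case m0
      then show ?thesis using a by (intro wit[of 1 "- M1 / a" 0 1]) auto
    next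
      case par
      obtain \<alpha> where \<alpha>: "M2 = \<alpha> * L2" "M3 = \<alpha> * L3"
      proof (cases "L2 = 0")
        case True
        then show ?thesis using par that[of "M3 / L3"] by (auto simp: d_def)
      next
        case False
        then show ?thesis using par that[of "M2 / L2"] by (auto simp: d_def field_simps)
      qed
      then have \<alpha>0: "\<alpha> \<noteq> 0" using par(3) by auto
      have "(Q3 * M2 - Q2 * M3) * (Q2 * L3 - Q3 * L2) = 0" using st2 par(1) a by simp
      moreover have "Q3 * M2 - Q2 * M3 = - \<alpha> * (Q2 * L3 - Q3 * L2)" unfolding \<alpha> by (simp add: algebra_simps)
      ultimately have "Q2 * L3 = Q3 * L2" using \<alpha>0 by simp
      then obtain \<beta> where \<beta>: "Q2 = \<beta> * L2" "Q3 = \<beta> * L3"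
      proof (cases "L2 = 0")
        case True
        then show ?thesis using par \<open>Q2 * L3 = Q3 * L2\<close> that[of "Q3 / L3"] by auto
      next
        case False
        then show ?thesis using par \<open>Q2 * L3 = Q3 * L2\<close> that[of "Q2 / L2"] by (auto simp: field_simps)
      qed
      \<comment> \<open>The second and third equations are now multiples of
        \<open>\<beta> + \<alpha> * w + z = 0\<close>. Inserting this \<open>z\<close> into the
        first gives a quadratic in \<open>w\<close> whose leading coefficient is nonzero.\<close>
      obtain w where w: "(- a * \<alpha>) * w\<^sup>2 + (M1 - \<alpha> * L1 - a * \<beta>) * w + (Q1 - \<beta> * L1) = 0"
        using quadratic_root[of "- a * \<alpha>"] a \<alpha>0 by auto
      define z where "z = - \<beta> - \<alpha> * w"
      have "Q1 + w * M1 + z * L1 + z * w * a = 0" using w unfolding z_def by (simp add: algebra_simps power2_eq_square)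
      moreover have "Q2 + w * M2 + z * L2 = 0" "Q3 + w * M3 + z * L3 = 0"
        unfolding \<alpha> \<beta> z_def by (simp_all add: algebra_simps)
      ultimately show ?thesis by (intro wit[of 1 z 1 w]) auto
    qed
  qed
  then obtain \<kappa> \<mu> z w where "\<kappa> \<noteq> 0 \<or> z \<noteq> 0" "\<mu> \<noteq> 0 \<or> w \<noteq> 0"
      "\<kappa> * \<mu> * Q1 + \<kappa> * w * M1 + \<mu> * z * L1 + z * w * a = 0"
      "\<kappa> * \<mu> * Q2 + \<kappa> * w * M2 + \<mu> * z * L2 = 0"
      "\<kappa> * \<mu> * Q3 + \<kappa> * w * M3 + \<mu> * z * L3 = 0" by blast
  then have "solvable (quad q1) (lin m1) (lin l1) a s t \<kappa> \<mu> z w"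
    "solvable (quad q2) (lin m2) (lin l2) 0 s t \<kappa> \<mu> z w"
    "solvable (quad q3) (lin m3) (lin l3) 0 s t \<kappa> \<mu> z w"
    by (simp_all add: solvable_def v)
  then show ?thesis using st(1) \<open>\<kappa> \<noteq> 0 \<or> z \<noteq> 0\<close> \<open>\<mu> \<noteq> 0 \<or> w \<noteq> 0\<close> by blast
qed


lemma card_3_obtain:
  assumes "card A = 3" "a0 \<in> A"
  obtains a1 a2 where "A = {a0, a1, a2}" "a0 \<noteq> a1" "a0 \<noteq> a2" "a1 \<noteq> a2"
proof -
  have "finite A" using assms card.infinite by fastforce
  then have "card (A - {a0}) = 2" using assms by simp
  then obtain a1 a2 where "A - {a0} = {a1, a2}" "a1 \<noteq> a2" by (auto simp: card_2_iff)
  then show ?thesis using that[of a1 a2] assms(2) by blast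
qed

text \<open>The singular form \<open>G\<close> has kernel vectors \<open>x0\<close> and
  \<open>y0\<close> on both sides and descends to a form \<open>C\<close> on the two quotient
  planes. If \<open>C\<close> is singular, \<open>G\<close> vanishes for every \<open>y\<close> in
  the plane of \<open>y0\<close> and \<open>y1\<close>, which leaves three forms on a 2 x 3 system.
  If \<open>C\<close> is regular, each direction \<open>ys s t\<close> in one quotient has one
  orthogonal direction \<open>xs s t\<close> in the other, and zeros of \<open>G\<close> are
  parametrised by \<open>(s, t)\<close> together with coefficients for \<open>x0\<close> and
  \<open>y0\<close>.\<close>

lemma common_zero_3_degenerate:
  fixes G :: "'a \<times> 'b \<Rightarrow> complex"
  assumes A: "card A = 3" and B: "card B = 3"
    and y0: "\<exists>l\<in>B. y0 l \<noteq> 0" and G: "\<And>i. i \<in> A \<Longrightarrow> (\<Sum>l\<in>B. G (i, l) * y0 l) = 0"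
  shows "\<exists>x y. (\<exists>i\<in>A. x i \<noteq> 0) \<and> (\<exists>l\<in>B. y l \<noteq> 0) \<and> bil A B G x y = 0 \<and>
    bil A B f1 x y = 0 \<and> bil A B f2 x y = 0 \<and> bil A B f3 x y = 0"
proof -
  have fin: "finite A" "finite B" using A B card.infinite by fastforce+
  obtain b0 where b0: "b0 \<in> B" "y0 b0 \<noteq> 0" using y0 by blast
  obtain b1 b2 where Bs: "B = {b0, b1, b2}" "b0 \<noteq> b1" "b0 \<noteq> b2" "b1 \<noteq> b2"
    using card_3_obtain[OF B b0(1)] .
  \<comment> \<open>Only two of the three equations are imposed on \<open>x0\<close>; the one at
    \<open>b0\<close> follows by pairing with \<open>y0\<close>, whose coordinate there is
    nonzero.\<close>
  have "card (B - {b0}) < card A" using A B b0 fin by simp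
  then obtain x0 where x0: "\<exists>i\<in>A. x0 i \<noteq> 0" "\<forall>l\<in>B - {b0}. (\<Sum>i\<in>A. x0 i * G (i, l)) = 0"
    using homogeneous_system[of "B - {b0}" A "\<lambda>l i. G (i, l)"] fin by auto
  obtain a0 where a0: "a0 \<in> A" "x0 a0 \<noteq> 0" using x0(1) by blast
  obtain a1 a2 where As: "A = {a0, a1, a2}" "a0 \<noteq> a1" "a0 \<noteq> a2" "a1 \<noteq> a2"
    using card_3_obtain[OF A a0(1)] .
  have Gy0: "bil A B G x y0 = 0" for x unfolding bil_right using G by simp
  have "(\<Sum>i\<in>A. x0 i * G (i, b0)) * y0 b0 = bil A B G x0 y0"
    unfolding bil_left using x0(2) Bs by (simp add: mult_ac)
  then have "(\<Sum>i\<in>A. x0 i * G (i, b0)) = 0" using Gy0 b0 by simp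
  then have "\<forall>l\<in>B. (\<Sum>i\<in>A. x0 i * G (i, l)) = 0" using x0(2) by auto
  then have Gx0: "bil A B G x0 y = 0" for y unfolding bil_left by (simp add: mult.commute)
  define C where "C = (\<lambda>i l. G (i, l))"
  have C: "bil A B G (axis i) (axis l) = C i l" if "i \<in> A" "l \<in> B" for i l
    using bil_axis[OF fin that] by (simp add: C_def)
  show ?thesis
  proof (cases "C a1 b1 * C a2 b2 - C a1 b2 * C a2 b1 = 0")
    case True
    obtain s t where st: "s \<noteq> 0 \<or> t \<noteq> 0" "C a1 b1 * s + C a1 b2 * t = 0" "C a2 b1 * s + C a2 b2 * t = 0"
    proof (cases "C a1 b1 = 0 \<and> C a1 b2 = 0")
      case T: True
      then show ?thesis
      proof (cases "C a2 b1 = 0 \<and> C a2 b2 = 0")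
        case True
        then show ?thesis using T that[of 1 0] by simp
      next
        case False
        then show ?thesis using T that[of "- C a2 b2" "C a2 b1"] by auto
      qed
    next
      case False
      then show ?thesis using True that[of "- C a1 b2" "C a1 b1"] by (auto simp: algebra_simps)
    qed
    define y1 where "y1 = (\<lambda>l. s * axis b1 l + t * axis b2 l)"
    have Gy1: "bil A B G x y1 = 0" for x
    proof -
      have a12: "(\<Sum>l\<in>B. G (i, l) * y1 l) = 0" if "i \<in> {a1, a2}" for i
        using that st Bs As by (auto simp: y1_def C_def algebra_simps)
      have "bil A B G x0 y1 = x0 a0 * (\<Sum>l\<in>B. G (a0, l) * y1 l)"
        unfolding bil_right using a12 As by simp
      then have "(\<Sum>l\<in>B. G (a0, l) * y1 l) = 0" using Gx0 a0 by simp
      then show ?thesis unfolding bil_right using a12 As by simp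
    qed
    define Y where "Y = (\<lambda>q :: nat. if q = 0 then y0 else y1)"
    define H where "H = (\<lambda>f (p :: nat \<times> 'a). \<Sum>l\<in>B. f (snd p, l) * Y (fst p) l)"
    have "card {H f1, H f2, H f3} \<le> card A" using A by (simp add: card_insert_if)
    then obtain u x where ux: "\<exists>i\<in>{0, 1}. u i \<noteq> 0" "\<exists>i\<in>A. x i \<noteq> 0" "\<forall>f\<in>{H f1, H f2, H f3}. bil {0, 1} A f u x = 0"
      using common_zero_2[of "{0, 1 :: nat}" A "{H f1, H f2, H f3}"] fin a0 by auto
    define y where "y = (\<lambda>l. u 0 * y0 l + u 1 * y1 l)"
    have tr: "bil {0, 1} A (H f) u x = bil A B f x y" for f
    proof -
      have "bil {0, 1} A (H f) u x = u 0 * bil A B f x y0 + u 1 * bil A B f x y1"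
        unfolding bil_right[of "{0, 1}"] by (simp add: bil_right H_def Y_def mult.commute)
      then show ?thesis by (simp add: y_def bil_lin_right)
    qed
    have "\<exists>l\<in>B. y l \<noteq> 0"
    proof (rule ccontr)
      assume "\<not> ?thesis"
      then have z: "y b0 = 0" "y b1 = 0" "y b2 = 0" using Bs by auto
      have "u 0 = 0" using z(1) b0 Bs by (simp add: y_def y1_def)
      then have "u 1 \<noteq> 0" "u 1 * s = 0" "u 1 * t = 0" using ux(1) z(2,3) Bs by (auto simp: y_def y1_def)
      then show False using st(1) by simp
    qed
    moreover have "bil A B G x y = 0" by (simp add: y_def bil_lin_right Gy0 Gy1)
    moreover have "bil A B f x y = 0" if "f \<in> {f1, f2, f3}" for f
      using ux(3) that unfolding tr[symmetric] by blast
    ultimately show ?thesis using ux(2) by (intro exI[of _ x] exI[of _ y]) simp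
  next
    case False
    \<comment> \<open>Perpendicular to the image of \<open>(s, t)\<close> under \<open>C\<close>. It
      is linear in \<open>s\<close> and \<open>t\<close>, so the forms below become linear or
      quadratic.\<close>
    define xs where "xs = (\<lambda>s t i. - (C a2 b1 * s + C a2 b2 * t) * axis a1 i + (C a1 b1 * s + C a1 b2 * t) * axis a2 i)"
    define ys where "ys = (\<lambda>s t l. s * axis b1 l + t * axis b2 l)"
    have A12: "a1 \<in> A" "a2 \<in> A" "b1 \<in> B" "b2 \<in> B" using As Bs by auto
    have Gs: "bil A B G (xs s t) (ys s t) = 0" for s t
      unfolding xs_def ys_def bil_lin_left bil_lin_right by (simp add: C A12 algebra_simps)
    define m where "m = (\<lambda>f. (- C a2 b1 * bil A B f (axis a1) y0 + C a1 b1 * bil A B f (axis a2) y0,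
        - C a2 b2 * bil A B f (axis a1) y0 + C a1 b2 * bil A B f (axis a2) y0))"
    define l where "l = (\<lambda>f. (bil A B f x0 (axis b1), bil A B f x0 (axis b2)))"
    define q where "q = (\<lambda>f. (- C a2 b1 * f (a1, b1) + C a1 b1 * f (a2, b1),
        - C a2 b2 * f (a1, b1) + C a1 b2 * f (a2, b1) - C a2 b1 * f (a1, b2) + C a1 b1 * f (a2, b2),
        - C a2 b2 * f (a1, b2) + C a1 b2 * f (a2, b2)))"
    have ml: "bil A B f (xs s t) y0 = lin (m f) s t" "bil A B f x0 (ys s t) = lin (l f) s t" for f s t
      unfolding xs_def ys_def bil_lin_left bil_lin_right lin_def m_def l_def by (simp_all add: algebra_simps)
    have qq: "bil A B f (xs s t) (ys s t) = quad (q f) s t" for f s t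
      unfolding xs_def ys_def bil_lin_left bil_lin_right quad_def q_def
      by (simp add: bil_axis fin A12 algebra_simps power2_eq_square)
    let ?sol = "\<lambda>f1 f2 f3. \<exists>x y. (\<exists>i\<in>A. x i \<noteq> 0) \<and> (\<exists>l\<in>B. y l \<noteq> 0) \<and> bil A B G x y = 0 \<and>
      bil A B f1 x y = 0 \<and> bil A B f2 x y = 0 \<and> bil A B f3 x y = 0"
    have core: "?sol f1 f2 f3" if a: "bil A B f1 x0 y0 \<noteq> 0" "bil A B f2 x0 y0 = 0" "bil A B f3 x0 y0 = 0" for f1 f2 f3
    proof -
      obtain s t \<kappa> \<mu> z w where sol: "s \<noteq> 0 \<or> t \<noteq> 0" "\<kappa> \<noteq> 0 \<or> z \<noteq> 0" "\<mu> \<noteq> 0 \<or> w \<noteq> 0"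
        "solvable (quad (q f1)) (lin (m f1)) (lin (l f1)) (bil A B f1 x0 y0) s t \<kappa> \<mu> z w"
        "solvable (quad (q f2)) (lin (m f2)) (lin (l f2)) 0 s t \<kappa> \<mu> z w"
        "solvable (quad (q f3)) (lin (m f3)) (lin (l f3)) 0 s t \<kappa> \<mu> z w"
        using common_zero_scroll[OF a(1), of "q f1" "m f1" "l f1" "q f2" "m f2" "l f2" "q f3" "m f3" "l f3"]
        by blast
      define x where "x = (\<lambda>i. \<kappa> * xs s t i + z * x0 i)"
      define y where "y = (\<lambda>l. \<mu> * ys s t l + w * y0 l)"
      have bxy: "bil A B f x y = \<kappa> * \<mu> * bil A B f (xs s t) (ys s t) + \<kappa> * w * bil A B f (xs s t) y0
          + \<mu> * z * bil A B f x0 (ys s t) + z * w * bil A B f x0 y0" for f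
        unfolding x_def y_def bil_lin_left bil_lin_right by (simp add: algebra_simps)
      have "bil A B f1 x y = 0" "bil A B f2 x y = 0" "bil A B f3 x y = 0"
        using sol(4-6) a(2,3) unfolding bxy qq ml solvable_def by (simp_all add: mult_ac)
      moreover have "bil A B G x y = 0" unfolding bxy Gs Gx0 Gy0 by simp
      moreover have "\<exists>i\<in>A. x i \<noteq> 0"
      proof (rule ccontr)
        assume "\<not> ?thesis"
        then have e: "x a0 = 0" "x a1 = 0" "x a2 = 0" using As by auto
        have z0: "z = 0" using e(1) a0 As by (simp add: x_def xs_def)
        then have k: "\<kappa> \<noteq> 0" using sol(2) by simp
        have e1: "C a2 b1 * s + C a2 b2 * t = 0" using e(2) z0 k As by (simp add: x_def xs_def neg_eq_iff_add_eq_0)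
        have e2: "C a1 b1 * s + C a1 b2 * t = 0" using e(3) z0 k As by (simp add: x_def xs_def)
        have "(C a1 b1 * C a2 b2 - C a1 b2 * C a2 b1) * s =
            C a2 b2 * (C a1 b1 * s + C a1 b2 * t) - C a1 b2 * (C a2 b1 * s + C a2 b2 * t)" by (simp add: algebra_simps)
        moreover have "(C a1 b1 * C a2 b2 - C a1 b2 * C a2 b1) * t =
            C a1 b1 * (C a2 b1 * s + C a2 b2 * t) - C a2 b1 * (C a1 b1 * s + C a1 b2 * t)" by (simp add: algebra_simps)
        ultimately show False using e1 e2 False sol(1) by simp
      qed
      moreover have "\<exists>l\<in>B. y l \<noteq> 0"
      proof (rule ccontr)
        assume "\<not> ?thesis"
        then have e: "y b0 = 0" "y b1 = 0" "y b2 = 0" using Bs by auto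
        have z0: "w = 0" using e(1) b0 Bs by (simp add: y_def ys_def)
        then show False using e(2,3) sol(1,3) Bs by (auto simp: y_def ys_def)
      qed
      ultimately show ?thesis by blast
    qed
    have perm: "?sol f1 f2 f3" if a: "bil A B f1 x0 y0 \<noteq> 0" for f1 f2 f3
    proof -
      \<comment> \<open>Adding a multiple of \<open>f1\<close> makes the other two forms vanish at
        \<open>(x0, y0)\<close>, which removes their terms in \<open>z * w\<close>.\<close>
      define k where "k = (\<lambda>f. - (bil A B f x0 y0 / bil A B f1 x0 y0))"
      define h where "h = (\<lambda>f p. 1 * f p + k f * f1 p)"
      have h: "bil A B (h f) x y = bil A B f x y + k f * bil A B f1 x y" for f x y
        unfolding h_def bil_lin_form by simp
      have "bil A B (h f) x0 y0 = 0" for f using a by (simp add: h k_def)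
      from core[OF a this this, of f2 f3] obtain x y where xy: "\<exists>i\<in>A. x i \<noteq> 0" "\<exists>l\<in>B. y l \<noteq> 0"
        "bil A B G x y = 0" "bil A B f1 x y = 0" "bil A B (h f2) x y = 0" "bil A B (h f3) x y = 0" by blast
      have "bil A B f2 x y = 0" "bil A B f3 x y = 0" using xy(4-6) by (simp_all add: h)
      then show ?thesis using xy(1-4) by blast
    qed
    consider "bil A B f1 x0 y0 \<noteq> 0" | "bil A B f2 x0 y0 \<noteq> 0" | "bil A B f3 x0 y0 \<noteq> 0"
      | "bil A B f1 x0 y0 = 0" "bil A B f2 x0 y0 = 0" "bil A B f3 x0 y0 = 0" by blast
    then show ?thesis
    proof cases
      case 1
      then show ?thesis by (rule perm)
    next
      case 2
      then show ?thesis using perm[of f2 f1 f3] by blast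
    next
      case 3
      then show ?thesis using perm[of f3 f1 f2] by blast
    next
      case 4
      then show ?thesis using x0(1) y0 Gy0 by blast
    qed
  qed
qed

text \<open>The Segre variety of two planes has dimension 4, so it meets every linear subspace of
  codimension 4. The zeros of a singular form in the span of the four can be parametrised.\<close>

lemma common_zero_3:
  fixes F :: "('a \<times> 'b \<Rightarrow> complex) set"
  assumes A: "card A = 3" and B: "card B = 3" and F: "finite F" "card F \<le> 4"
  shows "\<exists>x y. (\<exists>i\<in>A. x i \<noteq> 0) \<and> (\<exists>l\<in>B. y l \<noteq> 0) \<and> (\<forall>f\<in>F. bil A B f x y = 0)"
proof -
  have fin: "finite A" "finite B" using A B card.infinite by fastforce+
  obtain e where e: "bij_betw e {..<card F} F" using ex_bij_betw_nat_finite[OF F(1)] by (auto simp: atLeast0LessThan)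
  define g where "g = (\<lambda>q. if q < card F then e q else (\<lambda>_. 0))"
  have Fg: "f \<in> {g 0, g 1, g 2, g 3}" if f: "f \<in> F" for f
  proof -
    obtain q where q: "q < card F" "f = e q" using e f by (auto simp: bij_betw_def)
    then have "q \<in> {0, 1, 2, 3}" using F(2) by auto
    then show ?thesis using q by (auto simp: g_def)
  qed
  define R where "R = (\<lambda>i (p :: nat \<times> 'b). g (fst p) (i, snd p))"
  have B_ne: "B \<noteq> {}" using B by auto
  \<comment> \<open>The pencil of the first two forms gives three equations on a 2 x 3 system, so
    some combination \<open>G\<close> of the two has a kernel vector \<open>y0\<close>.\<close>
  have "card (R ` A) \<le> card B" using card_image_le[OF fin(1), of R] A B by simp
  then obtain c y0 where c: "\<exists>q\<in>{0, 1}. c q \<noteq> 0" "\<exists>l\<in>B. y0 l \<noteq> 0" "\<forall>f\<in>R ` A. bil {0, 1} B f c y0 = 0"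
    using common_zero_2[of "{0, 1 :: nat}" B "R ` A"] fin B_ne by auto
  define G where "G = (\<lambda>p. c 0 * g 0 p + c 1 * g 1 p)"
  have G: "(\<Sum>l\<in>B. G (i, l) * y0 l) = 0" if "i \<in> A" for i
  proof -
    have "(\<Sum>l\<in>B. G (i, l) * y0 l) = bil {0, 1} B (R i) c y0"
      by (simp add: bil_right G_def R_def sum_distrib_left sum.distrib algebra_simps)
    then show ?thesis using c(3) that by simp
  qed
  have Gb: "bil A B G x y = c 0 * bil A B (g 0) x y + c 1 * bil A B (g 1) x y" for x y
    unfolding G_def by (rule bil_lin_form)
  \<comment> \<open>Together with \<open>G\<close> this recovers both \<open>g 0\<close> and
    \<open>g 1\<close>: if \<open>c 0 = 0\<close>, then \<open>G\<close> is a nonzero multiple of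
    \<open>g 1\<close>.\<close>
  define g' where "g' = (if c 0 = 0 then g 0 else g 1)"
  obtain x y where xy: "\<exists>i\<in>A. x i \<noteq> 0" "\<exists>l\<in>B. y l \<noteq> 0" "bil A B G x y = 0"
    "bil A B g' x y = 0" "bil A B (g 2) x y = 0" "bil A B (g 3) x y = 0"
    using common_zero_3_degenerate[OF A B c(2) G, of g' "g 2" "g 3"] by blast
  have "bil A B (g 0) x y = 0 \<and> bil A B (g 1) x y = 0"
    using xy(3,4) c(1) unfolding Gb by (auto simp: g'_def split: if_splits)
  then have "\<forall>f\<in>F. bil A B f x y = 0" using xy(5,6) Fg by blast
  then show ?thesis using xy(1,2) by blast
qed

section \<open>Reduction to smaller systems\<close>


lemma neg_ge_le:
  assumes "\<And>v. qform J' M' v \<le> qform J M v" "neg_ge J M k"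
  shows "neg_ge J' M' k" using assms unfolding neg_ge_def by (meson le_less_trans)

lemma sform_restrict:
  assumes "finite J" "K \<subseteq> J" and z: "\<And>a b. a \<in> J \<Longrightarrow> b \<in> J \<Longrightarrow> a \<notin> K \<or> b \<notin> K \<Longrightarrow> cnj (u a) * M a b * v b = 0"
  shows "sform J M u v = sform K M u v"
proof -
  have "sform J M u v = (\<Sum>a\<in>K. \<Sum>b\<in>J. cnj (u a) * M a b * v b)"
    unfolding sform_def using assms(1,2) by (intro sum.mono_neutral_right) (auto intro!: sum.neutral z simp del: mult_eq_0_iff)
  also have "\<dots> = sform K M u v" unfolding sform_def
  proof (rule sum.cong[OF refl])
    fix a assume "a \<in> K"
    then show "(\<Sum>b\<in>J. cnj (u a) * M a b * v b) = (\<Sum>b\<in>K. cnj (u a) * M a b * v b)"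
      using assms(1,2) by (intro sum.mono_neutral_right) (auto intro!: z simp del: mult_eq_0_iff)
  qed
  finally show ?thesis .
qed

text \<open>Elimination of the indices outside \<open>J'\<close> when no row among them except that
  of \<open>f\<close> is nonzero. Allowing the row of \<open>f\<close> to vanish as well keeps the
  formula \<open>N c d - N c f * N f d\<close> valid without a division.\<close>

locale one_axis =
  fixes J J' :: "'i set" and f :: 'i and N :: "'i \<Rightarrow> 'i \<Rightarrow> complex"
  assumes fin: "finite J" and sub: "J' \<subseteq> J" and f: "f \<in> J" "f \<notin> J'" and herm: "herm_on J N"
    and zero: "\<And>a b. a \<in> J - J' - {f} \<Longrightarrow> b \<in> J \<Longrightarrow> N a b = 0"
    and ff: "N f f = 1 \<or> (\<forall>b\<in>J. N f b = 0)"
begin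

text \<open>The coordinate at \<open>f\<close> is the one that annihilates the square in
  \<open>sform_split\<close>.\<close>

definition lift :: "('i \<Rightarrow> complex) \<Rightarrow> 'i \<Rightarrow> complex" where
  "lift u = (\<lambda>a. if a = f then - (\<Sum>c\<in>J'. N f c * u c) else if a \<in> J' then u a else 0)"

lemma sform_split:
  "sform J N u v = sform J' (\<lambda>c d. N c d - N c f * N f d) u v
    + N f f * cnj (u f + (\<Sum>c\<in>J'. N f c * u c)) * (v f + (\<Sum>c\<in>J'. N f c * v c))"
proof -
  let ?m = "\<lambda>u. \<Sum>c\<in>J'. N f c * u c"
  have fJ': "finite J'" using sub fin by (rule finite_subset)
  have zero': "N b a = 0" if "a \<in> J - J' - {f}" "b \<in> J" for a b
    using zero[OF that] herm_onD[OF herm, of a b] that by auto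
  have row: "(\<Sum>b\<in>J. g b) = (\<Sum>b\<in>insert f J'. g b)" if "\<And>b. b \<in> J - J' - {f} \<Longrightarrow> g b = 0" for g :: "'i \<Rightarrow> complex"
    using sub f that fin by (intro sum.mono_neutral_right) auto
  have "sform J N u v = (\<Sum>a\<in>insert f J'. \<Sum>b\<in>J. cnj (u a) * N a b * v b)"
    unfolding sform_def by (rule row) (simp add: zero)
  also have "\<dots> = (\<Sum>a\<in>insert f J'. \<Sum>b\<in>insert f J'. cnj (u a) * N a b * v b)"
  proof (rule sum.cong[OF refl], rule row)
    fix a b assume "a \<in> insert f J'" "b \<in> J - J' - {f}"
    then have "N a b = 0" using zero'[of b a] sub f by blast
    then show "cnj (u a) * N a b * v b = 0" by simp
  qed
  also have "\<dots> = cnj (u f) * N f f * v f + cnj (u f) * ?m v + (\<Sum>a\<in>J'. cnj (u a) * N a f) * v f + sform J' N u v"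
    using f fJ' by (simp add: sform_def sum.distrib sum_distrib_left sum_distrib_right mult.assoc)
  also have "(\<Sum>a\<in>J'. cnj (u a) * N a f) = cnj (?m u)" unfolding cnj_sum
  proof (rule sum.cong[OF refl])
    fix a assume "a \<in> J'"
    then show "cnj (u a) * N a f = cnj (N f a * u a)" using herm_onD[OF herm, of f a] f sub by (auto simp: mult.commute)
  qed
  finally have 1: "sform J N u v = cnj (u f) * N f f * v f + cnj (u f) * ?m v + cnj (?m u) * v f + sform J' N u v" .
  have "sform J' (\<lambda>c d. N c d - N c f * N f d) u v = sform J' N u v - (\<Sum>c\<in>J'. \<Sum>d\<in>J'. cnj (u c) * N c f * (N f d * v d))"
    by (simp add: sform_def algebra_simps sum_subtractf)
  also have "(\<Sum>c\<in>J'. \<Sum>d\<in>J'. cnj (u c) * N c f * (N f d * v d)) = (\<Sum>a\<in>J'. cnj (u a) * N a f) * ?m v"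
    by (simp add: sum_product)
  also have "(\<Sum>a\<in>J'. cnj (u a) * N a f) = cnj (?m u)" by fact
  finally have 2: "sform J' N u v = sform J' (\<lambda>c d. N c d - N c f * N f d) u v + cnj (?m u) * ?m v" by simp
  show ?thesis using ff
  proof
    assume "N f f = 1"
    then show ?thesis unfolding 1 2 by (simp add: algebra_simps)
  next
    assume "\<forall>b\<in>J. N f b = 0"
    then have "N f f = 0" "?m u = 0" "?m v = 0" using f sub by (auto intro!: sum.neutral)
    then show ?thesis unfolding 1 2 by simp
  qed
qed

lemma sform_lift: "sform J N (lift u) (lift v) = sform J' (\<lambda>c d. N c d - N c f * N f d) u v"
proof -
  have "lift u f + (\<Sum>c\<in>J'. N f c * lift u c) = 0" for u
  proof -
    have "(\<Sum>c\<in>J'. N f c * lift u c) = (\<Sum>c\<in>J'. N f c * u c)"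
      using f by (intro sum.cong refl) (auto simp: lift_def)
    then show ?thesis by (simp add: lift_def)
  qed
  moreover have "sform J' M (lift u) (lift v) = sform J' M u v" for M
    using f by (intro sform_cong) (auto simp: lift_def)
  ultimately show ?thesis unfolding sform_split by simp
qed

text \<open>Positive directions are lifted, but negative ones travel the other way: the omitted
  square is nonnegative, so a subspace negative for \<open>N\<close> is negative for the
  complement.\<close>

lemma sform_schur_le: "qform J' (\<lambda>c d. N c d - N c f * N f d) v \<le> qform J N v"
proof -
  define x where "x = v f + (\<Sum>c\<in>J'. N f c * v c)"
  have "0 \<le> Re (N f f * cnj x * x)"
    using ff f by (auto simp: mult.commute[of "cnj x"] complex_mult_cnj)
  then show ?thesis unfolding sform_split[of v v] x_def by simp
qed

end

context normal_pair
begin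

text \<open>By \<open>z\<close>, all rows of \<open>H\<close> at \<open>a0\<close> other than that
  of \<open>bs\<close> vanish, and so do those of the state. One elimination step therefore removes
  \<open>a0\<close> altogether, and it commutes with partial transposition.\<close>

lemma reduction:
  assumes bs: "bs \<in> B" and z: "\<And>j l k. j \<in> A \<Longrightarrow> l \<in> B \<Longrightarrow> k \<in> B \<Longrightarrow> k \<noteq> bs \<Longrightarrow> r (j, k) (a0, l) = 0"
  obtains \<sigma> where "psd_on ((A - {a0}) \<times> B) \<sigma>"
    "\<And>k. pos_pt (A - {a0}) B \<sigma> k \<Longrightarrow> pos_pt A B r k"
    "\<And>k. neg_pt A B r k \<Longrightarrow> neg_pt (A - {a0}) B \<sigma> k"
proof -
  let ?J = "A \<times> B" and ?J' = "(A - {a0}) \<times> B" and ?f = "(a0, bs)"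
  have z0: "r (a0, k) (j, l) = 0" "r (j, l) (a0, k) = 0" if "j \<in> A" "l \<in> B" "k \<in> B" "k \<noteq> bs" for j k l
    using zero_row[OF a0 _ _ _ z[OF a0 that(3) that(3) that(4)]] that by auto
  have f1: "r ?f ?f = 1 \<or> (\<forall>b\<in>?J. r ?f b = 0)"
    using unitB[OF bs] zero_row(1)[OF a0 bs] by auto
  have f2: "pt r ?f ?f = 1 \<or> (\<forall>b\<in>?J. pt r ?f b = 0)"
  proof (cases "r ?f ?f = 1")
    case False
    then have "r ?f ?f = 0" using unitB[OF bs] by simp
    have "pt r ?f (j, l) = 0" if "j \<in> A" "l \<in> B" for j l
      using z0(2)[of j bs l] zero_row(2)[OF a0 bs that(1) bs \<open>r ?f ?f = 0\<close>] that bs by (cases "l = bs") auto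
    then show ?thesis by auto
  qed simp
  interpret R: one_axis ?J ?J' ?f r by unfold_locales (use fin herm_r a0 bs z0 f1 in auto)
  have zpt: "pt r a b = 0" if ab: "a \<in> ?J - ?J' - {?f}" "b \<in> ?J" for a b
  proof -
    obtain k where "a = (a0, k)" "k \<in> B" "k \<noteq> bs" using ab(1) by auto
    moreover obtain j l where "b = (j, l)" "j \<in> A" "l \<in> B" using ab(2) by auto
    ultimately show ?thesis by (simp add: z)
  qed
  interpret M: one_axis ?J ?J' ?f "pt r" by unfold_locales (use fin herm_pt a0 bs zpt f2 in auto)
  define \<sigma> where "\<sigma> = (\<lambda>c d. r c d - r c ?f * r ?f d)"
  have psd\<sigma>: "psd_on ?J' \<sigma>" unfolding psd_on_def
  proof (intro conjI allI)
    show "herm_on ?J' \<sigma>" unfolding herm_on_def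
    proof (intro ballI)
      fix a b assume "a \<in> ?J'" "b \<in> ?J'"
      then have "a \<in> ?J" "b \<in> ?J" "?f \<in> ?J" using a0 bs by auto
      then show "\<sigma> b a = cnj (\<sigma> a b)" by (simp add: \<sigma>_def herm_onD[OF herm_r] mult.commute)
    qed
    show "0 \<le> qform ?J' \<sigma> v" for v
      unfolding \<sigma>_def R.sform_lift[symmetric] by (rule psd_on_nonneg[OF psd])
  qed
  have pt\<sigma>: "pt \<sigma> c d = pt r c d - pt r c ?f * pt r ?f d" if cd0: "c \<in> ?J'" "d \<in> ?J'" for c d
  proof -
    obtain i k j l where cd: "c = (i, k)" "d = (j, l)" "i \<in> A" "j \<in> A" "k \<in> B" "l \<in> B" using cd0 by auto
    \<comment> \<open>The correction terms with and without partial transposition: both are 0 unless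
      \<open>k = l = bs\<close>, and then the two factors are merely exchanged.\<close>
    have "r (j, k) (a0, bs) * r (a0, bs) (i, l) = r (a0, k) (i, bs) * r (j, bs) (a0, l)"
    proof (cases "k = bs")
      case False
      then show ?thesis using z0[OF cd(4) bs cd(5)] z0[OF cd(3) bs cd(5)] z[OF cd(4) bs cd(5)] by simp
    next
      case True
      then show ?thesis using z0(2)[OF cd(4) bs cd(6)] z[OF cd(3) bs cd(6)]
          herm_onD[OF herm_r, of "(i, l)" "(a0, bs)"] cd a0 bs by (cases "l = bs") auto
    qed
    then show ?thesis by (simp add: cd \<sigma>_def)
  qed
  have e: "sform ?J' (pt \<sigma>) u v = sform ?J' (\<lambda>c d. pt r c d - pt r c ?f * pt r ?f d) u v" for u v
    by (intro sform_cong refl pt\<sigma>)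
  show thesis
  proof (rule that[OF psd\<sigma>])
    show "pos_ge ?J (pt r) k" if "pos_ge ?J' (pt \<sigma>) k" for k
      by (rule pos_ge_transfer[OF that, of _ _ M.lift]) (simp add: e M.sform_lift)
    show "neg_ge ?J' (pt \<sigma>) k" if "neg_ge ?J (pt r) k" for k
      by (rule neg_ge_le[OF _ that]) (simp add: e M.sform_schur_le)
  qed
qed

lemma normal_pair_swp: "normal_pair B A b0 a0 (swp r)"
proof
  show "normal_form B A b0 a0 (swp r)"
    unfolding normal_form_def using finAB a0 b0 psd_on_swp[OF psd] cross unitA unitB
    by (auto simp: diagA diagB)
qed

end

text \<open>The doubly degenerate configuration: each local block has exactly one entry 1, at
  \<open>a2\<close> and at \<open>b2\<close>.\<close>

locale rank_one_pair = normal_pair A B a0 b0 r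
  for A :: "'a set" and B :: "'b set" and a0 b0 r +
  fixes a1 a2 b1 b2
  assumes A: "A = {a0, a1, a2}" "a0 \<noteq> a1" "a0 \<noteq> a2" "a1 \<noteq> a2" and B: "B = {b0, b1, b2}" "b0 \<noteq> b1" "b0 \<noteq> b2" "b1 \<noteq> b2"
    and eA: "r (a1, b0) (a1, b0) = 0" "r (a2, b0) (a2, b0) = 1"
    and eB: "r (a0, b1) (a0, b1) = 0" "r (a0, b2) (a0, b2) = 1"
begin

lemma mem: "a1 \<in> A" "a2 \<in> A" "b1 \<in> B" "b2 \<in> B" using A B by auto

lemmas za = zero_row[OF mem(1) b0 _ _ eA(1)] and zb = zero_row[OF a0 mem(3) _ _ eB(1)]

text \<open>Five arises as two axes, the residual of \<open>(a1, b1)\<close> and two hyperbolic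
  planes from the isotropic axes \<open>(a0, b1)\<close> and \<open>(a1, b0)\<close>. By
  \<open>u\<close> the row of \<open>(a1, b1)\<close> in the state is nonzero, so its diagonal entry
  is positive, and the zero rows decouple it from the axes.\<close>

lemma rank_one_case:
  assumes u: "r (a1, b1) (a0, b2) \<noteq> 0" and l: "l \<in> B" "r (a2, b0) (a1, l) \<noteq> 0"
  shows "pos_pt A B r 5"
proof -
  let ?J = "A \<times> B" and ?M = "pt r"
  have "r (a1, b1) (a1, b1) \<noteq> 0" using zero_row(1)[OF mem(1) mem(3) a0 mem(4)] u by auto
  moreover have "0 \<le> Re (r (a1, b1) (a1, b1))" "Im (r (a1, b1) (a1, b1)) = 0"
    using psd_on_nonneg[OF psd, of "axis (a1, b1)"] sform_real[OF herm_r, of "axis (a1, b1)"] mem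
    by (simp_all add: sform_axis[OF fin])
  ultimately have r11: "0 < Re (r (a1, b1) (a1, b1))" by (auto simp: complex_eq_iff)
  define F where "F = {a0} \<times> {b2} \<union> {a2} \<times> {b0}"
  have "{b2} \<subseteq> B - {b0}" "{a2} \<subseteq> A - {a0}" using A B by auto
  note ax = axes[OF this, folded F_def]
  interpret F: orthonormal_axes ?J ?M F by (rule ax(1)) (use eA eB in auto)
  have Fs: "F = {(a0, b2), (a2, b0)}" by (auto simp: F_def)
  define c where "c = (a1, b1)"
  have cJ: "c \<in> ?J" using mem by (simp add: c_def)
  have Mc: "?M f c = 0" "?M c f = 0" if "f \<in> F" for f
    using that Fs a0 b0 mem za zb by (auto simp: c_def)
  have Sc: "schur_compl ?M F c c = r c c" using Mc by (simp add: schur_compl_def c_def)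
  define U where "U = insert (residual ?M F c) (axis ` F)"
  have U: "orth_pos ?J ?M U" "card U = 3"
    using F.orth_pos_residual[OF cJ] Sc r11 A(3) by (auto simp: U_def c_def Fs)
  define z1 z2 w1 w2 where z: "z1 = axis (a0, b1)" "z2 = axis (a1, b0)" "w1 = axis (a1, b2)" "w2 = axis (a2, l)"
  have orth: "sform ?J ?M (axis x) y = 0" if yx: "y \<in> U" "x \<in> {(a0, b1), (a1, b0)}" for x y
  proof -
    have xJ: "x \<in> ?J" using yx mem a0 b0 by auto
    have xc: "?M x c = 0" using yx a0 b0 mem za zb by (auto simp: c_def)
    have xF: "?M x f = 0" if "f \<in> F" for f
      using that yx(2) Fs a0 b0 mem za zb A B by (auto simp: corner diagA diagB)
    have "sform ?J ?M (axis x) (residual ?M F c) = 0"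
      using F.sform_axis_residual[OF xJ cJ] xc xF by (simp add: schur_compl_def)
    moreover have "sform ?J ?M (axis x) (axis f) = 0" if "f \<in> F" for f
      using sform_axis[OF fin xJ, of f ?M] that F.F xF by auto
    ultimately show ?thesis using yx(1) unfolding U_def by blast
  qed
  have orth': "sform ?J ?M y (axis x) = 0" if "y \<in> U" "x \<in> {(a0, b1), (a1, b0)}" for x y
    using orth[OF that] sform_swap[OF herm_pt, of y "axis x"] by simp
  have "sform ?J ?M z1 z1 = 0" "sform ?J ?M z1 w1 \<noteq> 0"
    using mem a0 b0 eB u by (simp_all add: z sform_axis[OF fin])
  from orth_pos_insert_isotropic[OF herm_pt U(1) _ this]
  obtain v where v: "orth_pos ?J ?M (insert v U)" "v \<notin> U"
    "\<And>y. (\<And>u. u \<in> U \<Longrightarrow> sform ?J ?M y u = 0) \<Longrightarrow> sform ?J ?M y z1 = 0 \<Longrightarrow> sform ?J ?M y w1 = 0 \<Longrightarrow> sform ?J ?M y v = 0"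
    using orth' unfolding z by auto
  \<comment> \<open>The partner \<open>(a1, b2)\<close> of \<open>z1\<close> pairs with
    \<open>z2\<close> to an entry in the zero row of \<open>(a1, b0)\<close>, so the second plane
    can be added orthogonally to the first.\<close>
  have "sform ?J ?M z2 v = 0"
    by (rule v(3)) (use orth mem a0 b0 za in \<open>auto simp: z sform_axis[OF fin] corner\<close>)
  then have "sform ?J ?M v z2 = 0" using sform_swap[OF herm_pt, of v z2] by simp
  then have o2: "sform ?J ?M y z2 = 0" if "y \<in> insert v U" for y using that orth' by (auto simp: z)
  have "sform ?J ?M z2 z2 = 0" "sform ?J ?M z2 w2 \<noteq> 0"
    using mem a0 b0 eA l by (simp_all add: z sform_axis[OF fin])
  from orth_pos_insert_isotropic[OF herm_pt v(1) o2 this]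
  obtain v' where "orth_pos ?J ?M (insert v' (insert v U))" "v' \<notin> insert v U" by metis
  moreover have "finite U" using U(1) by (simp add: orth_pos_def)
  ultimately show ?thesis using U(2) v(2) unfolding pos_ge_def
    by (intro exI[of _ "insert v' (insert v U)"]) auto
qed

text \<open>The four positive directions are two axes, the residual of \<open>(a1, b2)\<close>,
  positive because Bessel's inequality for the state also contains
  \<open>r (a2, b0) (a1, b2)\<close>, and one hyperbolic plane. Three negative directions are
  impossible: some nontrivial combination would vanish at \<open>(a2, b1)\<close> and
  \<open>(a2, b2)\<close>, and on such vectors \<open>H\<close> is nonnegative.\<close>

lemma rank_one_dependent_case:
  assumes u1: "r (a1, b1) (a0, b2) = 0" "r (a2, b0) (a1, b1) = 0"
    and u2: "r (a2, b1) (a0, b2) \<noteq> 0" "r (a2, b0) (a1, b2) \<noteq> 0"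
  shows "pos_pt A B r 4 \<and> \<not> neg_pt A B r 3"
proof
  let ?J = "A \<times> B" and ?M = "pt r"
  define F where "F = {a0} \<times> {b2} \<union> {a2} \<times> {b0}"
  have LI: "{b2} \<subseteq> B - {b0}" "{a2} \<subseteq> A - {a0}" using A B by auto
  have one: "\<And>k. k \<in> {b2} \<Longrightarrow> r (a0, k) (a0, k) = 1" "\<And>i. i \<in> {a2} \<Longrightarrow> r (i, b0) (i, b0) = 1"
    using eA eB by auto
  note ax = axes[OF LI one, folded F_def]
  interpret F: orthonormal_axes ?J ?M F by (rule ax(1))
  have Fs: "F = {(a0, b2), (a2, b0)}" by (auto simp: F_def)
  have ne: "(a0, b2) \<noteq> (a2, b0)" using A by auto
  define c where "c = (a1, b2)"
  have cJ: "c \<in> ?J" using mem by (simp add: c_def)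
  define ka where "ka = r (a0, b2) (a1, b2)"
  define la where "la = r (a2, b0) (a1, b2)"
  define rh where "rh = r (a1, b1) (a1, b2)"
  have cJs: "cnj (r a b) = r b a" if "a \<in> ?J" "b \<in> ?J" for a b using herm_onD[OF herm_r that] .
  have ka': "r (a1, b2) (a0, b2) = cnj ka" and la': "r (a1, b2) (a2, b0) = cnj la" and rh': "r (a1, b2) (a1, b1) = cnj rh"
    using cJs mem a0 b0 by (simp_all add: ka_def la_def rh_def)
  have "(\<Sum>f\<in>F. (cmod (?M f c))\<^sup>2) = (cmod ka)\<^sup>2"
    unfolding Fs using ne za(1)[OF mem(2) mem(4)] by (simp add: c_def ka')
  then have "Re (schur_compl ?M F c c) = Re (r c c) - (cmod ka)\<^sup>2"
    by (simp add: F.schur_compl_diag[OF cJ]) (simp add: c_def)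
  moreover have "(cmod ka)\<^sup>2 + (cmod la)\<^sup>2 \<le> Re (r c c)"
    using bessel[OF ax(2) psd cJ] ne unfolding Fs by (simp add: c_def ka_def la_def)
  moreover have "0 < (cmod la)\<^sup>2" using u2 by (simp add: la_def)
  ultimately have Sc: "0 < Re (schur_compl ?M F c c)" by linarith
  define U where "U = insert (residual ?M F c) (axis ` F)"
  have U: "orth_pos ?J ?M U" "card U = 3"
    using F.orth_pos_residual[OF cJ Sc] ne by (auto simp: U_def Fs)
  let ?x = "(a0, b1)"
  have xJ: "?x \<in> ?J" using mem a0 by simp
  have xF: "?M ?x f = 0" if "f \<in> F" for f
    using that Fs a0 b0 mem A B by (auto simp: corner diagB)
  have orth: "sform ?J ?M y (axis ?x) = 0" if "y \<in> U" for y
  proof -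
    have "sform ?J ?M (axis ?x) (residual ?M F c) = 0"
      using F.sform_axis_residual[OF xJ cJ] u1 xF by (simp add: schur_compl_def c_def)
    moreover have "sform ?J ?M (axis ?x) (axis f) = 0" if "f \<in> F" for f
      using sform_axis[OF fin xJ, of f ?M] that F.F xF by auto
    ultimately have "sform ?J ?M (axis ?x) y = 0" using that unfolding U_def by blast
    then show ?thesis using sform_swap[OF herm_pt, of y "axis ?x"] by simp
  qed
  have "sform ?J ?M (axis ?x) (axis ?x) = 0" "sform ?J ?M (axis ?x) (axis (a2, b2)) \<noteq> 0"
    using mem a0 b0 eB u2 by (simp_all add: sform_axis[OF fin])
  from orth_pos_insert_isotropic[OF herm_pt U(1) orth this]
  obtain v where "orth_pos ?J ?M (insert v U)" "v \<notin> U" by metis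
  then show "pos_ge ?J ?M 4" using U unfolding pos_ge_def orth_pos_def
    by (intro exI[of _ "insert v U"]) auto
  show "\<not> neg_ge ?J ?M 3"
  proof
    assume "neg_ge ?J ?M 3"
    then obtain w :: "nat \<Rightarrow> 'a \<times> 'b \<Rightarrow> complex" where w: "\<And>c. (\<exists>p<3. c p \<noteq> 0) \<Longrightarrow>
        qform ?J ?M (lincomb {..<3} c w) < 0" unfolding neg_ge_def by blast
    obtain g where g: "\<exists>p\<in>{..<3}. g p \<noteq> 0" "\<forall>e\<in>{(a2, b1), (a2, b2)}. (\<Sum>p<3. g p * w p e) = 0"
      using homogeneous_system[of "{(a2, b1), (a2, b2)}" "{..<3::nat}" "\<lambda>e p. w p e"] B(4) by auto
    define y where "y = (lincomb {..<3} g w)"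
    have neg: "qform ?J ?M y < 0" unfolding y_def using w g(1) by auto
    have y0: "y (a2, b1) = 0" "y (a2, b2) = 0" using g(2) by (auto simp: y_def)
    \<comment> \<open>For \<open>y\<close> vanishing at the two indices, only these four coordinates
      contribute to the form of \<open>H\<close>.\<close>
    define K where "K = {(a0, b2), (a2, b0), (a1, b1), c}"
    have neq: "a0 \<noteq> a1" "a0 \<noteq> a2" "a1 \<noteq> a2" "a1 \<noteq> a0" "a2 \<noteq> a0" "a2 \<noteq> a1"
      "b0 \<noteq> b1" "b0 \<noteq> b2" "b1 \<noteq> b2" "b1 \<noteq> b0" "b2 \<noteq> b0" "b2 \<noteq> b1" using A B by auto
    have out: "y a = 0 \<or> y b = 0 \<or> ?M a b = 0" if ab: "a \<in> ?J - K" "b \<in> ?J" for a b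
    proof -
      have "(\<exists>l\<in>B. b = (a0, l)) \<or> b = (a1, b0) \<or> b = (a1, b1) \<or> b = (a1, b2) \<or> b = (a2, b0) \<or> b = (a2, b1) \<or> b = (a2, b2)"
        using ab(2) A(1) B(1) by auto
      then have row: "y b = 0 \<or> ?M (a0, b0) b = 0 \<and> ?M (a0, b1) b = 0 \<and> ?M (a1, b0) b = 0"
        by (elim disjE bexE) (simp_all add: y0 u1 b0 a0 mem cross(1) zb(1)[OF a0] zb(2)[OF mem(1) mem(3)] corner
          za(1)[OF mem(1)] za(2)[OF mem(2) b0])
      have "a \<in> {(a0, b0), (a0, b1), (a1, b0), (a2, b1), (a2, b2)}"
        using ab(1) A(1) B(1) by (auto simp: K_def c_def)
      then show ?thesis using row y0 by auto
    qed
    have KJ: "K \<subseteq> ?J" using mem a0 b0 by (auto simp: K_def c_def)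
    have K1: "sform ?J ?M y y = sform K ?M y y"
    proof (rule sform_restrict[OF fin KJ])
      fix a b assume ab: "a \<in> ?J" "b \<in> ?J" "a \<notin> K \<or> b \<notin> K"
      then have "y a = 0 \<or> y b = 0 \<or> ?M a b = 0 \<or> ?M b a = 0" using out[of a b] out[of b a] by blast
      then show "cnj (y a) * ?M a b * y b = 0" using herm_onD[OF herm_pt ab(1,2)] by auto
    qed
    \<comment> \<open>Agrees with \<open>y\<close> at \<open>(a1, b1)\<close> and \<open>c\<close>,
      but is orthogonal, for the state, to the axes \<open>(a0, b2)\<close> and
      \<open>(a2, b0)\<close>. The form of \<open>H\<close> at \<open>y\<close> exceeds that of the
      state at \<open>z\<close> by three squares; the one of \<open>q\<close> appears because
      partial transposition removes the coupling \<open>la\<close>.\<close>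
    define z where "z = (\<lambda>a. if a = (a0, b2) then - ka * y c else if a = (a2, b0) then - la * y c
      else if a \<in> K then y a else 0)"
    have "(a0, b2) \<in> K" "(a2, b0) \<in> K" by (simp_all add: K_def)
    then have "z a = 0" if "a \<notin> K" for a using that by (auto simp: z_def)
    then have K2: "sform ?J r z z = sform K r z z" by (intro sform_restrict[OF fin KJ]) auto
    note base = corner(2)[OF mem(2) mem(4)] zb(2)[OF mem(1) mem(4)] corner(1)[OF mem(2) mem(4)]
      za(1)[OF mem(2) mem(3)] za(1)[OF mem(2) mem(4)] zb(1)[OF mem(1) mem(4)]
      za(2)[OF mem(2) mem(3)] za(2)[OF mem(2) mem(4)]
    have Mv: "?M (a0, b2) (a0, b2) = 1" "?M (a0, b2) (a2, b0) = 0" "?M (a0, b2) (a1, b1) = 0" "?M (a0, b2) c = cnj ka"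
      "?M (a2, b0) (a0, b2) = 0" "?M (a2, b0) (a2, b0) = 1" "?M (a2, b0) (a1, b1) = 0" "?M (a2, b0) c = 0"
      "?M (a1, b1) (a0, b2) = 0" "?M (a1, b1) (a2, b0) = 0" "?M (a1, b1) (a1, b1) = r (a1, b1) (a1, b1)" "?M (a1, b1) c = rh"
      "?M c (a0, b2) = ka" "?M c (a2, b0) = 0" "?M c (a1, b1) = cnj rh" "?M c c = r c c"
      by (simp_all only: c_def pt_pair base ka' rh' eA eB ka_def[symmetric] rh_def[symmetric])
    have c1: "r (a0, b2) (a1, b1) = 0" "r (a1, b1) (a2, b0) = 0"
      using u1 cJs[of "(a1, b1)" "(a0, b2)"] cJs[of "(a2, b0)" "(a1, b1)"] mem a0 b0 by simp_all
    have rv: "r (a0, b2) (a0, b2) = 1" "r (a0, b2) (a2, b0) = 0" "r (a0, b2) (a1, b1) = 0" "r (a0, b2) c = ka"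
      "r (a2, b0) (a0, b2) = 0" "r (a2, b0) (a2, b0) = 1" "r (a2, b0) (a1, b1) = 0" "r (a2, b0) c = la"
      "r (a1, b1) (a0, b2) = 0" "r (a1, b1) (a2, b0) = 0" "r (a1, b1) c = rh"
      "r c (a0, b2) = cnj ka" "r c (a2, b0) = cnj la" "r c (a1, b1) = cnj rh"
      using mem a0 b0 eA eB u1 c1
      by (simp_all add: c_def ka' la' rh' ka_def[symmetric] la_def[symmetric] rh_def[symmetric] cross)
    define p q s where "p = y (a0, b2) + cnj ka * y c" and "q = la * y c" and "s = y (a2, b0)"
    have cne: "c \<noteq> (a0, b2)" "c \<noteq> (a2, b0)" "c \<noteq> (a1, b1)" using neq by (auto simp: c_def)
    have zv: "z (a0, b2) = - ka * y c" "z (a2, b0) = - la * y c" "z (a1, b1) = y (a1, b1)" "z c = y c"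
      using neq cne by (auto simp: z_def K_def)
    have KM: "sform K N v v = (\<Sum>a\<leftarrow>[(a0, b2), (a2, b0), (a1, b1), c]. \<Sum>b\<leftarrow>[(a0, b2), (a2, b0), (a1, b1), c]. cnj (v a) * N a b * v b)" for N v
      using neq cne unfolding sform_def K_def by (simp add: add_ac)
    have "sform ?J ?M y y = sform ?J r z z + p * cnj p + q * cnj q + s * cnj s"
      unfolding K1 K2 KM by (simp add: Mv rv zv base p_def q_def s_def algebra_simps)
    then have "0 \<le> qform ?J ?M y"
      using psd_on_nonneg[OF psd, of z] by (simp add: complex_mult_cnj)
    then show False using neg by simp
  qed
qed

end

section \<open>Case analysis in dimensions 2 x 2, 2 x 3 and 3 x 3\<close>

context normal_pair
begin

lemma reduction_zero:
  assumes z: "\<And>k. k \<in> B \<Longrightarrow> r (a0, k) (a0, k) = 0"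
  obtains \<sigma> where "psd_on ((A - {a0}) \<times> B) \<sigma>"
    "\<And>k. pos_pt (A - {a0}) B \<sigma> k \<Longrightarrow> pos_pt A B r k"
    "\<And>k. neg_pt A B r k \<Longrightarrow> neg_pt (A - {a0}) B \<sigma> k"
  by (rule reduction[OF b0]) (use zero_row(2)[OF a0 _ _ _ z] that in auto)

definition reducible :: bool where
  "reducible \<longleftrightarrow> (\<exists>\<sigma>. psd_on ((A - {a0}) \<times> B) \<sigma> \<and>
    (\<forall>k. pos_pt (A - {a0}) B \<sigma> k \<longrightarrow> pos_pt A B r k) \<and>
    (\<forall>k. neg_pt A B r k \<longrightarrow> neg_pt (A - {a0}) B \<sigma> k))"

lemma corner_diag: "r (a0, b0) (a0, b0) = 0" using cross[OF a0 b0] by simp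

text \<open>If exactly one of the two entries is 0 and there is no coupling, the row of
  \<open>H\<close> at that axis vanishes, as does the row of the kernel vector. A single row at
  \<open>a0\<close> remains, and \<open>reduction\<close> applies.\<close>

lemma block_alternatives:
  assumes "card B = 3"
  shows "(\<forall>k\<in>B - {b0}. r (a0, k) (a0, k) = 1) \<or> reducible \<or> (\<exists>b1 b2 j. coupled b1 b2 j)"
proof -
  have half: "reducible \<or> (\<exists>j\<in>A. r (j, b1) (a0, b2) \<noteq> 0)"
    if b: "B = {b0, b1, b2}" "b0 \<noteq> b1" "b0 \<noteq> b2" "b1 \<noteq> b2" "r (a0, b1) (a0, b1) = 0" for b1 b2
  proof (cases "\<exists>j\<in>A. r (j, b1) (a0, b2) \<noteq> 0")
    case False
    have b2: "b2 \<in> B" "b1 \<in> B" using b by auto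
    have z: "r (j, k) (a0, l) = 0" if "j \<in> A" "l \<in> B" "k \<in> B" "k \<noteq> b2" for j k l
    proof -
      have "k = b0 \<or> k = b1" using that b(1) by auto
      moreover have "l = b0 \<or> l = b1 \<or> l = b2" using that b(1) by auto
      ultimately show ?thesis using that cross corner zero_row(2)[OF a0 b2(2) that(1) b2(2) b(5)] False by auto
    qed
    show ?thesis unfolding reducible_def by (rule reduction[OF b2(1) z]) auto
  qed blast
  obtain b1 b2 where b: "B = {b0, b1, b2}" "b0 \<noteq> b1" "b0 \<noteq> b2" "b1 \<noteq> b2"
    using card_3_obtain[OF assms b0] .
  then have mem: "b1 \<in> B" "b2 \<in> B" by auto
  consider "r (a0, b1) (a0, b1) = 1" "r (a0, b2) (a0, b2) = 1"
    | "r (a0, b1) (a0, b1) = 0" "r (a0, b2) (a0, b2) = 1"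
    | "r (a0, b1) (a0, b1) = 1" "r (a0, b2) (a0, b2) = 0"
    | "r (a0, b1) (a0, b1) = 0" "r (a0, b2) (a0, b2) = 0" using unitB mem by blast
  then show ?thesis
  proof cases
    case 1
    then show ?thesis using b by auto
  next
    case 2
    then show ?thesis using half[OF b] b unfolding coupled_def by metis
  next
    case 3
    have "B = {b0, b2, b1}" using b by auto
    then show ?thesis using half[of b2 b1] 3 b unfolding coupled_def by metis
  next
    case 4
    have "r (a0, k) (a0, k) = 0" if "k \<in> B" for k using that b 4 corner_diag by auto
    then have reducible unfolding reducible_def by (rule reduction_zero) auto
    then show ?thesis by blast
  qed
qed

end

lemma singleton_ppt:
  assumes "card A = 1" "psd_on (A \<times> B) r" shows "\<not> neg_pt A B r (Suc k)"
proof -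
  obtain a where "A = {a}" using assms(1) by (auto simp: card_1_singleton_iff)
  then have "sform (A \<times> B) (pt r) v v = sform (A \<times> B) r v v" for v by (intro sform_cong) auto
  then show ?thesis using psd_on_nonneg[OF assms(2)] by (intro psd_not_neg_ge) auto
qed

lemma normal_pair_exists:
  assumes fin: "finite A" "finite B" and r: "psd_on (A \<times> B) r" and n: "\<not> pos_pt A B r (Suc k)"
    and Z: "\<And>F :: ('a \<times> 'b \<Rightarrow> complex) set. finite F \<Longrightarrow> card F \<le> k \<Longrightarrow>
      \<exists>x y. (\<exists>i\<in>A. x i \<noteq> 0) \<and> (\<exists>l\<in>B. y l \<noteq> 0) \<and> (\<forall>f\<in>F. bil A B f x y = 0)"
  obtains a0 b0 r' where "normal_pair A B a0 b0 r'"
    "\<And>k. pos_pt A B r' k \<Longrightarrow> pos_pt A B r k"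
    "\<And>k. neg_pt A B r k \<Longrightarrow> neg_pt A B r' k"
proof -
  obtain x y where xy: "\<exists>i\<in>A. x i \<noteq> 0" "\<exists>l\<in>B. y l \<noteq> 0" "\<And>z. sform (A \<times> B) (pt r) (tensor x y) z = 0"
    using kernel_product_vector[OF fin r n Z[unfolded bil_def]] by blast
  obtain a0 b0 r' where "normal_form A B a0 b0 r'"
    "\<And>k. pos_pt A B r' k \<Longrightarrow> pos_pt A B r k"
    "\<And>k. neg_pt A B r k \<Longrightarrow> neg_pt A B r' k"
    using normal_form_exists[OF fin r xy] by blast
  then show ?thesis using that by (simp add: normal_pair_def)
qed

lemma card_2_remove:
  assumes "card A = 2" "a0 \<in> A" obtains a1 where "A - {a0} = {a1}"
  using assms by (metis card_1_singletonE card_Diff_singleton diff_Suc_1 numeral_2_eq_2 One_nat_def)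

text \<open>A zero entry in a local block leaves a system with a one-dimensional factor, where
  partial transposition changes nothing; so a negative direction forces the nondegenerate
  case.\<close>

lemma pos_ge_2_2:
  assumes A: "card A = 2" and B: "card B = 2" and r: "psd_on (A \<times> B) r" and neg: "neg_pt A B r 1"
  shows "pos_pt A B r 3"
proof (rule ccontr)
  assume np: "\<not> ?thesis"
  have fin: "finite A" "finite B" using A B card.infinite by fastforce+
  have B_ne: "B \<noteq> {}" using B by auto
  obtain a0 b0 r' where n: "normal_pair A B a0 b0 r'" and tr:
    "\<And>k. pos_pt A B r' k \<Longrightarrow> pos_pt A B r k"
    "\<And>k. neg_pt A B r k \<Longrightarrow> neg_pt A B r' k"
    using normal_pair_exists[of A B r 2] fin r np common_zero_2[OF A fin(2) B_ne] B by (auto simp: numeral_3_eq_3 numeral_2_eq_2)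
  interpret normal_pair A B a0 b0 r' by fact
  interpret s: normal_pair B A b0 a0 "swp r'" by (rule normal_pair_swp)
  obtain a1 where a1: "A - {a0} = {a1}" by (rule card_2_remove[OF A a0])
  obtain b1 where b1: "B - {b0} = {b1}" by (rule card_2_remove[OF B b0])
  have As: "A = {a0, a1}" and Bs: "B = {b0, b1}" using a1 b1 a0 b0 by auto
  have neg': "neg_pt A B r' 1" using tr(2)[OF neg] .
  consider "r' (a0, b1) (a0, b1) = 0" | "r' (a1, b0) (a1, b0) = 0"
    | "r' (a0, b1) (a0, b1) = 1" "r' (a1, b0) (a1, b0) = 1" using unitA unitB As Bs by blast
  then show False
  proof cases
    case 1
    then have "r' (a0, k) (a0, k) = 0" if "k \<in> B" for k using that Bs corner_diag by auto
    then obtain \<sigma> where "psd_on ((A - {a0}) \<times> B) \<sigma>" "neg_pt (A - {a0}) B \<sigma> 1"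
      using reduction_zero neg' by metis
    then show False using singleton_ppt[of "A - {a0}" B \<sigma> 0] a1 by simp
  next
    case 2
    then have "swp r' (b0, k) (b0, k) = 0" if "k \<in> A" for k using that As corner_diag by auto
    then obtain \<sigma> where "psd_on ((B - {b0}) \<times> A) \<sigma>" "neg_pt (B - {b0}) A \<sigma> 1"
      using s.reduction_zero neg_ge_swp[OF neg'] by metis
    then show False using singleton_ppt[of "B - {b0}" A \<sigma> 0] b1 by simp
  next
    case 3
    then have "pos_pt A B r' (card A + card B - 1) \<or> (\<forall>v. 0 \<le> qform (A \<times> B) (pt r') v)"
      using a1 b1 by (intro nondegenerate_case) auto
    then show False
      using A B tr(1)[of 3] np psd_not_neg_ge[of "A \<times> B" "pt r'" 1] neg' by (auto simp: numeral_eq_Suc)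
  qed
qed

text \<open>The block on the two-dimensional factor has one entry beside the corner. If it is 0, the
  three-dimensional factor shrinks and the 2 x 2 result applies. Otherwise the alternatives for the
  other block give four positive directions, a nonnegative form, or a one-dimensional
  factor.\<close>

lemma pos_ge_2_3:
  assumes A: "card A = 2" and B: "card B = 3" and r: "psd_on (A \<times> B) r"
  shows "(neg_pt A B r 1 \<longrightarrow> pos_pt A B r 3) \<and>
    (neg_pt A B r 2 \<longrightarrow> pos_pt A B r 4)"
proof (cases "pos_pt A B r 4")
  case True
  then show ?thesis using pos_ge_mono by force
next
  case np: False
  have fin: "finite A" "finite B" using A B card.infinite by fastforce+
  have B_ne: "B \<noteq> {}" using B by auto
  have np': "\<not> pos_pt A B r (Suc 3)" using np by (simp add: eval_nat_numeral)
  obtain a0 b0 r' where n: "normal_pair A B a0 b0 r'" and tr: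
    "\<And>k. pos_pt A B r' k \<Longrightarrow> pos_pt A B r k"
    "\<And>k. neg_pt A B r k \<Longrightarrow> neg_pt A B r' k"
    using normal_pair_exists[OF fin r np'] common_zero_2[OF A fin(2) B_ne] B by metis
  interpret normal_pair A B a0 b0 r' by fact
  interpret s: normal_pair B A b0 a0 "swp r'" by (rule normal_pair_swp)
  obtain a1 where a1: "A - {a0} = {a1}" by (rule card_2_remove[OF A a0])
  have As: "A = {a0, a1}" "a1 \<in> A" using a1 a0 by auto
  let ?goal = "(neg_pt A B r' 1 \<longrightarrow> pos_pt A B r' 3) \<and>
    (neg_pt A B r' 2 \<longrightarrow> pos_pt A B r' 4)"
  have psd0: ?goal if "\<not> neg_pt A B r' 1" using that neg_ge_mono[of _ _ 2 1] by auto
  have red: ?goal if red0: reducible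
  proof -
    obtain \<sigma> where \<sigma>: "psd_on ((A - {a0}) \<times> B) \<sigma>"
      "\<And>k. neg_pt A B r' k \<Longrightarrow> neg_pt (A - {a0}) B \<sigma> k"
      using red0 unfolding reducible_def by blast
    show ?thesis by (rule psd0) (use singleton_ppt[OF _ \<sigma>(1), of 0] \<sigma>(2) a1 in auto)
  qed
  have "?goal"
  proof (cases "r' (a1, b0) (a1, b0) = 0")
    case True
    then have "swp r' (b0, k) (b0, k) = 0" if "k \<in> A" for k using that As corner_diag by auto
    then obtain \<sigma> where \<sigma>: "psd_on ((B - {b0}) \<times> A) \<sigma>"
      "\<And>k. pos_pt (B - {b0}) A \<sigma> k \<Longrightarrow> pos_pt B A (swp r') k"
      "\<And>k. neg_pt B A (swp r') k \<Longrightarrow> neg_pt (B - {b0}) A \<sigma> k"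
      using s.reduction_zero by metis
    have cB: "card (B - {b0}) = 2" using B b0 fin by simp
    have p3: "pos_pt (B - {b0}) A \<sigma> 3" if "neg_pt A B r' 1"
      using pos_ge_2_2[OF cB A \<sigma>(1) \<sigma>(3)[OF neg_ge_swp[OF that]]] .
    have "\<not> neg_pt A B r' 2"
    proof
      assume n2: "neg_pt A B r' 2"
      then have "neg_pt A B r' 1" using neg_ge_mono by force
      \<comment> \<open>Three positive and two negative directions would need five dimensions, but
        the reduced space has four.\<close>
      then have "3 + 2 \<le> card ((B - {b0}) \<times> A)"
        using pos_neg_dim[OF _ p3 \<sigma>(3)[OF neg_ge_swp[OF n2]]] finAB by simp
      then show False using cB A by (simp add: card_cartesian_product)
    qed
    then show ?thesis using p3 \<sigma>(2) pos_ge_swp by blast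
  next
    case False
    then have one: "r' (i, b0) (i, b0) = 1" if "i \<in> A - {a0}" for i using that a1 unitA[OF As(2)] by auto
    consider "\<forall>k\<in>B - {b0}. r' (a0, k) (a0, k) = 1" | reducible
      | b1 b2 j where "coupled b1 b2 j" using block_alternatives[OF B] by blast
    then show ?thesis
    proof cases
      case 1
      then have "pos_pt A B r' (card A + card B - 1) \<or> (\<forall>v. 0 \<le> qform (A \<times> B) (pt r') v)"
        using one by (intro nondegenerate_case) auto
      then show ?thesis using A B tr(1)[of 4] np psd0 psd_not_neg_ge[of "A \<times> B" "pt r'" 1] by auto
    next
      case 2
      then show ?thesis by (rule red)
    next
      case 3
      have "pos_pt A B r' (card A + 2)" by (rule half_degenerate_case[OF 3 one])
      then show ?thesis using A tr(1)[of 4] np by auto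
    qed
  qed
  then show ?thesis using tr by blast
qed

text \<open>Each local block is an identity, reducible or coupled. Reducible blocks lead to 2 x 3.
  The other combinations \<open>c1\<close> to \<open>c4\<close> give five positive directions,
  except for a nonnegative form in \<open>c1\<close> and the last subcase of \<open>c4\<close>,
  where three negative directions are excluded.\<close>

lemma pos_ge_3_3:
  assumes A: "card A = 3" and B: "card B = 3" and r: "psd_on (A \<times> B) r"
  shows "(neg_pt A B r 1 \<longrightarrow> pos_pt A B r 3) \<and>
    (neg_pt A B r 2 \<longrightarrow> pos_pt A B r 4) \<and>
    (neg_pt A B r 3 \<longrightarrow> pos_pt A B r 5)"
proof (cases "pos_pt A B r 5")
  case True
  then have "pos_pt A B r 3" "pos_pt A B r 4" by (auto elim: pos_ge_mono)
  then show ?thesis using True by simp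
next
  case np: False
  have fin: "finite A" "finite B" using A B card.infinite by fastforce+
  have np': "\<not> pos_pt A B r (Suc 4)" using np by (simp add: eval_nat_numeral)
  obtain a0 b0 r' where n: "normal_pair A B a0 b0 r'" and tr:
    "\<And>k. pos_pt A B r' k \<Longrightarrow> pos_pt A B r k"
    "\<And>k. neg_pt A B r k \<Longrightarrow> neg_pt A B r' k"
    using normal_pair_exists[OF fin r np'] common_zero_3[OF A B] by metis
  interpret normal_pair A B a0 b0 r' by fact
  interpret s: normal_pair B A b0 a0 "swp r'" by (rule normal_pair_swp)
  define goal where "goal = ((neg_pt A B r' 1 \<longrightarrow> pos_pt A B r' 3) \<and>
    (neg_pt A B r' 2 \<longrightarrow> pos_pt A B r' 4) \<and>
    (neg_pt A B r' 3 \<longrightarrow> pos_pt A B r' 5))"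
  have n5: False if "pos_pt A B r' 5" using tr(1)[OF that] np by blast
  have n5s: False if "pos_pt B A (swp r') 5" using n5 pos_ge_swp[OF that] by blast
  \<comment> \<open>After a reduction the third implication is vacuous: four positive and three
    negative directions do not fit into dimension 6. The factors have types of their own, so that
    either one may be the reduced one.\<close>
  have sub: goal if cC: "card C = 2" "card D = 3" and \<sigma>: "psd_on (C \<times> D) \<sigma>"
      "\<And>k. pos_pt C D \<sigma> k \<Longrightarrow> pos_pt A B r' k"
      "\<And>k. neg_pt A B r' k \<Longrightarrow> neg_pt C D \<sigma> k"
    for C :: "'x set" and D :: "'y set" and \<sigma>
  proof -
    note c = pos_ge_2_3[OF cC \<sigma>(1)]
    have "\<not> neg_pt A B r' 3"
    proof
      assume "neg_pt A B r' 3"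
      then have n3: "neg_pt C D \<sigma> 3" by (rule \<sigma>(3))
      then have "neg_pt C D \<sigma> 2" using neg_ge_mono by force
      then have p4: "pos_pt C D \<sigma> 4" using c by blast
      have "finite (C \<times> D)" using cC card.infinite[of C] card.infinite[of D] by fastforce
      from pos_neg_dim[OF this p4 n3] show False using cC by (simp add: card_cartesian_product)
    qed
    then show ?thesis using c \<sigma>(2,3) unfolding goal_def by blast
  qed
  have cAB: "card (A - {a0}) = 2" "card (B - {b0}) = 2" using A B a0 b0 fin by simp_all
  have red: goal if reducible
    using that unfolding reducible_def by (elim exE conjE) (rule sub[OF cAB(1) B], auto)
  have sred: goal if s.reducible using that unfolding s.reducible_def
    by (elim exE conjE) (rule sub[OF cAB(2) A], auto intro: pos_ge_swp neg_ge_swp)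
  have "goal"
  proof (rule ccontr)
    assume ng: "\<not> goal"
    have c1: False if I: "\<forall>k\<in>B - {b0}. r' (a0, k) (a0, k) = 1" and sI: "\<forall>k\<in>A - {a0}. swp r' (b0, k) (b0, k) = 1"
    proof -
      have "pos_pt A B r' (card A + card B - 1) \<or> (\<forall>v. 0 \<le> qform (A \<times> B) (pt r') v)"
        using I sI by (intro nondegenerate_case) auto
      then have "\<forall>v. 0 \<le> qform (A \<times> B) (pt r') v" using A B n5 by auto
      then have "\<not> neg_pt A B r' 1" "\<not> neg_pt A B r' 2" "\<not> neg_pt A B r' 3"
        using psd_not_neg_ge[of "A \<times> B" "pt r'"] by simp_all
      then show False using ng by (simp add: goal_def)
    qed
    have c2: False if I: "\<forall>k\<in>B - {b0}. r' (a0, k) (a0, k) = 1" and sD: "s.coupled a1 a2 l" for a1 a2 l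
    proof -
      have "pos_pt B A (swp r') (card B + 2)" by (rule s.half_degenerate_case[OF sD]) (use I in auto)
      then show False using B n5s by simp
    qed
    have c3: False if D: "coupled b1 b2 j" and sI: "\<forall>k\<in>A - {a0}. swp r' (b0, k) (b0, k) = 1" for b1 b2 j
    proof -
      have "pos_pt A B r' (card A + 2)" by (rule half_degenerate_case[OF D]) (use sI in auto)
      then show False using A n5 by simp
    qed
    have c4: False if "coupled b1 b2 j" "s.coupled a1 a2 l" for a1 a2 l b1 b2 j
    proof -
      note D = that(1)[unfolded coupled_def] and sD = that(2)[unfolded s.coupled_def]
      interpret ro: rank_one_pair A B a0 b0 r' a1 a2 b1 b2 by unfold_locales (use D sD in auto)
      interpret so: rank_one_pair B A b0 a0 "swp r'" b1 b2 a1 a2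
        by unfold_locales (use D sD in auto)
      have ul: "l \<in> B" "r' (a2, b0) (a1, l) \<noteq> 0" and uj: "j \<in> A" "r' (j, b1) (a0, b2) \<noteq> 0" using sD D by auto
      show False
      proof (cases "r' (a1, b1) (a0, b2) = 0")
        case False
        show False by (rule n5, rule ro.rank_one_case[OF False ul])
      next
        case u1: True
        show False
        proof (cases "r' (a2, b0) (a1, b1) = 0")
          case False
          show False by (rule n5s, rule so.rank_one_case[of j]) (use uj False in auto)
        next
          case w1: True
          \<comment> \<open>The other values of \<open>j\<close> are excluded by the zero row of
            \<open>(a0, b1)\<close> and by \<open>u1\<close>; similarly for
            \<open>l\<close>.\<close>
          have "j = a2" using uj ro.A(1) u1 ro.zb(1)[OF a0 ro.mem(4)] by auto
          moreover have "l = b2" using ul ro.B(1) w1 ro.za(2)[OF ro.mem(2) b0] by auto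
          ultimately have "pos_pt A B r' 4 \<and> \<not> neg_pt A B r' 3"
            using ro.rank_one_dependent_case[OF u1 w1] uj ul by blast
          then show False using ng pos_ge_mono[of _ _ 4 3] unfolding goal_def by auto
        qed
      qed
    qed
    show False using block_alternatives[OF B] s.block_alternatives[OF A] red sred ng c1 c2 c3 c4 by blast
  qed
  then show ?thesis using tr unfolding goal_def by blast
qed

section \<open>Inertia of Hermitian matrices\<close>


lemma neg_ge_of_orth_pos:
  assumes h: "herm_on J M" and p: "pos_ge J (\<lambda>a b. - M a b) k"
  shows "neg_ge J M k"
proof -
  have n: "sform J (\<lambda>a b. - M a b) u v = - sform J M u v" for u v by (simp add: sform_def sum_negf)
  obtain U where U: "orth_pos J (\<lambda>a b. - M a b) U" "k \<le> card U" using p by (auto simp: pos_ge_def)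
  have fU: "finite U" using U(1) by (simp add: orth_pos_def)
  obtain h where "bij_betw h {..<card U} U" using ex_bij_betw_nat_finite[OF fU] by (auto simp: atLeast0LessThan)
  then have inj: "inj_on h {..<k}" "h ` {..<k} \<subseteq> U"
    using U(2) by (auto simp: bij_betw_def intro: inj_on_subset)
  have "qform J M (lincomb {..<k} c h) < 0"
    if c: "\<exists>p<k. c p \<noteq> 0" for c
  proof -
    have o: "sform J M (h p) (h q) = 0" if "p < k" "q < k" "p \<noteq> q" for p q
    proof -
      have "h p \<in> U" "h q \<in> U" "h p \<noteq> h q" using inj that by (auto simp: inj_on_def)
      then show ?thesis using U(1) by (auto simp: orth_pos_def n)
    qed
    have d: "qform J M (h p) < 0" if "p < k" for p
      using U(1) inj that by (auto simp: orth_pos_def n image_subset_iff)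
    have "sform J M (lincomb {..<k} c h) (lincomb {..<k} c h) =
        (\<Sum>p<k. of_real ((cmod (c p))\<^sup>2) * sform J M (h p) (h p))"
      using o by (intro sform_orthogonal_combination) auto
    then have "- qform J M (lincomb {..<k} c h) =
        (\<Sum>p<k. (cmod (c p))\<^sup>2 * - qform J M (h p))" by (simp add: sum_negf)
    also obtain q where "q < k" "c q \<noteq> 0" using c by blast
    then have "0 < (\<Sum>p<k. (cmod (c p))\<^sup>2 * - qform J M (h p))"
      using d by (intro sum_pos2[of _ q]) (auto intro!: mult_pos_neg mult_nonneg_nonpos simp: less_imp_le)
    finally show ?thesis by simp
  qed
  then show ?thesis unfolding neg_ge_def by blast
qed

text \<open>Sylvester's law of inertia. The nonpositive members of the family span a nonpositive
  subspace, which bounds every positive system by \<open>pos_nonpos_dim\<close>.\<close>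

lemma pos_ge_iff_orthogonal_family:
  fixes u :: "'p \<Rightarrow> 'i \<Rightarrow> complex"
  assumes J: "finite J" and P: "finite P" "card P = card J"
    and indep: "\<And>g. (\<And>a. a \<in> J \<Longrightarrow> (\<Sum>p\<in>P. g p * u p a) = 0) \<Longrightarrow> \<forall>p\<in>P. g p = 0"
    and orth: "\<And>p q. p \<in> P \<Longrightarrow> q \<in> P \<Longrightarrow> p \<noteq> q \<Longrightarrow> sform J M (u p) (u q) = 0"
  shows "pos_ge J M k \<longleftrightarrow> k \<le> card {p \<in> P. 0 < qform J M (u p)}"
proof
  let ?d = "\<lambda>p. qform J M (u p)"
  assume "k \<le> card {p \<in> P. 0 < ?d p}"
  have inj: "inj_on u {p \<in> P. 0 < ?d p}"
  proof (rule inj_onI, rule ccontr)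
    fix p q assume "p \<in> {p \<in> P. 0 < ?d p}" "q \<in> {p \<in> P. 0 < ?d p}" "u p = u q" "p \<noteq> q"
    then show False using orth[of p q] by auto
  qed
  then have "orth_pos J M (u ` {p \<in> P. 0 < ?d p})" using P orth by (auto simp: orth_pos_def)
  then show "pos_ge J M k" using \<open>k \<le> _\<close> card_image[OF inj] by (auto simp: pos_ge_def)
next
  let ?d = "\<lambda>p. qform J M (u p)"
  assume "pos_ge J M k"
  then obtain U where U: "orth_pos J M U" "k \<le> card U" by (auto simp: pos_ge_def)
  have fU: "finite U" using U by (simp add: orth_pos_def)
  define R where "R = {p \<in> P. \<not> 0 < ?d p}"
  have fR: "finite R" using P by (simp add: R_def)
  have "P = {p \<in> P. 0 < ?d p} \<union> R" by (auto simp: R_def)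
  then have cP: "card P = card {p \<in> P. 0 < ?d p} + card R"
    using P(1) fR card_Un_disjoint[of "{p \<in> P. 0 < ?d p}" R] by (auto simp: R_def)
  have "card U + card R \<le> card J"
  proof (rule pos_nonpos_dim[OF J U(1) fR])
    fix c
    have "sform J M (lincomb R c u) (lincomb R c u) =
        (\<Sum>q\<in>R. of_real ((cmod (c q))\<^sup>2) * sform J M (u q) (u q))"
      using fR orth by (intro sform_orthogonal_combination) (auto simp: R_def)
    then have "qform J M (lincomb R c u) =
        (\<Sum>q\<in>R. (cmod (c q))\<^sup>2 * ?d q)" by simp
    also have "\<dots> \<le> 0" by (intro sum_nonpos mult_nonneg_nonpos) (auto simp: R_def)
    finally show "qform J M (lincomb R c u) \<le> 0" .
    assume z: "\<And>a. a \<in> J \<Longrightarrow> (\<Sum>q\<in>R. c q * u q a) = 0"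
    have "(\<Sum>p\<in>P. (if p \<in> R then c p else 0) * u p a) = (\<Sum>q\<in>R. c q * u q a)" for a
      using P by (intro sum.mono_neutral_cong_right) (auto simp: R_def)
    then have "\<forall>p\<in>P. (if p \<in> R then c p else 0) = 0" using z by (intro indep) simp
    then show "\<forall>q\<in>R. c q = 0" by (auto simp: R_def)
  qed
  then show "k \<le> card {p \<in> P. 0 < ?d p}" using U(2) P(2) cP by simp
qed

section \<open>Spectral theorem for Hermitian forms\<close>

abbreviation id_form :: "'i \<Rightarrow> 'i \<Rightarrow> complex" where
  "id_form \<equiv> (\<lambda>a b. if a = b then 1 else 0)"

definition mult_vec :: "'i set \<Rightarrow> ('i \<Rightarrow> 'i \<Rightarrow> complex) \<Rightarrow> ('i \<Rightarrow> complex) \<Rightarrow> 'i \<Rightarrow> complex" where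
  "mult_vec J M v = (\<lambda>a. \<Sum>b\<in>J. M a b * v b)"

lemma sform_id:
  assumes "finite J" shows "sform J id_form u v = (\<Sum>a\<in>J. cnj (u a) * v a)"
  unfolding sform_def
proof (rule sum.cong[OF refl])
  fix a assume "a \<in> J"
  have "(\<Sum>b\<in>J. cnj (u a) * id_form a b * v b) = (\<Sum>b\<in>J. if b = a then cnj (u a) * v a else 0)"
    by (intro sum.cong) auto
  then show "(\<Sum>b\<in>J. cnj (u a) * id_form a b * v b) = cnj (u a) * v a" using assms \<open>a \<in> J\<close> by simp
qed

lemma sform_id_mult_vec: "finite J \<Longrightarrow> sform J id_form u (mult_vec J M v) = sform J M u v"
  by (simp add: sform_id mult_vec_def) (simp add: sform_def sum_distrib_left mult.assoc)

lemma herm_id: "herm_on J id_form" by (auto simp: herm_on_def)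

lemma sform_id_pos:
  assumes "finite J" "a \<in> J" "v a \<noteq> 0" shows "0 < qform J id_form v"
proof -
  have "qform J id_form v = (\<Sum>a\<in>J. (cmod (v a))\<^sup>2)"
    using assms(1) by (simp add: sform_id complex_mult_cnj cmod_power2 mult.commute[of "cnj _"])
  also have "0 < \<dots>" using assms by (intro sum_pos2[of _ a]) auto
  finally show ?thesis .
qed

text \<open>A polynomial of least degree annihilating a given vector splits off a linear factor, and
  the cofactor maps the vector to an eigenvector.\<close>

lemma eigenvector_in_orbit:
  assumes J: "finite J" and v: "\<exists>a\<in>J. v a \<noteq> 0"
  obtains z w where "\<exists>a\<in>J. w a \<noteq> 0" "\<And>a. a \<in> J \<Longrightarrow> mult_vec J M w a = z * w a"
    "\<forall>u. (\<forall>i. sform J id_form u ((mult_vec J M ^^ i) v) = 0) \<longrightarrow> sform J id_form u w = 0"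
proof -
  define T where "T = mult_vec J M"
  define X where "X = (\<lambda>i. (T ^^ i) v)"
  define N where "N = card J"
  define ev where "ev = (\<lambda>p a. \<Sum>i\<le>N. coeff p i * X i a)"
  define P where "P = (\<lambda>p. p \<noteq> 0 \<and> degree p \<le> N \<and> (\<forall>a\<in>J. ev p a = 0))"
  have "card J < card {..N}" by (simp add: N_def)
  then obtain c where c: "\<exists>i\<in>{..N}. c i \<noteq> 0" "\<forall>a\<in>J. (\<Sum>i\<le>N. c i * X i a) = 0"
    using homogeneous_system[of J "{..N}" "\<lambda>a i. X i a"] J by auto
  define p0 where "p0 = (\<Sum>i\<le>N. monom (c i) i)"
  have p0c: "coeff p0 i = (if i \<le> N then c i else 0)" for i unfolding p0_def coeff_sum by simp
  have "P p0" unfolding P_def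
  proof (intro conjI ballI)
    show "p0 \<noteq> 0" using c(1) p0c by (metis atMost_iff coeff_0)
    show "degree p0 \<le> N" by (intro degree_le) (simp add: p0c)
    show "ev p0 a = 0" if "a \<in> J" for a using c(2) that by (simp add: ev_def p0c)
  qed
  then obtain p where p: "P p" "\<And>q. P q \<Longrightarrow> degree p \<le> degree q"
    using ex_has_least_nat[of P p0 degree] by blast
  have "degree p \<noteq> 0"
  proof
    assume "degree p = 0"
    then obtain k where k: "p = [:k:]" by (metis degree_eq_zeroE)
    have "ev p a = k * v a" for a
    proof -
      have "ev p a = (\<Sum>i\<le>N. if i = 0 then k * v a else 0)"
        unfolding ev_def k by (intro sum.cong refl) (auto simp: X_def coeff_pCons split: nat.splits)
      then show ?thesis by simp
    qed
    then show False using p(1) v k by (auto simp: P_def)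
  qed
  then have "\<not> constant (poly p)" by (simp add: constant_degree)
  then obtain z where "poly p z = 0" using fundamental_theorem_of_algebra by blast
  then obtain q where q: "p = [:- z, 1:] * q" by (auto simp: poly_eq_0_iff_dvd)
  have q0: "q \<noteq> 0" using p(1) q by (auto simp: P_def)
  have dq: "degree p = Suc (degree q)" unfolding q using q0 by (subst degree_mult_eq) auto
  then have dN: "degree q < N" using p(1) by (simp add: P_def)
  have Tev: "T (ev q) a - z * ev q a = ev p a" if "a \<in> J" for a
  proof -
    have pc: "coeff p i = (case i of 0 \<Rightarrow> 0 | Suc j \<Rightarrow> coeff q j) - z * coeff q i" for i
      unfolding q by (simp add: coeff_pCons split: nat.splits)
    have "T (ev q) a = (\<Sum>i\<le>N. coeff q i * T (X i) a)"
    proof -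
      have "T (ev q) a = (\<Sum>b\<in>J. \<Sum>i\<le>N. coeff q i * (M a b * X i b))"
        by (simp add: T_def mult_vec_def ev_def sum_distrib_left mult_ac)
      also have "\<dots> = (\<Sum>i\<le>N. \<Sum>b\<in>J. coeff q i * (M a b * X i b))" by (rule sum.swap)
      finally show ?thesis by (simp add: T_def mult_vec_def sum_distrib_left)
    qed
    also have "\<dots> = (\<Sum>i\<le>N. coeff q i * X (Suc i) a)" by (simp add: X_def)
    also have "\<dots> = (\<Sum>i<N. coeff q i * X (Suc i) a)"
      using dN by (simp add: coeff_eq_0 flip: lessThan_Suc_atMost)
    also have "\<dots> = (\<Sum>i\<le>N. (case i of 0 \<Rightarrow> 0 | Suc j \<Rightarrow> coeff q j) * X i a)"
      by (simp add: sum.atMost_shift)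
    finally show ?thesis by (simp add: ev_def pc sum_subtractf sum_distrib_left algebra_simps)
  qed
  have "\<not> P q" using p(2)[of q] dq by auto
  then have "\<exists>a\<in>J. ev q a \<noteq> 0" using q0 dN by (auto simp: P_def)
  moreover have "T (ev q) a = z * ev q a" if "a \<in> J" for a using Tev[OF that] p(1) that by (simp add: P_def)
  moreover have "sform J id_form u (ev q) = 0" if "\<And>i. sform J id_form u ((mult_vec J M ^^ i) v) = 0" for u
    using that unfolding ev_def sform_sum_right X_def T_def by simp
  ultimately show thesis using that unfolding T_def by blast
qed

text \<open>A maximal orthogonal system of eigenvectors is complete: otherwise some \<open>v\<close>
  is orthogonal to it, by Hermitian symmetry so is the whole orbit of \<open>v\<close>, and the
  eigenvector found from the orbit extends the system.\<close>

lemma orthogonal_eigenvectors: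
  assumes J: "finite J" and h: "herm_on J M"
  obtains U l where "orth_pos J id_form U" "card U = card J"
    "\<And>u a. u \<in> U \<Longrightarrow> a \<in> J \<Longrightarrow> mult_vec J M u a = of_real (l u) * u a"
proof -
  define P where "P = (\<lambda>m. \<exists>U. orth_pos J id_form U \<and> card U = m \<and>
    (\<forall>u\<in>U. \<exists>z. \<forall>a\<in>J. mult_vec J M u a = z * u a))"
  have bound: "m \<le> card J" if "P m" for m
  proof -
    have "pos_ge J id_form m" using that by (auto simp: P_def pos_ge_def)
    moreover have "neg_ge J id_form 0" by (simp add: neg_ge_def)
    ultimately show ?thesis using pos_neg_dim[OF J] by fastforce
  qed
  have "P 0" unfolding P_def by (intro exI[of _ "{}"]) (simp add: orth_pos_def)
  then have "P (Greatest P)" using GreatestI_nat[of P 0 "card J"] bound by blast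
  then obtain U where U: "orth_pos J id_form U" "card U = Greatest P"
    "\<forall>u\<in>U. \<exists>z. \<forall>a\<in>J. mult_vec J M u a = z * u a" unfolding P_def by blast
  have fU: "finite U" using U(1) by (simp add: orth_pos_def)
  have "card U = card J"
  proof (rule ccontr)
    assume "card U \<noteq> card J"
    then have "card U < card J" using bound[OF \<open>P (Greatest P)\<close>] U(2) by simp
    then obtain v where v: "\<exists>a\<in>J. v a \<noteq> 0" "\<forall>u\<in>U. (\<Sum>a\<in>J. v a * cnj (u a)) = 0"
      using homogeneous_system[of U J "\<lambda>u a. cnj (u a)"] fU J by auto
    have orbit: "sform J id_form u ((mult_vec J M ^^ i) v) = 0" if u: "u \<in> U" for u i
    proof (induction i)
      case 0
      show ?case using v(2) u by (simp add: sform_id[OF J] mult.commute)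
    next
      case (Suc i)
      let ?w = "(mult_vec J M ^^ i) v"
      obtain z where z: "\<forall>a\<in>J. mult_vec J M u a = z * u a" using U(3) u by blast
      have wu: "sform J id_form ?w u = 0" using Suc sform_swap[OF herm_id, of J ?w u] by simp
      have "sform J M ?w u = sform J id_form ?w (mult_vec J M u)" by (rule sform_id_mult_vec[OF J, symmetric])
      also have "\<dots> = sform J id_form ?w (\<lambda>a. z * u a)" using z by (intro sform_cong) auto
      also have "\<dots> = 0" by (simp add: sform_scale_right wu)
      finally have "sform J M u ?w = 0" using sform_swap[OF h, of u ?w] by simp
      then show ?case by (simp add: sform_id_mult_vec[OF J])
    qed
    obtain z w where w: "\<exists>a\<in>J. w a \<noteq> 0" "\<And>a. a \<in> J \<Longrightarrow> mult_vec J M w a = z * w a"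
      "\<forall>u. (\<forall>i. sform J id_form u ((mult_vec J M ^^ i) v) = 0) \<longrightarrow> sform J id_form u w = 0"
      by (rule eigenvector_in_orbit[OF J v(1), of M]) (rule that)
    have "0 < qform J id_form w" using w(1) sform_id_pos[OF J] by blast
    from orth_pos_insert[OF herm_id U(1) this w(3)[rule_format, OF orbit]]
    have "orth_pos J id_form (insert w U)" "w \<notin> U" by auto
    then have "P (Suc (Greatest P))" using U fU w(2) unfolding P_def
      by (intro exI[of _ "insert w U"]) auto
    then show False using Greatest_le_nat[of P "Suc (Greatest P)" "card J"] bound by auto
  qed
  have "\<exists>l. \<forall>a\<in>J. mult_vec J M u a = of_real l * u a" if u: "u \<in> U" for u
  proof -
    obtain z where z: "\<forall>a\<in>J. mult_vec J M u a = z * u a" using U(3) u by blast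
    have "sform J M u u = sform J id_form u (\<lambda>a. z * u a)"
      using z by (subst sform_id_mult_vec[OF J, symmetric], intro sform_cong) auto
    then have e: "sform J M u u = z * sform J id_form u u" by (simp add: sform_scale_right)
    have "Im (sform J M u u) = 0" "Im (sform J id_form u u) = 0" "0 < qform J id_form u"
      using sform_real[OF h] sform_real[OF herm_id] U(1) u by (auto simp: orth_pos_def)
    then have "Im z = 0" unfolding e by simp
    then have "z = of_real (Re z)" by (simp add: complex_eq_iff)
    then show ?thesis using z by metis
  qed
  then obtain l where "\<And>u a. u \<in> U \<Longrightarrow> a \<in> J \<Longrightarrow> mult_vec J M u a = of_real (l u) * u a" by metis
  then show thesis using that U(1) \<open>card U = card J\<close> by blast
qed

definition entry :: "complex mat \<Rightarrow> nat \<Rightarrow> nat \<Rightarrow> complex" where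
  "entry H a b = H $$ (a, b)"

lemma hermitian_mat_iff:
  assumes A: "A \<in> carrier_mat n n"
  shows "hermitian_mat A \<longleftrightarrow> herm_on {..<n} (entry A)"
proof -
  have adj: "mat_adjoint A \<in> carrier_mat n n" "i < n \<Longrightarrow> j < n \<Longrightarrow> mat_adjoint A $$ (i, j) = cnj (A $$ (j, i))" for i j
    using A by (auto simp: mat_adjoint_def mat_of_rows_index)
  have "hermitian_mat A \<longleftrightarrow> (\<forall>i<n. \<forall>j<n. mat_adjoint A $$ (i, j) = A $$ (i, j))"
    unfolding hermitian_mat_def using A adj(1) by (auto intro!: eq_matI)
  also have "\<dots> \<longleftrightarrow> (\<forall>i<n. \<forall>j<n. cnj (A $$ (j, i)) = A $$ (i, j))" by (simp add: adj(2))
  finally show ?thesis unfolding herm_on_def entry_def by (metis lessThan_iff)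
qed

lemma size_filter_map: "size {#x \<in># mset (map f [0..<n]). Q x#} = card {p. p < n \<and> Q (f p)}"
proof -
  have "size {#x \<in># mset (map f [0..<n]). Q x#} = length (filter (\<lambda>p. Q (f p)) [0..<n])"
    unfolding mset_filter[symmetric] size_mset filter_map by (simp add: comp_def)
  also have "\<dots> = card (set (filter (\<lambda>p. Q (f p)) [0..<n]))"
    by (rule distinct_card[symmetric]) simp
  also have "set (filter (\<lambda>p. Q (f p)) [0..<n]) = {p. p < n \<and> Q (f p)}" by auto
  finally show ?thesis .
qed

text \<open>The eigenvectors link roots of the characteristic polynomial to signatures of forms: as
  columns of \<open>S\<close> they diagonalise \<open>H\<close>, and as an orthogonal family they
  allow Sylvester's law for \<open>entry H\<close> and for its negative.\<close>

lemma inertia_pos_ge: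
  assumes H: "H \<in> carrier_mat n n" "hermitian_mat H" and i: "inertia H = (a, b, c)"
  shows "a + b + c = n" "pos_ge {..<n} (entry H) k \<longleftrightarrow> k \<le> c"
    "pos_ge {..<n} (\<lambda>i j. - entry H i j) k \<longleftrightarrow> k \<le> a"
proof -
  let ?J = "{..<n}" and ?M = "entry H"
  have h: "herm_on ?J ?M" using hermitian_mat_iff[OF H(1)] H(2) by simp
  obtain U l where U: "orth_pos ?J id_form U" "card U = card ?J"
    "\<And>u a. u \<in> U \<Longrightarrow> a \<in> ?J \<Longrightarrow> mult_vec ?J ?M u a = of_real (l u) * u a"
    using orthogonal_eigenvectors[OF _ h] by auto
  have fU: "finite U" using U(1) by (simp add: orth_pos_def)
  obtain e where e: "bij_betw e {..<n} U"
    using ex_bij_betw_nat_finite[OF fU] U(2) by (auto simp: atLeast0LessThan)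
  have eU: "e p \<in> U" if "p < n" for p using e that by (auto simp: bij_betw_def)
  have einj: "e p \<noteq> e q" if "p < n" "q < n" "p \<noteq> q" for p q
    using e that by (auto simp: bij_betw_def inj_on_def)
  define N where "N = (\<lambda>p. sform ?J id_form (e p) (e p))"
  have N: "0 < Re (N p)" "Im (N p) = 0" if "p < n" for p
    using U(1) eU[OF that] sform_real[OF herm_id] by (auto simp: orth_pos_def N_def)
  have N0: "N p \<noteq> 0" if "p < n" for p using N(1)[OF that] by auto
  have oid: "sform ?J id_form (e p) (e q) = 0" if "p < n" "q < n" "p \<noteq> q" for p q
    using U(1) eU einj that by (auto simp: orth_pos_def)
  have sM: "sform ?J ?M (e p) (e q) = of_real (l (e q)) * sform ?J id_form (e p) (e q)" if "q < n" for p q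
  proof -
    have "sform ?J ?M (e p) (e q) = sform ?J id_form (e p) (\<lambda>a. of_real (l (e q)) * e q a)"
      using U(3) eU[OF that]
      by (subst sform_id_mult_vec[OF finite_lessThan, symmetric], intro sform_cong) auto
    then show ?thesis by (simp add: sform_scale_right)
  qed
  define S where "S = mat n n (\<lambda>(a, p). e p a)"
  \<comment> \<open>The inverse of \<open>S\<close>; the eigenvectors are not normalised, hence the
    division by \<open>N p\<close>.\<close>
  define Q where "Q = mat n n (\<lambda>(p, a). cnj (e p a) / N p)"
  define D where "D = mat n n (\<lambda>(p, q). if p = q then of_real (l (e p)) else 0 :: complex)"
  have car: "S \<in> carrier_mat n n" "Q \<in> carrier_mat n n" "D \<in> carrier_mat n n"
    by (simp_all add: S_def Q_def D_def)
  have QS: "Q * S = 1\<^sub>m n"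
  proof (rule eq_matI)
    fix p q assume "p < dim_row (1\<^sub>m n)" "q < dim_col (1\<^sub>m n)"
    then have pq: "p < n" "q < n" by auto
    have "(Q * S) $$ (p, q) = (\<Sum>a<n. cnj (e p a) / N p * e q a)"
      using pq by (simp add: Q_def S_def scalar_prod_def atLeast0LessThan)
    also have "\<dots> = sform ?J id_form (e p) (e q) / N p"
      by (simp add: sform_id sum_divide_distrib)
    also have "\<dots> = 1\<^sub>m n $$ (p, q)" using pq oid N0 by (auto simp: N_def)
    finally show "(Q * S) $$ (p, q) = 1\<^sub>m n $$ (p, q)" .
  qed (use car in auto)
  have SQ: "S * Q = 1\<^sub>m n" by (rule mat_mult_left_right_inverse[OF car(2,1) QS])
  have HS: "H * S = S * D"
  proof (rule eq_matI)
    fix a q assume "a < dim_row (S * D)" "q < dim_col (S * D)"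
    then have aq: "a < n" "q < n" using car by auto
    have "(H * S) $$ (a, q) = mult_vec ?J ?M (e q) a"
      using aq H(1) by (simp add: S_def scalar_prod_def atLeast0LessThan mult_vec_def entry_def)
    also have "\<dots> = of_real (l (e q)) * e q a" using U(3) eU aq by simp
    also have "\<dots> = (\<Sum>p<n. if p = q then of_real (l (e q)) * e q a else 0)" using aq by simp
    also have "\<dots> = (\<Sum>p<n. e p a * (if p = q then of_real (l (e p)) else 0))"
      by (intro sum.cong) auto
    also have "\<dots> = (S * D) $$ (a, q)"
      using aq by (simp add: S_def D_def scalar_prod_def atLeast0LessThan)
    finally show "(H * S) $$ (a, q) = (S * D) $$ (a, q)" .
  qed (use car H in auto)
  have "H = H * (S * Q)" using SQ H(1) by simp
  also have "\<dots> = (H * S) * Q" using H(1) car by (simp add: assoc_mult_mat[of _ n n])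
  finally have "H = S * D * Q" unfolding HS .
  then have "similar_mat_wit H D S Q" by (rule similar_mat_witI[OF SQ QS _ H(1) car(3,1,2)])
  then have "char_poly H = char_poly D" by (intro char_poly_similar) (auto simp: similar_mat_def)
  also have "\<dots> = (\<Prod>a\<leftarrow>diag_mat D. [:- a, 1:])"
    by (rule char_poly_upper_triangular[OF car(3)]) (auto simp: D_def)
  also have "diag_mat D = map (\<lambda>p. of_real (l (e p))) [0..<n]"
    using car by (auto simp: diag_mat_def D_def)
  finally have cp: "char_poly H = (\<Prod>a\<leftarrow>map (\<lambda>p. of_real (l (e p))) [0..<n]. [:- a, 1:])" .
  have proots: "proots (\<Prod>a\<leftarrow>as. [:- a, 1:]) = mset as" for as :: "complex list"
  proof (induction as)
    case (Cons a as)
    have "(\<Prod>a\<leftarrow>as. [:- a, 1:]) \<noteq> (0 :: complex poly)" by (auto simp: prod_list_zero_iff)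
    then show ?case using Cons by (simp add: proots_mult del: mult_pCons_left)
  qed simp
  have in': "inertia H = (card {p. p < n \<and> l (e p) < 0}, card {p. p < n \<and> l (e p) = 0}, card {p. p < n \<and> 0 < l (e p)})"
    unfolding inertia_def cp proots size_filter_map by (simp add: less_complex_def)
  then have abc: "a = card {p. p < n \<and> l (e p) < 0}" "b = card {p. p < n \<and> l (e p) = 0}" "c = card {p. p < n \<and> 0 < l (e p)}"
    using i by auto
  have "card {..<n} = a + b + c"
  proof -
    have "{..<n} = ({p. p < n \<and> l (e p) < 0} \<union> {p. p < n \<and> l (e p) = 0}) \<union> {p. p < n \<and> 0 < l (e p)}" by auto
    moreover have "card ({p. p < n \<and> l (e p) < 0} \<union> {p. p < n \<and> l (e p) = 0}) = a + b"
      unfolding abc by (rule card_Un_disjoint) auto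
    moreover have "card (({p. p < n \<and> l (e p) < 0} \<union> {p. p < n \<and> l (e p) = 0}) \<union> {p. p < n \<and> 0 < l (e p)}) =
        card ({p. p < n \<and> l (e p) < 0} \<union> {p. p < n \<and> l (e p) = 0}) + c"
      unfolding abc by (rule card_Un_disjoint) auto
    ultimately show ?thesis by simp
  qed
  then show "a + b + c = n" by simp
  have indep: "\<forall>p\<in>{..<n}. g p = 0" if g: "\<And>a. a \<in> ?J \<Longrightarrow> (\<Sum>p\<in>{..<n}. g p * e p a) = 0" for g
  proof
    fix q assume q: "q \<in> {..<n}"
    have "0 = sform ?J id_form (e q) (lincomb {..<n} g e)" using g by (simp add: sform_id)
    also have "\<dots> = (\<Sum>p<n. if p = q then g q * N q else 0)"
      unfolding sform_sum_right using oid q by (intro sum.cong) (auto simp: N_def)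
    finally show "g q = 0" using q N0 by simp
  qed
  have pos: "qform ?J ?M (e p) = l (e p) * Re (N p)" if "p < n" for p
    using sM[OF that, of p] by (simp add: N_def)
  have sg: "0 < qform ?J ?M (e p) \<longleftrightarrow> 0 < l (e p)" "qform ?J ?M (e p) < 0 \<longleftrightarrow> l (e p) < 0"
    if "p < n" for p
    unfolding pos[OF that] using N(1)[OF that] by (simp_all add: zero_less_mult_iff mult_less_0_iff)
  have c: "{p \<in> {..<n}. 0 < qform ?J ?M (e p)} = {p. p < n \<and> 0 < l (e p)}"
    using sg(1) by auto
  show "pos_ge ?J ?M k \<longleftrightarrow> k \<le> c" unfolding abc(3) c[symmetric]
    by (rule pos_ge_iff_orthogonal_family[OF _ _ _ indep]) (simp_all add: sM oid)
  have neg: "sform ?J (\<lambda>i j. - ?M i j) u v = - sform ?J ?M u v" for u v by (simp add: sform_def sum_negf)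
  have a: "{p \<in> {..<n}. 0 < qform ?J (\<lambda>i j. - ?M i j) (e p)} = {p. p < n \<and> l (e p) < 0}"
    unfolding neg using sg(2) by auto
  show "pos_ge ?J (\<lambda>i j. - ?M i j) k \<longleftrightarrow> k \<le> a"
    unfolding abc(1) a[symmetric]
    by (rule pos_ge_iff_orthogonal_family[OF _ _ _ indep]) (simp_all add: neg sM oid)
qed

section \<open>Two qutrits\<close>


abbreviation grid :: "(nat \<times> nat) set" where
  "grid \<equiv> {..<3} \<times> {..<3}"

definition idx :: "nat \<times> nat \<Rightarrow> nat" where
  "idx a = fst a * 3 + snd a"

definition pair_entry :: "complex mat \<Rightarrow> nat \<times> nat \<Rightarrow> nat \<times> nat \<Rightarrow> complex" where
  "pair_entry \<rho> a b = entry \<rho> (idx a) (idx b)"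

lemma bij_idx: "bij_betw idx grid {..<9}"
proof (rule bij_betwI[where g = "\<lambda>s. (s div 3, s mod 3)"])
  show "idx \<in> grid \<rightarrow> {..<9}" by (auto simp: idx_def)
  show "(\<lambda>s. (s div 3, s mod 3)) \<in> {..<9} \<rightarrow> grid" by auto
qed (auto simp: idx_def)

lemma pos_ge_reindex_iff:
  assumes b: "bij_betw f J' J"
  shows "pos_ge J' (\<lambda>a b. M (f a) (f b)) k \<longleftrightarrow> pos_ge J M k"
proof
  show "pos_ge J M k" if "pos_ge J' (\<lambda>a b. M (f a) (f b)) k" using pos_ge_reindex[OF b that] .
  show "pos_ge J' (\<lambda>a b. M (f a) (f b)) k" if "pos_ge J M k"
    by (rule pos_ge_transfer[OF that, of _ _ "\<lambda>u a. u (f a)"]) (rule sform_reindex[OF b])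
qed

lemma pos_ge_cong:
  assumes "\<And>a b. a \<in> J \<Longrightarrow> b \<in> J \<Longrightarrow> M a b = M' a b" shows "pos_ge J M k \<longleftrightarrow> pos_ge J M' k"
proof -
  have "sform J M = sform J M'" using assms by (intro ext sform_cong) auto
  then show ?thesis by (simp add: pos_ge_def orth_pos_def)
qed

lemma herm_on_cong:
  assumes "\<And>a b. a \<in> J \<Longrightarrow> b \<in> J \<Longrightarrow> M a b = M' a b" shows "herm_on J M \<longleftrightarrow> herm_on J M'"
  unfolding herm_on_def by (intro ball_cong refl) (simp add: assms)

lemma partial_transpose_entry:
  assumes "a \<in> grid" "b \<in> grid"
  shows "entry (partial_transpose 3 3 \<rho>) (idx a) (idx b) = pt (pair_entry \<rho>) a b"
  using assms by (auto simp: entry_def partial_transpose_def mat_block_def idx_def pair_entry_def)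

lemma sform_entry:
  assumes "A \<in> carrier_mat n n"
  shows "sform {..<n} (entry A) v v = (A *\<^sub>v vec n v) \<bullet>c vec n v" using assms
  by (simp add: sform_def scalar_prod_def entry_def atLeast0LessThan sum_distrib_right sum_distrib_left mult_ac)

lemma psd_mat_iff:
  assumes A: "A \<in> carrier_mat n n"
  shows "psd_mat A \<longleftrightarrow> hermitian_mat A \<and> (\<forall>v. 0 \<le> qform {..<n} (entry A) v)"
proof (cases "hermitian_mat A")
  case True
  have h: "herm_on {..<n} (entry A)" using hermitian_mat_iff[OF A] True by simp
  have "0 \<le> (A *\<^sub>v v) \<bullet>c v \<longleftrightarrow> 0 \<le> qform {..<n} (entry A) (\<lambda>i. v $ i)" if "v \<in> carrier_vec n" for v
  proof -
    have "vec n (\<lambda>i. v $ i) = v" using that by auto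
    then show ?thesis using sform_entry[OF A, of "\<lambda>i. v $ i"] sform_real[OF h, of "\<lambda>i. v $ i"]
      by (simp add: less_eq_complex_def)
  qed
  moreover have "sform {..<n} (entry A) v v = sform {..<n} (entry A) (\<lambda>i. vec n v $ i) (\<lambda>i. vec n v $ i)" for v
    by (intro sform_cong) auto
  ultimately show ?thesis using True A unfolding psd_mat_def by (metis carrier_matD(1) vec_carrier)
qed (simp add: psd_mat_def)

lemma herm_on_reindex_iff:
  assumes "bij_betw f J' J"
  shows "herm_on J' (\<lambda>a b. M (f a) (f b)) \<longleftrightarrow> herm_on J M"
proof -
  have "J = f ` J'" using assms by (auto simp: bij_betw_def)
  then show ?thesis by (simp add: herm_on_def)
qed

lemma psd_mat_iff_grid:
  assumes "\<rho> \<in> carrier_mat 9 9"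
  shows "psd_mat \<rho> \<longleftrightarrow> psd_on grid (pair_entry \<rho>)"
proof -
  have e: "pair_entry \<rho> = (\<lambda>a b. entry \<rho> (idx a) (idx b))" by (simp add: fun_eq_iff pair_entry_def)
  have s: "sform {..<9} (entry \<rho>) v v = sform grid (pair_entry \<rho>) (\<lambda>a. v (idx a)) (\<lambda>a. v (idx a))" for v
    unfolding e by (rule sform_reindex[OF bij_idx, symmetric])
  have s': "sform grid (pair_entry \<rho>) v v = sform {..<9} (entry \<rho>) (\<lambda>i. v (the_inv_into grid idx i)) (\<lambda>i. v (the_inv_into grid idx i))" for v
  proof -
    have "sform grid (pair_entry \<rho>) v v = sform grid (pair_entry \<rho>)
        (\<lambda>a. v (the_inv_into grid idx (idx a))) (\<lambda>a. v (the_inv_into grid idx (idx a)))"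
      using bij_idx by (intro sform_cong) (simp_all add: the_inv_into_f_f bij_betw_def)
    then show ?thesis by (simp add: s)
  qed
  have "herm_on grid (pair_entry \<rho>) \<longleftrightarrow> herm_on {..<9} (entry \<rho>)"
    unfolding e by (rule herm_on_reindex_iff[OF bij_idx])
  moreover have "(\<forall>v. 0 \<le> qform {..<9} (entry \<rho>) v) \<longleftrightarrow> (\<forall>v. 0 \<le> qform grid (pair_entry \<rho>) v)"
    using s s' by metis
  ultimately show ?thesis unfolding psd_mat_iff[OF assms] hermitian_mat_iff[OF assms] psd_on_def by simp
qed

lemma inertia_partial_transpose:
  assumes \<rho>: "\<rho> \<in> carrier_mat 9 9" and h: "herm_on grid (pair_entry \<rho>)"
    and i: "inertia (partial_transpose 3 3 \<rho>) = (a, b, c)"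
  shows "a + b + c = 9" "pos_ge grid (pt (pair_entry \<rho>)) k \<longleftrightarrow> k \<le> c"
    "pos_ge grid (\<lambda>x y. - pt (pair_entry \<rho>) x y) k \<longleftrightarrow> k \<le> a"
    "1 \<le> a \<longleftrightarrow> (\<exists>x. eigenvalue (partial_transpose 3 3 \<rho>) x \<and> x < 0)"
proof -
  define H where "H = partial_transpose 3 3 \<rho>"
  have H: "H \<in> carrier_mat 9 9" using partial_transpose_carrier[of 3 3 \<rho>] by (simp add: H_def)
  have e: "entry H (idx x) (idx y) = pt (pair_entry \<rho>) x y" if "x \<in> grid" "y \<in> grid" for x y
    unfolding H_def by (rule partial_transpose_entry[OF that])
  have "herm_on grid (pt (pair_entry \<rho>))" by (rule herm_on_pt[OF h])
  then have "herm_on grid (\<lambda>x y. entry H (idx x) (idx y))"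
    using herm_on_cong[of grid "\<lambda>x y. entry H (idx x) (idx y)" "pt (pair_entry \<rho>)"] e by blast
  then have hH: "hermitian_mat H"
    unfolding hermitian_mat_iff[OF H] by (simp only: herm_on_reindex_iff[OF bij_idx])
  note in_H = inertia_pos_ge[OF H hH i[folded H_def]]
  show "a + b + c = 9" by (rule in_H(1))
  show "pos_ge grid (pt (pair_entry \<rho>)) k \<longleftrightarrow> k \<le> c"
    unfolding in_H(2)[symmetric] pos_ge_reindex_iff[OF bij_idx, symmetric] by (intro pos_ge_cong) (simp only: e)
  show "pos_ge grid (\<lambda>x y. - pt (pair_entry \<rho>) x y) k \<longleftrightarrow> k \<le> a"
    unfolding in_H(3)[symmetric] pos_ge_reindex_iff[OF bij_idx, symmetric] by (intro pos_ge_cong) (simp only: e)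
  have "char_poly H \<noteq> 0" using degree_monic_char_poly[OF H] by auto
  then have r: "x \<in># proots (char_poly H) \<longleftrightarrow> eigenvalue H x" for x
    by (simp add: eigenvalue_root_char_poly[OF H])
  have "a = size {#x \<in># proots (char_poly H). x < 0#}" using i by (simp add: inertia_def H_def)
  then have "1 \<le> a \<longleftrightarrow> {#x \<in># proots (char_poly H). x < 0#} \<noteq> {#}"
    by (metis One_nat_def Suc_le_eq nonempty_has_size)
  also have "\<dots> \<longleftrightarrow> (\<exists>x. x \<in># proots (char_poly H) \<and> x < 0)"
    by (auto simp: filter_mset_eq_conv multiset_eq_iff)
  finally show "1 \<le> a \<longleftrightarrow> (\<exists>x. eigenvalue (partial_transpose 3 3 \<rho>) x \<and> x < 0)"
    unfolding H_def[symmetric] by (simp only: r)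
qed

lemma npt_inertias_subset:
  "npt_inertias 3 3 \<subseteq>
    {(1,0,8), (1,1,7), (1,2,6), (1,3,5), (1,4,4), (1,5,3),
     (2,0,7), (2,1,6), (2,2,5), (2,3,4),
     (3,0,6), (3,1,5),
     (4,0,5)}"
proof
  fix t assume "t \<in> npt_inertias 3 3"
  then obtain \<rho> where \<rho>: "t = inertia (partial_transpose 3 3 \<rho>)" "\<rho> \<in> carrier_mat 9 9" "psd_mat \<rho>"
    "\<exists>x. eigenvalue (partial_transpose 3 3 \<rho>) x \<and> x < 0"
    unfolding npt_inertias_def by auto
  obtain a b c where t: "t = (a, b, c)" by (cases t)
  let ?r = "pair_entry \<rho>"
  have psd: "psd_on grid ?r" using psd_mat_iff_grid[OF \<rho>(2)] \<rho>(3) by simp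
  have h: "herm_on grid ?r" by (rule psd_on_herm[OF psd])
  note pt_inertia = inertia_partial_transpose[OF \<rho>(2) h, of a b c, folded \<rho>(1), OF t]
  have "neg_ge grid (pt ?r) a"
    using pt_inertia(3) by (intro neg_ge_of_orth_pos[OF herm_on_pt[OF h]]) simp
  then have n: "neg_ge grid (pt ?r) k" if "k \<le> a" for k using that by (rule neg_ge_mono)
  have "(neg_ge grid (pt ?r) 1 \<longrightarrow> pos_ge grid (pt ?r) 3) \<and> (neg_ge grid (pt ?r) 2 \<longrightarrow> pos_ge grid (pt ?r) 4) \<and>
      (neg_ge grid (pt ?r) 3 \<longrightarrow> pos_ge grid (pt ?r) 5)"
    by (rule pos_ge_3_3[OF _ _ psd]) simp_all
  then have c: "1 \<le> a \<Longrightarrow> 3 \<le> c" "2 \<le> a \<Longrightarrow> 4 \<le> c" "3 \<le> a \<Longrightarrow> 5 \<le> c"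
    using n pt_inertia(2) by auto
  have "1 \<le> a" using pt_inertia(4) \<rho>(4) by simp
  have "a + b + c = 9" by (rule pt_inertia(1))
  then show "t \<in> {(1,0,8), (1,1,7), (1,2,6), (1,3,5), (1,4,4), (1,5,3), (2,0,7), (2,1,6), (2,2,5), (2,3,4),
     (3,0,6), (3,1,5), (4,0,5)}"
    unfolding t using \<open>1 \<le> a\<close> c by (simp, presburger)
qed

section \<open>Integer states realising the listed inertias\<close>

definition cells :: "(nat \<times> nat) list" where
  "cells = List.product [0, 1, 2] [0, 1, 2]"

definition amp :: "((nat \<times> nat) \<times> int) list \<Rightarrow> nat \<times> nat \<Rightarrow> int" where
  "amp w a = (case map_of w a of None \<Rightarrow> 0 | Some x \<Rightarrow> x)"

text \<open>Integer Gram matrices are positive semidefinite by construction, and conditions on their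
  entries can be decided by evaluation.\<close>

definition gram :: "((nat \<times> nat) \<times> int) list list \<Rightarrow> nat \<times> nat \<Rightarrow> nat \<times> nat \<Rightarrow> int" where
  "gram ws a b = (\<Sum>w\<leftarrow>ws. amp w a * amp w b)"

definition gram_pt :: "((nat \<times> nat) \<times> int) list list \<Rightarrow> nat \<times> nat \<Rightarrow> nat \<times> nat \<Rightarrow> int" where
  "gram_pt ws a b = gram ws (fst b, snd a) (fst a, snd b)"

text \<open>For a coupled index this is the determinant of its block rather than the Schur
  complement: the pivot is positive, so the signs agree and the value stays an integer.\<close>

definition pivot_sign :: "((nat \<times> nat) \<times> int) list list \<Rightarrow> ((nat \<times> nat) \<times> (nat \<times> nat)) list \<Rightarrow> nat \<times> nat \<Rightarrow> int" where
  "pivot_sign ws ms a = (case map_of ms a of None \<Rightarrow> gram_pt ws a a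
     | Some c \<Rightarrow> gram_pt ws a a * gram_pt ws c c - gram_pt ws c a * gram_pt ws c a)"

text \<open>\<open>ws\<close> are the vectors spanning the state, and the pairs in \<open>ms\<close> say which indices are coupled
  by the partial transpose: each \<open>(b, c)\<close> gives a \<open>2 \<times> 2\<close> block, with positive pivot \<open>c\<close>.\<close>

definition block_matching :: "((nat \<times> nat) \<times> int) list list \<Rightarrow> ((nat \<times> nat) \<times> (nat \<times> nat)) list \<Rightarrow> bool" where
  "block_matching ws ms \<longleftrightarrow> distinct (map fst ms @ map snd ms) \<and>
     list_all (\<lambda>(b, c). b \<in> set cells \<and> c \<in> set cells \<and> 0 < gram_pt ws c c) ms \<and>
     list_all (\<lambda>a. list_all (\<lambda>b. a = b \<or> map_of ms b = Some a \<or> map_of ms a = Some b \<or> gram_pt ws a b = 0) cells) cells"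

lemma set_cells: "set cells = grid"
proof -
  have "{..<3} = {0, 1, 2 :: nat}" by auto
  then show ?thesis by (simp add: cells_def)
qed

lemma gram_sym: "gram ws a b = gram ws b a" by (simp add: gram_def mult.commute)

lemma psd_on_gram: "psd_on J (\<lambda>a b. of_int (gram ws a b))" unfolding psd_on_def
proof (intro conjI allI)
  show "herm_on J (\<lambda>a b. of_int (gram ws a b))" by (auto simp: herm_on_def gram_sym)
  show "0 \<le> qform J (\<lambda>a b. of_int (gram ws a b)) v" for v
  proof (induction ws)
    case (Cons w ws)
    define x where "x = (\<Sum>a\<in>J. of_int (amp w a) * v a)"
    have "sform J (\<lambda>a b. of_int (gram (w # ws) a b)) v v =
        sform J (\<lambda>a b. of_int (amp w a) * of_int (amp w b)) v v + sform J (\<lambda>a b. of_int (gram ws a b)) v v"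
      by (simp add: sform_def gram_def algebra_simps sum.distrib)
    also have "sform J (\<lambda>a b. of_int (amp w a) * of_int (amp w b)) v v = cnj x * x"
      unfolding sform_def x_def cnj_sum sum_product by (intro sum.cong refl) (simp add: mult_ac)
    finally show ?case using Cons by (simp add: mult.commute[of "cnj _"] complex_mult_cnj)
  qed (simp add: sform_def gram_def)
qed

text \<open>Blocks of size at most two are diagonalised by removing from each coupled axis its
  component along the pivot; Sylvester's law then reads off the inertia from the signs.\<close>

lemma matching_inertia:
  assumes bm: "block_matching ws ms" and neg: "\<exists>a\<in>grid. pivot_sign ws ms a < 0"
  defines "n \<equiv> card {a \<in> grid. pivot_sign ws ms a < 0}" and "p \<equiv> card {a \<in> grid. 0 < pivot_sign ws ms a}"
  shows "(n, 9 - n - p, p) \<in> npt_inertias 3 3"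
proof -
  define r where "r = (\<lambda>a b. of_int (gram ws a b) :: complex)"
  define \<rho> where "\<rho> = mat 9 9 (\<lambda>(s, t). r (s div 3, s mod 3) (t div 3, t mod 3))"
  have \<rho>: "\<rho> \<in> carrier_mat 9 9" by (simp add: \<rho>_def)
  have pe: "pair_entry \<rho> a b = r a b" if "a \<in> grid" "b \<in> grid" for a b
    using that by (auto simp: pair_entry_def entry_def \<rho>_def idx_def)
  have psd: "psd_on grid (pair_entry \<rho>)"
  proof -
    have "psd_on grid r" unfolding r_def by (rule psd_on_gram)
    moreover have "sform grid (pair_entry \<rho>) v v = sform grid r v v" for v by (intro sform_cong pe refl)
    ultimately show ?thesis using herm_on_cong[of grid "pair_entry \<rho>" r] pe by (simp add: psd_on_def)
  qed
  define M where "M = (\<lambda>a b. of_int (gram_pt ws a b) :: complex)"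
  have ptM: "pt (pair_entry \<rho>) a b = M a b" if "a \<in> grid" "b \<in> grid" for a b
  proof -
    have "pt (pair_entry \<rho>) a b = r (fst b, snd a) (fst a, snd b)"
      unfolding pt_def using that by (intro pe) auto
    then show ?thesis by (simp add: r_def M_def gram_pt_def)
  qed
  have dist: "distinct (map fst ms)" "distinct (map snd ms)" "fst ` set ms \<inter> snd ` set ms = {}"
    using bm by (auto simp: block_matching_def)
  define m where "m = map_of ms"
  have m_in: "(b, c) \<in> set ms" if "m b = Some c" for b c using that by (simp add: m_def map_of_SomeD)
  have m_c: "m c = None" if "m b = Some c" for b c
    using m_in[OF that] dist(3) unfolding m_def map_of_eq_None_iff by force
  have m_inj: "b = b'" if "m b = Some c" "m b' = Some c" for b b' c
  proof -
    have "inj_on snd (set ms)" using dist(2) by (simp add: distinct_map)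
    then show ?thesis using m_in[OF that(1)] m_in[OF that(2)] by (metis inj_onD prod.inject snd_conv)
  qed
  have m_grid: "b \<in> grid" "c \<in> grid" "0 < gram_pt ws c c" if "m b = Some c" for b c
    using m_in[OF that] bm by (auto simp: block_matching_def list_all_iff set_cells)
  have Mz: "M a b = 0" if "a \<in> grid" "b \<in> grid" "a \<noteq> b" "m b \<noteq> Some a" "m a \<noteq> Some b" for a b
  proof -
    have "\<forall>a\<in>grid. \<forall>b\<in>grid. a = b \<or> map_of ms b = Some a \<or> map_of ms a = Some b \<or> gram_pt ws a b = 0"
      using bm unfolding block_matching_def list_all_iff set_cells by blast
    then have "gram_pt ws a b = 0" using that unfolding m_def by blast
    then show ?thesis using that by (simp add: M_def)
  qed
  have Ms: "M a b = M b a" for a b by (auto simp: M_def gram_pt_def gram_sym)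
  have Mr: "cnj (M a b) = M a b" for a b by (simp add: M_def)
  define \<mu> where "\<mu> = (\<lambda>p c. M c p / M c c)"
  have \<mu>r: "cnj (\<mu> p c) = \<mu> p c" for p c by (simp add: \<mu>_def Mr)
  define S where "S = (\<lambda>p. case m p of None \<Rightarrow> axis p | Some c \<Rightarrow> (\<lambda>x. axis p x - \<mu> p c * axis c x))"
  have Mc: "M c c \<noteq> 0" if "m b = Some c" for b c using m_grid(3)[OF that] by (simp add: M_def)
  have orth: "sform grid M (S p) (S q) = 0" if pq: "p \<in> grid" "q \<in> grid" "p \<noteq> q" for p q
  proof (cases "m p"; cases "m q")
    assume "m p = None" "m q = None"
    then show ?thesis using pq by (simp add: S_def sform_axis Mz)
  next
    fix c assume p: "m p = None" and q: "m q = Some c"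
    have "sform grid M (S p) (S q) = M p q - \<mu> q c * M p c"
      using pq m_grid(2)[OF q] by (simp add: S_def p q sform_linear sform_axis)
    also have "\<dots> = 0"
    proof (cases "p = c")
      case True
      then show ?thesis using Mc[OF q] by (simp add: \<mu>_def)
    next
      case False
      then show ?thesis using pq p q m_c[OF q] m_grid(2)[OF q] by (simp add: Mz)
    qed
    finally show ?thesis .
  next
    fix c assume p: "m p = Some c" and q: "m q = None"
    have "sform grid M (S p) (S q) = M p q - \<mu> p c * M c q"
      using pq m_grid(2)[OF p] by (simp add: S_def p q sform_linear sform_axis \<mu>r)
    also have "\<dots> = 0"
    proof (cases "q = c")
      case True
      then show ?thesis using Mc[OF p] by (simp add: \<mu>_def Ms[of p c])
    next
      case False
      then show ?thesis using pq p q m_c[OF p] m_grid(2)[OF p] by (simp add: Mz)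
    qed
    finally show ?thesis .
  next
    fix c d assume p: "m p = Some c" and q: "m q = Some d"
    have cd: "c \<noteq> d" using m_inj[OF p] q pq by blast
    have g: "c \<in> grid" "d \<in> grid" using m_grid(2) p q by auto
    have n: "m c = None" "m d = None" using m_c p q by auto
    have ne: "p \<noteq> d" "d \<noteq> p" "q \<noteq> c" "c \<noteq> q" using n p q by auto
    have "M p q = 0" "M p d = 0" "M c q = 0" "M c d = 0"
      using pq g cd ne by (simp_all add: Mz n p q)
    then show ?thesis using pq g by (simp add: S_def p q sform_linear sform_axis)
  qed
  have indep: "\<forall>p\<in>grid. g p = 0" if g: "\<And>a. a \<in> grid \<Longrightarrow> (\<Sum>p\<in>grid. g p * S p a) = 0" for g
  proof -
    \<comment> \<open>The family is triangular: a coupled index is never a pivot, so its coefficient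
      can be read off its own coordinate, and afterwards the remaining ones.\<close>
    have N: "g p = 0" if p: "p \<in> grid" "m p = Some c" for p c
    proof -
      have "S q p = axis q p" for q
        using m_c[of q p] p(2) by (auto simp: S_def split: option.splits)
      then have "(\<Sum>q\<in>grid. g q * S q p) = g p" using p(1) by (simp add: sum_axis)
      then show ?thesis using g[OF p(1)] by simp
    qed
    have "g p = 0" if p: "p \<in> grid" "m p = None" for p
    proof -
      have "(\<Sum>q\<in>grid. g q * S q p) = (\<Sum>q\<in>grid. g q * axis q p)"
        using N by (intro sum.cong refl) (auto simp: S_def split: option.splits)
      also have "\<dots> = g p" using p(1) by (intro sum_axis) auto
      finally show ?thesis using g[OF p(1)] by simp
    qed
    then show ?thesis using N by (metis option.exhaust)
  qed
  have val: "qform grid M (S p) =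
      (case m p of None \<Rightarrow> of_int (pivot_sign ws ms p)
       | Some c \<Rightarrow> of_int (pivot_sign ws ms p) / of_int (gram_pt ws c c))" if p: "p \<in> grid" for p
  proof (cases "m p")
    case None
    then show ?thesis using p by (simp add: S_def sform_axis M_def pivot_sign_def m_def)
  next
    case (Some c)
    have "sform grid M (S p) (S p) = M p p - \<mu> p c * M p c - \<mu> p c * (M c p - \<mu> p c * M c c)"
      using p m_grid(2)[OF Some] by (simp add: S_def Some sform_linear sform_axis \<mu>r algebra_simps)
    also have "\<dots> = M p p - M c p * M c p / M c c"
      using Mc[OF Some] by (simp add: \<mu>_def Ms[of p c])
    also have "\<dots> = of_int (gram_pt ws p p) - of_int (gram_pt ws c p * gram_pt ws c p) / of_int (gram_pt ws c c)"
      by (simp add: M_def)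
    also have "\<dots> = of_real (of_int (pivot_sign ws ms p) / of_int (gram_pt ws c c))"
      using m_grid(3)[OF Some] Some by (simp add: pivot_sign_def m_def field_simps)
    finally show ?thesis by (simp add: Some)
  qed
  have sg: "0 < qform grid M (S p) \<longleftrightarrow> 0 < pivot_sign ws ms p"
    "qform grid M (S p) < 0 \<longleftrightarrow> pivot_sign ws ms p < 0" if "p \<in> grid" for p
    unfolding val[OF that] using m_grid(3)[of p]
    by (cases "m p"; auto simp: zero_less_divide_iff divide_less_0_iff)+
  obtain a b c where abc: "inertia (partial_transpose 3 3 \<rho>) = (a, b, c)" by (metis prod_cases3)
  note inr = inertia_partial_transpose[OF \<rho> psd_on_herm[OF psd] abc]
  have fin: "finite grid" by simp
  have "{p \<in> grid. 0 < qform grid M (S p)} = {p \<in> grid. 0 < pivot_sign ws ms p}"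
    using sg(1) by auto
  moreover have "pos_ge grid M k \<longleftrightarrow> k \<le> card {p \<in> grid. 0 < qform grid M (S p)}" for k
    by (rule pos_ge_iff_orthogonal_family[OF fin fin refl indep orth])
  moreover have "pos_ge grid (pt (pair_entry \<rho>)) k \<longleftrightarrow> pos_ge grid M k" for k
    by (rule pos_ge_cong[OF ptM])
  ultimately have kc: "k \<le> c \<longleftrightarrow> k \<le> p" for k
    unfolding inr(2)[symmetric] p_def by simp
  have c: "c = p" by (rule antisym[OF iffD1[OF kc order_refl] iffD2[OF kc order_refl]])
  have ng: "sform grid (\<lambda>x y. - M x y) u v = - sform grid M u v" for u v by (simp add: sform_def sum_negf)
  have orth': "sform grid (\<lambda>x y. - M x y) (S p) (S q) = 0" if "p \<in> grid" "q \<in> grid" "p \<noteq> q" for p q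
    unfolding ng using orth[OF that] by simp
  have "{p \<in> grid. 0 < qform grid (\<lambda>x y. - M x y) (S p)} = {p \<in> grid. pivot_sign ws ms p < 0}"
    unfolding ng using sg(2) by auto
  moreover have "pos_ge grid (\<lambda>x y. - M x y) k \<longleftrightarrow>
      k \<le> card {p \<in> grid. 0 < qform grid (\<lambda>x y. - M x y) (S p)}" for k
    by (rule pos_ge_iff_orthogonal_family[OF fin fin refl indep orth'])
  moreover have "pos_ge grid (\<lambda>x y. - pt (pair_entry \<rho>) x y) k \<longleftrightarrow> pos_ge grid (\<lambda>x y. - M x y) k" for k
    by (rule pos_ge_cong) (simp only: ptM)
  ultimately have ka: "k \<le> a \<longleftrightarrow> k \<le> n" for k
    unfolding inr(3)[symmetric] n_def by simp
  have a: "a = n" by (rule antisym[OF iffD1[OF ka order_refl] iffD2[OF ka order_refl]])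
  have b: "b = 9 - n - p" using inr(1) a c by simp
  have "{p \<in> grid. pivot_sign ws ms p < 0} \<noteq> {}" using neg by blast
  then have "1 \<le> a" unfolding a n_def by (simp add: Suc_le_eq card_gt_0_iff)
  then have "\<exists>x. eigenvalue (partial_transpose 3 3 \<rho>) x \<and> x < 0" using inr(4) by simp
  moreover have "psd_mat \<rho>" using psd_mat_iff_grid[OF \<rho>] psd by simp
  ultimately have "(a, b, c) \<in> npt_inertias 3 3"
    unfolding npt_inertias_def using \<rho> abc by (auto intro!: exI[of _ \<rho>])
  then show ?thesis unfolding a b c .
qed

definition realizes where
  "realizes ws ms n p \<longleftrightarrow> block_matching ws ms \<and> 0 < n \<and>
     length (filter (\<lambda>a. pivot_sign ws ms a < 0) cells) = n \<and> length (filter (\<lambda>a. 0 < pivot_sign ws ms a) cells) = p"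

lemma npt_inertias_realizes:
  assumes "realizes ws ms n p" shows "(n, 9 - n - p, p) \<in> npt_inertias 3 3"
proof -
  have "distinct cells" by (simp add: cells_def)
  then have cf: "card {a \<in> grid. Q a} = length (filter Q cells)" for Q
    using distinct_card[of "filter Q cells"] by (simp add: set_cells[symmetric])
  have "card {a \<in> grid. pivot_sign ws ms a < 0} \<noteq> 0" using assms by (simp add: cf realizes_def)
  then have "{a \<in> grid. pivot_sign ws ms a < 0} \<noteq> {}" by (metis card.empty)
  then have "\<exists>a\<in>grid. pivot_sign ws ms a < 0" by blast
  then show ?thesis using matching_inertia[of ws ms] assms by (simp add: cf realizes_def)
qed

text \<open>Each product vector added to the state turns a zero eigenvalue into a positive one.\<close>

lemma realizes_1:
  "list_all (\<lambda>k. realizes ([[((0, 0), 1), ((1, 1), 1)], [((0, 1), 1)]] @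
     take k [[((0, 2), 1)], [((1, 2), 1)], [((2, 0), 1)], [((2, 1), 1)], [((2, 2), 1)]])
     [((1, 0), (0, 1))] 1 (3 + k)) [0, 1, 2, 3, 4, 5]" by code_simp

text \<open>Each of the two entangled vectors supplies the positive pivot for the block created by
  the other, so two negative directions cost only four positive ones.\<close>

lemma realizes_2:
  "list_all (\<lambda>k. realizes ([[((0, 0), 1), ((1, 1), 1)], [((0, 1), 1), ((1, 2), 1)]] @
     take k [[((2, 0), 1)], [((2, 1), 1)], [((2, 2), 1)]])
     [((1, 0), (0, 1)), ((0, 2), (1, 1))] 2 (4 + k)) [0, 1, 2, 3]" by code_simp

text \<open>The three vectors overlap in \<open>(1, 1)\<close> and occupy five cells in all. Their
  couplings land on the unoccupied cells \<open>(0, 0)\<close>, \<open>(1, 2)\<close>,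
  \<open>(2, 1)\<close>, each with its own occupied pivot, and only \<open>(2, 2)\<close> stays
  free.\<close>

lemma realizes_3:
  "list_all (\<lambda>k. realizes ([[((0, 1), 1), ((1, 0), 1)], [((1, 1), 1), ((0, 2), 1)], [((1, 1), 1), ((2, 0), 1)]] @
     take k [[((2, 2), 1)]])
     [((0, 0), (1, 1)), ((1, 2), (0, 1)), ((2, 1), (1, 0))] 3 (5 + k)) [0, 1]" by code_simp

text \<open>Only two cells are unoccupied, so two of the four blocks have positive entries on the
  whole diagonal. The amplitudes 2 make their off-diagonal entries dominate: the determinants are
  \<open>2 - 16\<close> and \<open>1 - 4\<close>.\<close>

lemma realizes_4:
  "realizes [[((0, 2), 1), ((1, 0), 1)], [((0, 2), 1), ((2, 1), 1)],
     [((0, 0), 2), ((2, 2), 2)], [((1, 1), 2), ((2, 0), 1)]]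
     [((1, 2), (0, 0)), ((0, 1), (2, 2)), ((2, 0), (0, 2)), ((1, 0), (2, 1))] 4 5" by code_simp

theorem theorem22:
  shows "npt_inertias 3 3 =
    {(1,0,8), (1,1,7), (1,2,6), (1,3,5), (1,4,4), (1,5,3),
     (2,0,7), (2,1,6), (2,2,5), (2,3,4),
     (3,0,6), (3,1,5),
     (4,0,5)}"
proof (rule antisym[OF npt_inertias_subset])
  have 1: "(1, 9 - 1 - (3 + k), 3 + k) \<in> npt_inertias 3 3" if "k \<in> {0, 1, 2, 3, 4, 5}" for k
    using that by (intro npt_inertias_realizes[OF bspec[OF realizes_1[unfolded list_all_iff]]]) simp
  have 2: "(2, 9 - 2 - (4 + k), 4 + k) \<in> npt_inertias 3 3" if "k \<in> {0, 1, 2, 3}" for k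
    using that by (intro npt_inertias_realizes[OF bspec[OF realizes_2[unfolded list_all_iff]]]) simp
  have 3: "(3, 9 - 3 - (5 + k), 5 + k) \<in> npt_inertias 3 3" if "k \<in> {0, 1}" for k
    using that by (intro npt_inertias_realizes[OF bspec[OF realizes_3[unfolded list_all_iff]]]) simp
  show "{(1,0,8), (1,1,7), (1,2,6), (1,3,5), (1,4,4), (1,5,3),
     (2,0,7), (2,1,6), (2,2,5), (2,3,4),
     (3,0,6), (3,1,5),
     (4,0,5)} \<subseteq> npt_inertias 3 3"
    using 1[of 0] 1[of 1] 1[of 2] 1[of 3] 1[of 4] 1[of 5] 2[of 0] 2[of 1] 2[of 2] 2[of 3] 3[of 0] 3[of 1]
      npt_inertias_realizes[OF realizes_4] by simp
qed

end
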